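(* Let $\lambda$ be an infinite cardinal number and let $p\in [1,\infty)$. Then every non-zero, proper closed ideal of $\mathscr{B}(c_0(\lambda))$ is of the form $\mathscr{S}_{c_0(\kappa)}(c_0(\lambda))$ for some infinite cardinal number $\kappa\leqslant\lambda$, and every non-zero, proper closed ideal of $\mathscr{B}(\ell_p(\lambda))$ is of the form $\mathscr{S}_{\ell_p(\kappa)}(\ell_p(\lambda))$ for some infinite cardinal number $\kappa\leqslant\lambda$.
   Context: Banach spaces are over a fixed scalar field, either $\mathbb{R}$ or $\mathbb{C}$. $\mathscr{B}(X)$ is the Banach algebra of bounded linear operators on $X$; ideals are two-sided. For Banach spaces $E$ and $X$, $\mathscr{S}_E(X)$ is the set of all $T\in\mathscr{B}(X)$ that are not bounded below on any copy of $E$, i.e. for which there is no subspace $E_0\subseteq X$ isomorphic (linearly homeomorphic) to $E$ and constant $c>0$ with $\|Tx\|\geqslant c\|x\|$ for all $x\in E_0$. *)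

theory Defs
  imports "HOL-Analysis.Analysis"
begin

unbundle cardinal_syntax

text \<open>
  A normed space over the scalar field \<^typ>\<open>'k\<close> (below always \<^typ>\<open>real\<close> or
  \<^typ>\<open>complex\<close>) is represented by a set of functions \<^typ>\<open>'i \<Rightarrow> 'k\<close>, with
  pointwise vector space operations, together with a norm that is meaningful on that set only.
  Carrier sets are used rather than types because the spaces depend on \<open>p\<close> and on an index set,
  and because subspaces of a space have to be treated as spaces themselves.
\<close>

record ('i, 'k) nspace =
  vecs :: "('i \<Rightarrow> 'k) set"
  nrm :: "('i \<Rightarrow> 'k) \<Rightarrow> real"

text \<open>
  In the next two definitions, a function on the index set \<open>I\<close> is identified with its extension
  by \<open>0\<close> to the whole type. Both are meant for non-empty \<open>I\<close>.
\<close>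

definition c0_space :: "'i set \<Rightarrow> ('i, 'k::real_normed_field) nspace" where
  "c0_space I =
    \<lparr>vecs = {f. (\<forall>i. i \<notin> I \<longrightarrow> f i = 0) \<and> (\<forall>\<epsilon>>0. finite {i\<in>I. \<epsilon> \<le> norm (f i)})},
     nrm = (\<lambda>f. SUP i\<in>I. norm (f i))\<rparr>"

definition lp_space :: "real \<Rightarrow> 'i set \<Rightarrow> ('i, 'k::real_normed_field) nspace" where
  "lp_space p I =
    \<lparr>vecs = {f. (\<forall>i. i \<notin> I \<longrightarrow> f i = 0) \<and> (\<lambda>i. norm (f i) powr p) summable_on I},
     nrm = (\<lambda>f. (\<Sum>\<^sub>\<infinity>i\<in>I. norm (f i) powr p) powr (1 / p))\<rparr>"

definition lin_subspace :: "('i, 'k::real_normed_field) nspace \<Rightarrow> ('i \<Rightarrow> 'k) set \<Rightarrow> bool" where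
  "lin_subspace X V \<longleftrightarrow> V \<subseteq> vecs X \<and> (\<lambda>i. 0) \<in> V \<and>
    (\<forall>f\<in>V. \<forall>g\<in>V. (\<lambda>i. f i + g i) \<in> V) \<and> (\<forall>a. \<forall>f\<in>V. (\<lambda>i. a * f i) \<in> V)"

definition subspace_of :: "('i, 'k) nspace \<Rightarrow> ('i \<Rightarrow> 'k) set \<Rightarrow> ('i, 'k) nspace" where
  "subspace_of X V = \<lparr>vecs = V, nrm = nrm X\<rparr>"

definition bounded_linear_map ::
  "('i, 'k::real_normed_field) nspace \<Rightarrow> ('j, 'k) nspace \<Rightarrow> (('i \<Rightarrow> 'k) \<Rightarrow> ('j \<Rightarrow> 'k)) \<Rightarrow> bool" where
  "bounded_linear_map X Y T \<longleftrightarrow>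
    (\<forall>f\<in>vecs X. T f \<in> vecs Y) \<and>
    (\<forall>f\<in>vecs X. \<forall>g\<in>vecs X. T (\<lambda>i. f i + g i) = (\<lambda>j. T f j + T g j)) \<and>
    (\<forall>a. \<forall>f\<in>vecs X. T (\<lambda>i. a * f i) = (\<lambda>j. a * T f j)) \<and>
    (\<exists>C. \<forall>f\<in>vecs X. nrm Y (T f) \<le> C * nrm X f)"

definition isomorphic_spaces ::
  "('i, 'k::real_normed_field) nspace \<Rightarrow> ('j, 'k) nspace \<Rightarrow> bool" where
  "isomorphic_spaces X Y \<longleftrightarrow>
    (\<exists>U. bij_betw U (vecs X) (vecs Y) \<and> bounded_linear_map X Y U \<and>
         bounded_linear_map Y X (inv_into (vecs X) U))"

type_synonym ('i, 'k) operator = "('i \<Rightarrow> 'k) \<Rightarrow> ('i \<Rightarrow> 'k)"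

text \<open>
  Operators on \<open>X\<close> are normalised to take the value \<open>0\<close> outside \<^term>\<open>vecs X\<close>, so that equality of
  operators is equality of functions and the algebra operations are the pointwise ones and
  composition.
\<close>

definition bounded_ops :: "('i, 'k::real_normed_field) nspace \<Rightarrow> ('i, 'k) operator set" where
  "bounded_ops X = {T. bounded_linear_map X X T \<and> (\<forall>f. f \<notin> vecs X \<longrightarrow> T f = (\<lambda>i. 0))}"

definition zero_op :: "('i, 'k::real_normed_field) operator" where
  "zero_op = (\<lambda>f i. 0)"

definition add_op ::
  "('i, 'k::real_normed_field) operator \<Rightarrow> ('i, 'k) operator \<Rightarrow> ('i, 'k) operator" where
  "add_op S T = (\<lambda>f i. S f i + T f i)"

definition scale_op ::
  "'k::real_normed_field \<Rightarrow> ('i, 'k) operator \<Rightarrow> ('i, 'k) operator" where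
  "scale_op a T = (\<lambda>f i. a * T f i)"

definition op_norm ::
  "('i, 'k::real_normed_field) nspace \<Rightarrow> ('i, 'k) operator \<Rightarrow> real" where
  "op_norm X T = (SUP f\<in>{f\<in>vecs X. nrm X f \<le> 1}. nrm X (T f))"

definition op_ideal ::
  "('i, 'k::real_normed_field) nspace \<Rightarrow> ('i, 'k) operator set \<Rightarrow> bool" where
  "op_ideal X J \<longleftrightarrow> J \<subseteq> bounded_ops X \<and> zero_op \<in> J \<and>
    (\<forall>S\<in>J. \<forall>T\<in>J. add_op S T \<in> J) \<and>
    (\<forall>a. \<forall>T\<in>J. scale_op a T \<in> J) \<and>
    (\<forall>T\<in>J. \<forall>S\<in>bounded_ops X. S \<circ> T \<in> J \<and> T \<circ> S \<in> J)"

definition norm_closed ::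
  "('i, 'k::real_normed_field) nspace \<Rightarrow> ('i, 'k) operator set \<Rightarrow> bool" where
  "norm_closed X J \<longleftrightarrow>
    (\<forall>S T. (\<forall>n. S n \<in> J) \<and> T \<in> bounded_ops X \<and>
      (\<lambda>n::nat. op_norm X (add_op (S n) (scale_op (-1) T))) \<longlonglongrightarrow> 0 \<longrightarrow> T \<in> J)"

definition nonzero_proper_closed_ideal ::
  "('i, 'k::real_normed_field) nspace \<Rightarrow> ('i, 'k) operator set \<Rightarrow> bool" where
  "nonzero_proper_closed_ideal X J \<longleftrightarrow>
    op_ideal X J \<and> norm_closed X J \<and> J \<noteq> {zero_op} \<and> J \<noteq> bounded_ops X"

text \<open>The set \<open>\<S>\<^sub>E(X)\<close> of operators on \<open>X\<close> not bounded below on any copy of \<open>E\<close>.\<close>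

definition S_ops ::
  "('j, 'k::real_normed_field) nspace \<Rightarrow> ('i, 'k) nspace \<Rightarrow> ('i, 'k) operator set" where
  "S_ops E X = {T\<in>bounded_ops X.
    \<not> (\<exists>E0 c. lin_subspace X E0 \<and> isomorphic_spaces (subspace_of X E0) E \<and>
         c > 0 \<and> (\<forall>f\<in>E0. nrm X (T f) \<ge> c * nrm X f))}"

end

theory Submission
  imports Defs
begin

text \<open>
  Let \<open>X\<close> be \<open>c\<^sub>0(I)\<close> or \<open>\<ell>\<^sub>p(I)\<close>, let \<open>J\<close> be a non-zero proper closed ideal of operators on \<open>X\<close>, and for
  \<open>A \<subseteq> I\<close> let \<open>proj A\<close> be the projection onto the coordinates in \<open>A\<close>. The ideal contains \<open>proj A\<close> for all
  finite \<open>A\<close>, since it is non-zero, but not \<open>proj I\<close>, since it is proper. Let \<open>\<kappa>\<close> be the least infinite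
  cardinality of a set \<open>K\<close> with \<open>proj K \<notin> J\<close>. Then \<open>J\<close> consists precisely of the operators that are not
  bounded below on any copy of \<open>E K\<close>, where \<open>E K\<close> is \<open>c\<^sub>0(K)\<close> or \<open>\<ell>\<^sub>p(K)\<close>. This rests on a dichotomy for
  an operator \<open>T\<close>.

  Either \<open>T\<close> is a norm limit of operators \<open>proj A \<circ> T\<close> with fewer than \<open>\<kappa>\<close> elements in \<open>A\<close>. Then \<open>T\<close>
  belongs to \<open>J\<close> by the minimality of \<open>\<kappa>\<close>. Or \<open>T\<close> has large range (\<open>large_range\<close>). Then one finds \<open>\<kappa>\<close>
  disjoint finitely supported vectors whose images have substantial pieces on disjoint finite sets
  (\<open>disjoint_blocks\<close>). In terms of these vectors and of functionals that norm the pieces, \<open>T\<close> is a matrix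
  with diagonal one, and its off-diagonal part becomes arbitrarily small on a suitable set of \<open>\<kappa>\<close>
  indices. Consequently \<open>proj K\<close> is a limit of operators \<open>W \<circ> T \<circ> U\<close> (\<open>approximate_factorization\<close>).
  Two conclusions follow: a closed ideal that contains \<open>T\<close> contains \<open>proj K\<close>, and \<open>T\<close> is bounded below on
  a copy of \<open>E K\<close> (\<open>large_range_imp_not_S_ops\<close>).

  The dichotomy shows that an operator which is not bounded below on any copy of \<open>E K\<close> lies in \<open>J\<close>.
  Conversely, suppose that \<open>T \<in> J\<close> is bounded below on a copy of \<open>E K\<close>. Composing \<open>T\<close> with an embedding
  gives an operator in \<open>J\<close> that is bounded below on the coordinate subspace \<open>E K\<close>. Such an operator has
  large range (\<open>large_range_if_bounded_below\<close>), because \<open>\<kappa>\<close> unit vectors cannot be kept apart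
  by fewer than \<open>\<kappa>\<close> coordinates. Hence \<open>proj K \<in> J\<close>, a contradiction.

  All of this works for every norm that is governed by disjoint blocks (the locale \<open>disjoint_norm\<close>),
  except for the reduction of the off-diagonal part. In \<open>c\<^sub>0\<close> and in \<open>\<ell>\<^sub>p\<close> with \<open>p > 1\<close> the unit vectors are
  weakly null, so that rows and columns of a matrix tend to zero
  (\<open>diagonalizable_if_sublinear_indicators\<close>). In \<open>\<ell>\<^sub>1\<close> rows are merely bounded, and a lemma of Rosenthal
  on the absolutely summable columns is used instead (\<open>diagonalizable_if_superadditive\<close>).
\<close>

section \<open>Cardinal arithmetic and selection principles\<close>

lemma card_of_not_ordLess: "\<not> |A| <o |B| \<longleftrightarrow> |B| \<le>o |A|"
  by (rule not_ordLess_iff_ordLeq) (rule card_of_Well_order)+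

lemma finite_ordLess_infinite_set:
  assumes "finite A" "infinite B"
  shows "|A| <o |B|"
  using assms card_of_not_ordLess card_of_ordLeq_finite by blast

text \<open>
  For countable \<open>K\<close> the index set \<open>S\<close> is finite and so is the union; for uncountable \<open>K\<close> a union over
  an infinite \<open>S\<close> has at most \<open>|S|\<close> elements. Both cases are needed below, since copies of
  \<open>E K\<close> are considered for countable \<open>K\<close> as well.
\<close>

lemma finite_UN_ordLess:
  assumes "infinite K" "|S| <o |K|" "\<And>s. s \<in> S \<Longrightarrow> finite (g s)"
  shows "|\<Union>s\<in>S. g s| <o |K|"
proof (cases "finite S")
  case True
  then have "finite (\<Union>s\<in>S. g s)" using assms by auto
  then show ?thesis using assms(1) by (simp add: finite_ordLess_infinite_set)
next
  case False
  have "|\<Union>s\<in>S. g s| \<le>o |S|"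
    by (rule card_of_UNION_ordLeq_infinite[OF False])
       (simp_all add: card_of_mono1 ordLess_imp_ordLeq finite_ordLess_infinite_set assms(3) False)
  then show ?thesis using assms(2) ordLeq_ordLess_trans by blast
qed

lemma countable_ordLeq_infinite:
  assumes "infinite S" "countable A"
  shows "|A| \<le>o |S|"
proof -
  have "|A| \<le>o |UNIV::nat set|"
    using assms(2) unfolding countable_def card_of_ordLeq[symmetric] by auto
  then show ?thesis using assms(1) infinite_iff_card_of_nat ordLeq_transitive by blast
qed

lemma countable_UN_ordLess:
  assumes "uncountable K" "|S| <o |K|" "\<And>s. s \<in> S \<Longrightarrow> countable (g s)"
  shows "|\<Union>s\<in>S. g s| <o |K|"
proof (cases "finite S")
  case True
  then have "countable (\<Union>s\<in>S. g s)" using assms by (auto simp: countable_finite)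
  then have c: "|\<Union>s\<in>S. g s| \<le>o |UNIV::nat set|"
    using countable_ordLeq_infinite infinite_UNIV_nat by blast
  have "\<not> |K| \<le>o |UNIV::nat set|"
    using assms(1) unfolding countable_def card_of_ordLeq[symmetric] by auto
  then have "|UNIV::nat set| <o |K|" using card_of_not_ordLess by blast
  then show ?thesis using c ordLeq_ordLess_trans by blast
next
  case False
  have "|\<Union>s\<in>S. g s| \<le>o |S|"
    by (rule card_of_UNION_ordLeq_infinite[OF False])
       (simp_all add: card_of_mono1 countable_ordLeq_infinite False assms(3))
  then show ?thesis using assms(2) ordLeq_ordLess_trans by blast
qed

lemma Un_ordLess:
  assumes "infinite K" "|A| <o |K|" "|B| <o |K|"
  shows "|A \<union> B| <o |K|"
  using assms card_of_Un_ordLess_infinite by blast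

lemma ordLess_Diff_nonempty:
  assumes "|A| <o |K|"
  obtains k where "k \<in> K" "k \<notin> A"
proof -
  have "\<not> K \<subseteq> A"
    using assms card_of_mono1 not_ordLess_ordLeq by blast
  then show thesis using that by blast
qed

text \<open>
  An infinite set has only as many \<open>n\<close>-element subsets as elements, by induction on \<open>n\<close>, and there
  are countably many values of \<open>n\<close>.
\<close>

lemma Fpow_ordLess:
  assumes "infinite K" "|A| <o |K|"
  shows "|Fpow A| <o |K|"
proof (cases "finite A")
  case True
  then have "finite (Fpow A)" by (metis Fpow_subset_Pow finite_Pow_iff finite_subset)
  then show ?thesis using assms(1) by (simp add: finite_ordLess_infinite_set)
next
  case False
  have n: "|{R. R \<subseteq> A \<and> finite R \<and> card R = n}| \<le>o |A|" (is "|?F n| \<le>o _") for n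
  proof (induction n)
    case 0
    have "?F 0 = {{}}" by auto
    then show ?case using False
      by (metis finite.emptyI finite_insert finite_ordLess_infinite_set ordLess_imp_ordLeq)
  next
    case (Suc n)
    have "?F (Suc n) \<subseteq> (\<lambda>(a, R). insert a R) ` (A \<times> ?F n)"
    proof
      fix R assume R: "R \<in> ?F (Suc n)"
      then obtain a R' where "R = insert a R'" "a \<notin> R'" "card R' = n"
        by (auto simp: card_Suc_eq)
      then show "R \<in> (\<lambda>(a, R). insert a R) ` (A \<times> ?F n)" using R by force
    qed
    then have "|?F (Suc n)| \<le>o |A \<times> ?F n|" by (rule surj_imp_ordLeq)
    moreover have "|A \<times> ?F n| \<le>o |A|"
      by (rule card_of_Sigma_ordLeq_infinite[OF False]) (simp_all add: card_of_mono1 Suc.IH)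
    ultimately show ?case using ordLeq_transitive by blast
  qed
  have "Fpow A = (\<Union>n. ?F n)" by (auto simp: Fpow_def)
  moreover have "|\<Union>n. ?F n| \<le>o |A|"
    by (rule card_of_UNION_ordLeq_infinite[OF False])
       (use n False infinite_iff_card_of_nat in auto)
  ultimately show ?thesis using assms(2) ordLeq_ordLess_trans by metis
qed

lemma pigeonhole_finite_sets:
  assumes "infinite K" "|A| <o |K|" "\<And>k. k \<in> K \<Longrightarrow> finite (R k) \<and> R k \<subseteq> A"
  obtains R0 where "infinite {k\<in>K. R k = R0}"
proof (rule ccontr)
  assume "\<not> thesis"
  then have "\<And>R0. finite {k\<in>K. R k = R0}" using that by blast
  then have "|\<Union>R0\<in>Fpow A. {k\<in>K. R k = R0}| <o |K|"
    by (rule finite_UN_ordLess[OF assms(1) Fpow_ordLess[OF assms(1,2)]])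
  moreover have "K \<subseteq> (\<Union>R0\<in>Fpow A. {k\<in>K. R k = R0})" using assms(3) by (auto simp: Fpow_def)
  ultimately show False using card_of_mono1 not_ordLess_ordLeq by blast
qed

text \<open>
  Transfinite recursion of length \<open>|K|\<close> in the form in which it is used here: if the objects wanted
  only have to be related pairwise, and fewer than \<open>|K|\<close> of them never block the next one, then a
  maximal family given by Zorn's lemma has at least \<open>|K|\<close> members. No order on the family is
  involved, which is why singular cardinals are covered.
\<close>

lemma pairwise_family:
  assumes ext: "\<And>S. S \<subseteq> G \<Longrightarrow> pairwise R S \<Longrightarrow> |S| <o |K| \<Longrightarrow>
    \<exists>g\<in>G. g \<notin> S \<and> (\<forall>s\<in>S. R s g \<and> R g s)"
  obtains \<phi> where "inj_on \<phi> K" "\<phi> ` K \<subseteq> G" "pairwise R (\<phi> ` K)"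
proof -
  define F where "F = {S. S \<subseteq> G \<and> pairwise R S}"
  have "\<Union>C \<in> F" if C: "subset.chain F C" for C
  proof -
    have "chain\<^sub>\<subseteq> C" using C unfolding subset_chain_def chain_subset_def by blast
    then have "pairwise R (\<Union>C)"
      by (rule pairwise_chain_Union[rotated]) (use C in \<open>auto simp: F_def subset.chain_def\<close>)
    then show ?thesis using C by (auto simp: F_def subset.chain_def)
  qed
  then obtain S where S: "S \<in> F" "\<And>S'. S' \<in> F \<Longrightarrow> S \<subseteq> S' \<Longrightarrow> S' = S"
    using subset_Zorn'[of F] by blast
  have "\<not> |S| <o |K|"
  proof
    assume "|S| <o |K|"
    then obtain g where g: "g \<in> G" "g \<notin> S" "\<forall>s\<in>S. R s g \<and> R g s"
      using ext S(1) unfolding F_def by blast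
    then have "insert g S \<in> F" using S(1) by (auto simp: F_def pairwise_insert)
    then show False using S(2) g(2) by blast
  qed
  then have "|K| \<le>o |S|" using card_of_not_ordLess by blast
  then obtain \<phi> where \<phi>: "inj_on \<phi> K" "\<phi> ` K \<subseteq> S" using card_of_ordLeq[of K S] by auto
  moreover have "S \<subseteq> G" "pairwise R S" using S(1) by (auto simp: F_def)
  ultimately show thesis using that[OF \<phi>(1)] pairwise_subset[of R S "\<phi> ` K"] by simp
qed

text \<open>
  Rosenthal's disjointification argument, valid for every infinite cardinal. Cut \<open>K\<close> into \<open>|K|\<close>
  pieces of size \<open>|K|\<close>. If no piece works, each of them contains a point \<open>\<alpha> \<gamma>\<close> whose \<open>\<mu>\<close> gives
  more than \<open>\<delta>\<close> to the rest of its own piece. On the set of these points, which meets each piece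
  only once, the available mass has dropped by \<open>\<delta>\<close>. Since the total is at most \<open>n \<delta>\<close>, this can
  be repeated only \<open>n\<close> times.
\<close>

lemma rosenthal_disjointification:
  fixes \<mu> :: "'i \<Rightarrow> 'i set \<Rightarrow> real"
  assumes "\<And>k A. 0 \<le> \<mu> k A"
    and mono: "\<And>k A B. A \<subseteq> B \<Longrightarrow> \<mu> k A \<le> \<mu> k B"
    and super: "\<And>k A B. A \<inter> B = {} \<Longrightarrow> \<mu> k A + \<mu> k B \<le> \<mu> k (A \<union> B)"
    and "infinite K" "0 < \<delta>" "\<And>k. k \<in> K \<Longrightarrow> \<mu> k (K - {k}) \<le> real n * \<delta>"
  shows "\<exists>K'\<subseteq>K. |K'| =o |K| \<and> (\<forall>k\<in>K'. \<mu> k (K' - {k}) \<le> \<delta>)"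
  using assms(4,6)
proof (induction n arbitrary: K)
  case 0
  then show ?case using \<open>0 < \<delta>\<close> by (intro exI[of _ K]) (auto simp: card_of_refl intro: order_trans less_imp_le)
next
  case (Suc n)
  have "|K \<times> K| =o |K|" using card_of_Times_same_infinite Suc.prems(1) by blast
  then obtain h where h: "bij_betw h (K \<times> K) K" using card_of_ordIso by blast
  define M where "M \<gamma> = h ` ({\<gamma>} \<times> K)" for \<gamma>
  have MK: "M \<gamma> \<subseteq> K" if "\<gamma> \<in> K" for \<gamma>
    using h that by (auto simp: M_def bij_betw_def)
  have Mdisj: "\<gamma> = \<gamma>'" if "x \<in> M \<gamma>" "x \<in> M \<gamma>'" "\<gamma> \<in> K" "\<gamma>' \<in> K" for x \<gamma> \<gamma>'
    using h that by (auto simp: M_def bij_betw_def inj_on_def)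
  have Mcard: "|M \<gamma>| =o |K|" if "\<gamma> \<in> K" for \<gamma>
  proof -
    have "bij_betw (\<lambda>k. h (\<gamma>, k)) K (M \<gamma>)"
      using h that by (auto simp: M_def bij_betw_def inj_on_def)
    then show ?thesis using card_of_ordIso ordIso_symmetric by blast
  qed
  show ?case
  proof (cases "\<exists>\<gamma>\<in>K. \<forall>k\<in>M \<gamma>. \<mu> k (M \<gamma> - {k}) \<le> \<delta>")
    case True
    then show ?thesis using MK Mcard by blast
  next
    case False
    then have "\<forall>\<gamma>\<in>K. \<exists>k\<in>M \<gamma>. \<mu> k (M \<gamma> - {k}) > \<delta>" by force
    then obtain \<alpha> where \<alpha>: "\<And>\<gamma>. \<gamma> \<in> K \<Longrightarrow> \<alpha> \<gamma> \<in> M \<gamma> \<and> \<mu> (\<alpha> \<gamma>) (M \<gamma> - {\<alpha> \<gamma>}) > \<delta>"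
      by metis
    have inj: "inj_on \<alpha> K" using \<alpha> Mdisj by (metis inj_onI)
    have eq: "|\<alpha> ` K| =o |K|"
      by (metis inj card_of_ordIso ordIso_symmetric inj_on_imp_bij_betw)
    have sub: "\<alpha> ` K \<subseteq> K" using \<alpha> MK by blast
    have inf: "infinite (\<alpha> ` K)" using inj Suc.prems(1) by (simp add: finite_image_iff)
    have "\<mu> k (\<alpha> ` K - {k}) \<le> real n * \<delta>" if k: "k \<in> \<alpha> ` K" for k
    proof -
      obtain \<gamma> where \<gamma>: "\<gamma> \<in> K" "k = \<alpha> \<gamma>" using k by blast
      have disj: "(M \<gamma> - {k}) \<inter> (\<alpha> ` K - {k}) = {}"
        using \<gamma> \<alpha> Mdisj by fast
      have "\<delta> + \<mu> k (\<alpha> ` K - {k}) \<le> \<mu> k (M \<gamma> - {k}) + \<mu> k (\<alpha> ` K - {k})"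
        using \<alpha> \<gamma> by force
      also have "\<dots> \<le> \<mu> k ((M \<gamma> - {k}) \<union> (\<alpha> ` K - {k}))" by (rule super[OF disj])
      also have "\<dots> \<le> \<mu> k (K - {k})" by (rule mono) (use MK[OF \<gamma>(1)] sub in blast)
      also have "\<dots> \<le> real (Suc n) * \<delta>" using Suc.prems(2) k sub by blast
      finally show ?thesis by (simp add: algebra_simps)
    qed
    then obtain K' where "K' \<subseteq> \<alpha> ` K" "|K'| =o |\<alpha> ` K|" "\<forall>k\<in>K'. \<mu> k (K' - {k}) \<le> \<delta>"
      using Suc.IH[OF inf] by blast
    then show ?thesis using sub ordIso_transitive[OF _ eq, of "|K'|"] by (intro exI[of _ K']) simp
  qed
qed

lemma bounded_infinite_close_subset:
  fixes g :: "'b \<Rightarrow> 'j \<Rightarrow> 'k :: {real_normed_field, heine_borel}"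
  assumes "finite R" "infinite L" "0 < \<eta>" "\<And>k j. k \<in> L \<Longrightarrow> norm (g k j) \<le> C"
  shows "\<exists>L'\<subseteq>L. infinite L' \<and> (\<forall>j\<in>R. \<forall>k\<in>L'. \<forall>l\<in>L'. norm (g k j - g l j) < \<eta>)"
  using assms(1)
proof (induction R)
  case empty
  then show ?case using assms(2) by blast
next
  case (insert r R)
  then obtain L1 where L1: "L1 \<subseteq> L" "infinite L1"
    "\<forall>j\<in>R. \<forall>k\<in>L1. \<forall>l\<in>L1. norm (g k j - g l j) < \<eta>" by blast
  have "compact (cball (0::'k) C)" by simp
  then obtain F where F: "finite F" "cball (0::'k) C \<subseteq> (\<Union>x\<in>F. ball x (\<eta>/2))"
    using compact_eq_totally_bounded[of "cball (0::'k) C"] assms(3) by (meson half_gt_zero)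
  have "\<exists>x\<in>F. g k r \<in> ball x (\<eta>/2)" if "k \<in> L1" for k
    using F(2) assms(4)[of k r] L1(1) that by (auto simp: subset_iff)
  then have cov: "L1 \<subseteq> (\<Union>x\<in>F. {k\<in>L1. g k r \<in> ball x (\<eta>/2)})" by blast
  obtain x where x: "infinite {k\<in>L1. g k r \<in> ball x (\<eta>/2)}"
    using cov F(1) L1(2) by (meson finite_UN finite_subset)
  have "norm (g k r - g l r) < \<eta>" if "g k r \<in> ball x (\<eta>/2)" "g l r \<in> ball x (\<eta>/2)" for k l
    using that dist_triangle_half_r[of x "g k r" \<eta> "g l r"] by (simp add: dist_norm)
  then show ?case using x L1
    by (intro exI[of _ "{k\<in>L1. g k r \<in> ball x (\<eta>/2)}"]) auto
qed

section \<open>Norms governed by disjoint blocks\<close>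

definition restr :: "'i set \<Rightarrow> ('i \<Rightarrow> 'k::zero) \<Rightarrow> 'i \<Rightarrow> 'k" where
  "restr A f = (\<lambda>i. if i \<in> A then f i else 0)"

definition unit_vec :: "'i \<Rightarrow> 'i \<Rightarrow> 'k::zero_neq_one" where
  "unit_vec k = (\<lambda>i. if i = k then 1 else 0)"

lemma restr_split: "restr A f i + restr (- A) f i = (f i :: 'k::monoid_add)"
  by (simp add: restr_def)

lemma restr_sub: "restr A (\<lambda>i. f i - g i) = (\<lambda>i. restr A f i - restr A g i :: 'k::group_add)"
  by (auto simp: restr_def)

lemma restr_add: "restr A (\<lambda>i. f i + g i) = (\<lambda>i. restr A f i + restr A g i :: 'k::monoid_add)"
  by (auto simp: restr_def)

lemma finite_support_expand:
  fixes f :: "'i \<Rightarrow> 'k::comm_ring_1"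
  assumes "finite F" "\<And>i. i \<notin> F \<Longrightarrow> f i = 0"
  shows "f = (\<lambda>i. \<Sum>k\<in>F. f k * unit_vec k i)"
proof
  fix i
  have "(\<Sum>k\<in>F. f k * unit_vec k i) = (\<Sum>k\<in>F. if k = i then f k else 0)"
    by (rule sum.cong) (auto simp: unit_vec_def)
  then show "f i = (\<Sum>k\<in>F. f k * unit_vec k i)" using assms by (cases "i \<in> F") auto
qed

text \<open>
  What \<open>c\<^sub>0(I)\<close> and \<open>\<ell>\<^sub>p(I)\<close> have in common. The assumption \<open>domination\<close> says that the norm is
  controlled by the norms of disjoint blocks: if the blocks of \<open>w\<close> are no larger than corresponding
  disjoint blocks of \<open>z\<close>, then \<open>w\<close> belongs to the space and is no larger than \<open>z\<close>. Taking
  all blocks to be singletons gives the lattice property and the invariance under permutations of the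
  basis; taking only the blocks of \<open>z\<close> or only those of \<open>w\<close> to be singletons shows that disjoint
  vectors of norm at most one span the space boundedly and that disjointly supported functionals
  define an operator. The assumption \<open>norming\<close> provides norming functionals for finitely supported
  vectors, which replaces the dual space. The space \<open>E K\<close> for \<open>K \<subseteq> I\<close> is the subspace of \<open>E I\<close> of
  vectors supported in \<open>K\<close>.
\<close>

locale disjoint_norm =
  fixes E :: "'i set \<Rightarrow> ('i, 'k::{real_normed_field, heine_borel}) nspace" and I :: "'i set"
  assumes infinite_I: "infinite I"
    and zero_outside: "f \<in> vecs (E I) \<Longrightarrow> i \<notin> I \<Longrightarrow> f i = 0"
    and zero_in: "(\<lambda>i. 0) \<in> vecs (E I)"
    and add_in: "f \<in> vecs (E I) \<Longrightarrow> g \<in> vecs (E I) \<Longrightarrow> (\<lambda>i. f i + g i) \<in> vecs (E I)"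
    and triangle: "f \<in> vecs (E I) \<Longrightarrow> g \<in> vecs (E I) \<Longrightarrow>
      nrm (E I) (\<lambda>i. f i + g i) \<le> nrm (E I) f + nrm (E I) g"
    and scale_in: "f \<in> vecs (E I) \<Longrightarrow> (\<lambda>i. a * f i) \<in> vecs (E I)"
    and norm_scale: "f \<in> vecs (E I) \<Longrightarrow> nrm (E I) (\<lambda>i. a * f i) = norm a * nrm (E I) f"
    and unit_in: "k \<in> I \<Longrightarrow> unit_vec k \<in> vecs (E I)"
    and norm_unit: "k \<in> I \<Longrightarrow> nrm (E I) (unit_vec k) = 1"
    and small_tail: "f \<in> vecs (E I) \<Longrightarrow> 0 < \<epsilon> \<Longrightarrow>
      \<exists>R\<subseteq>I. finite R \<and> nrm (E I) (restr (- R) f) < \<epsilon>"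
    and domination: "\<lbrakk>z \<in> vecs (E I); disjoint_family_on B K; disjoint_family_on C K;
      \<And>k. k \<in> K \<Longrightarrow> finite (B k) \<and> B k \<subseteq> I; \<And>k. k \<in> K \<Longrightarrow> finite (C k) \<and> C k \<subseteq> I;
      \<And>i. i \<notin> (\<Union>k\<in>K. C k) \<Longrightarrow> w i = 0;
      \<And>k. k \<in> K \<Longrightarrow> nrm (E I) (restr (C k) w) \<le> nrm (E I) (restr (B k) z)\<rbrakk> \<Longrightarrow>
      w \<in> vecs (E I) \<and> nrm (E I) w \<le> nrm (E I) z"
    and norming: "finite D \<Longrightarrow> D \<subseteq> I \<Longrightarrow> \<exists>c. (\<Sum>j\<in>D. c j * y j) = of_real (nrm (E I) (restr D y)) \<and>
      (\<forall>z\<in>vecs (E I). norm (\<Sum>j\<in>D. c j * z j) \<le> nrm (E I) (restr D z))"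
    and vecs_sub: "K \<subseteq> I \<Longrightarrow> K \<noteq> {} \<Longrightarrow> vecs (E K) = {f \<in> vecs (E I). \<forall>i. i \<notin> K \<longrightarrow> f i = 0}"
    and nrm_sub: "K \<subseteq> I \<Longrightarrow> K \<noteq> {} \<Longrightarrow> f \<in> vecs (E K) \<Longrightarrow> nrm (E K) f = nrm (E I) f"
begin

abbreviation "V \<equiv> vecs (E I)"
abbreviation "N \<equiv> nrm (E I)"
abbreviation "ops \<equiv> bounded_ops (E I)"

lemma sub_in: "f \<in> V \<Longrightarrow> g \<in> V \<Longrightarrow> (\<lambda>i. f i - g i) \<in> V"
  using add_in[OF _ scale_in[of g "-1"], of f] by simp

lemma norm_neg: "f \<in> V \<Longrightarrow> N (\<lambda>i. - f i) = N f"
  using norm_scale[of f "-1"] by simp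

lemma nrm_zero: "N (\<lambda>i. 0) = 0"
  using norm_scale[OF zero_in, of 0] by simp

lemma triangle_sub: "f \<in> V \<Longrightarrow> g \<in> V \<Longrightarrow> N (\<lambda>i. f i - g i) \<le> N f + N g"
  using triangle[OF _ scale_in[of g "-1"], of f] norm_neg[of g] by simp

lemma norm_nonneg: "f \<in> V \<Longrightarrow> 0 \<le> N f"
  using triangle_sub[of f f] by (simp add: nrm_zero)

lemma triangle_le: "f \<in> V \<Longrightarrow> g \<in> V \<Longrightarrow> N f \<le> N g + N (\<lambda>i. f i - g i)"
  using triangle[OF _ sub_in, of g f g] by simp

lemma norm_restr_single: "i \<in> I \<Longrightarrow> N (restr {i} f) = norm (f i)"
proof -
  assume i: "i \<in> I"
  have "restr {i} f = (\<lambda>j. f i * unit_vec i j)" by (auto simp: restr_def unit_vec_def)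
  then show ?thesis using norm_scale[OF unit_in[OF i], of "f i"] norm_unit[OF i] by simp
qed

lemma solid:
  assumes "z \<in> V" "\<And>i. norm (w i) \<le> norm (z i)"
  shows "w \<in> V" "N w \<le> N z"
proof -
  have "w \<in> V \<and> N w \<le> N z"
  proof (rule domination[OF assms(1), where B = "\<lambda>i. {i}" and C = "\<lambda>i. {i}" and K = I])
    fix i assume "i \<notin> (\<Union>k\<in>I. {k})"
    then have "z i = 0" using assms(1) zero_outside by simp
    then show "w i = 0" using assms(2)[of i] by simp
  qed (auto simp: disjoint_family_on_def norm_restr_single assms(2))
  then show "w \<in> V" "N w \<le> N z" by auto
qed

lemma restr_in: "f \<in> V \<Longrightarrow> restr A f \<in> V"
  by (rule solid(1)[of f]) (auto simp: restr_def)

lemma norm_restr_le: "f \<in> V \<Longrightarrow> N (restr A f) \<le> N f"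
  by (rule solid(2)[of f]) (auto simp: restr_def)

lemma norm_restr_mono:
  assumes "f \<in> V" "A \<inter> I \<subseteq> B"
  shows "N (restr A f) \<le> N (restr B f)"
proof (rule solid(2)[OF restr_in[OF assms(1)]])
  fix i show "norm (restr A f i) \<le> norm (restr B f i)"
    using assms zero_outside[OF assms(1), of i] by (auto simp: restr_def)
qed

lemma coord_le: "f \<in> V \<Longrightarrow> norm (f i) \<le> N f"
proof (cases "i \<in> I")
  case True
  assume "f \<in> V"
  then show ?thesis using norm_restr_le[of f "{i}"] norm_restr_single[OF True] by simp
qed (simp add: zero_outside norm_nonneg)

lemma norm_eq_0: "f \<in> V \<Longrightarrow> N f = 0 \<Longrightarrow> f = (\<lambda>i. 0)"
  using coord_le[of f] by fastforce

lemma finite_combination: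
  assumes "finite F" "\<And>k. k \<in> F \<Longrightarrow> g k \<in> V"
  shows "(\<lambda>i. \<Sum>k\<in>F. a k * g k i) \<in> V \<and>
    N (\<lambda>i. \<Sum>k\<in>F. a k * g k i) \<le> (\<Sum>k\<in>F. norm (a k) * N (g k))"
  using assms
proof (induction F)
  case empty
  then show ?case by (simp add: zero_in nrm_zero)
next
  case (insert x F)
  then have 1: "(\<lambda>i. \<Sum>k\<in>F. a k * g k i) \<in> V"
      "N (\<lambda>i. \<Sum>k\<in>F. a k * g k i) \<le> (\<Sum>k\<in>F. norm (a k) * N (g k))"
    and 2: "g x \<in> V" by auto
  show ?case
    using insert.hyps add_in[OF scale_in[OF 2, of "a x"] 1(1)]
      triangle[OF scale_in[OF 2, of "a x"] 1(1)] norm_scale[OF 2, of "a x"] 1(2)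
    by simp
qed

lemma finite_support:
  assumes "finite F" "F \<subseteq> I" "\<And>i. i \<notin> F \<Longrightarrow> f i = 0"
  shows "f \<in> V" "N f \<le> (\<Sum>k\<in>F. norm (f k))"
proof -
  have u: "unit_vec k \<in> V \<and> N (unit_vec k) = 1" if "k \<in> F" for k
    using that assms(2) unit_in norm_unit by blast
  have "(\<lambda>i. \<Sum>k\<in>F. f k * unit_vec k i) \<in> V"
      "N (\<lambda>i. \<Sum>k\<in>F. f k * unit_vec k i) \<le> (\<Sum>k\<in>F. norm (f k) * N (unit_vec k))"
    using finite_combination[OF assms(1), of "\<lambda>k. unit_vec k" f] u by auto
  moreover have "(\<Sum>k\<in>F. norm (f k) * N (unit_vec k)) = (\<Sum>k\<in>F. norm (f k))"
    using u by (intro sum.cong) auto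
  ultimately show "f \<in> V" "N f \<le> (\<Sum>k\<in>F. norm (f k))"
    using finite_support_expand[of F f, OF assms(1,3)] by simp_all
qed

lemma norm_restr_split: "f \<in> V \<Longrightarrow> N f \<le> N (restr A f) + N (restr (- A) f)"
  using triangle[OF restr_in restr_in, of f f A "- A"] by (simp add: restr_split)

lemma norm_le_if_finite_restr_le:
  assumes "f \<in> V" "\<And>R. finite R \<Longrightarrow> R \<subseteq> I \<Longrightarrow> N (restr R f) \<le> b"
  shows "N f \<le> b"
proof (rule field_le_epsilon)
  fix e :: real assume "0 < e"
  then obtain R where "R \<subseteq> I" "finite R" "N (restr (- R) f) < e" using small_tail assms(1) by blast
  then show "N f \<le> b + e" using norm_restr_split[OF assms(1), of R] assms(2)[of R] by simp
qed

lemma finitely_many_large: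
  assumes "f \<in> V" "0 < \<eta>"
  shows "finite {i. \<eta> \<le> norm (f i)}"
proof -
  obtain R where R: "finite R" "N (restr (- R) f) < \<eta>" using small_tail assms by blast
  have "norm (f i) < \<eta>" if "i \<notin> R" for i
    using coord_le[OF restr_in[OF assms(1)], of "- R" i] R(2) that by (simp add: restr_def)
  then have "{i. \<eta> \<le> norm (f i)} \<subseteq> R" by force
  then show ?thesis using R(1) finite_subset by blast
qed

lemma countable_support:
  assumes "f \<in> V"
  shows "countable {i. f i \<noteq> 0}"
proof -
  have "{i. f i \<noteq> 0} = (\<Union>n. {i. inverse (real (Suc n)) \<le> norm (f i)})"
  proof (auto simp del: of_nat_Suc)
    fix i assume "f i \<noteq> 0"
    then obtain n where "inverse (real (Suc n)) < norm (f i)"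
      using reals_Archimedean zero_less_norm_iff by blast
    then show "\<exists>n. inverse (real (Suc n)) \<le> norm (f i)" by (meson less_imp_le)
  qed
  moreover have "countable (\<Union>n. {i. inverse (real (Suc n)) \<le> norm (f i)})"
    using finitely_many_large[OF assms] by (auto simp: countable_finite simp del: of_nat_Suc)
  ultimately show ?thesis by metis
qed

lemma op_in: "T \<in> ops \<Longrightarrow> f \<in> V \<Longrightarrow> T f \<in> V"
  and op_add: "T \<in> ops \<Longrightarrow> f \<in> V \<Longrightarrow> g \<in> V \<Longrightarrow> T (\<lambda>i. f i + g i) = (\<lambda>j. T f j + T g j)"
  and op_scale: "T \<in> ops \<Longrightarrow> f \<in> V \<Longrightarrow> T (\<lambda>i. a * f i) = (\<lambda>j. a * T f j)"
  and op_outside: "T \<in> ops \<Longrightarrow> f \<notin> V \<Longrightarrow> T f = (\<lambda>j. 0)"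
  unfolding bounded_ops_def bounded_linear_map_def by blast+

lemma op_value_in: "T \<in> ops \<Longrightarrow> T f \<in> V"
  by (cases "f \<in> V") (auto simp: op_in op_outside zero_in)

lemma op_sub: "T \<in> ops \<Longrightarrow> f \<in> V \<Longrightarrow> g \<in> V \<Longrightarrow> T (\<lambda>i. f i - g i) = (\<lambda>j. T f j - T g j)"
  using op_add[OF _ _ scale_in[of g "-1"], of T f] op_scale[of T g "-1"] by simp

lemma op_zero: "T \<in> ops \<Longrightarrow> T (\<lambda>i. 0) = (\<lambda>j. 0)"
  using op_scale[OF _ zero_in, of T 0] by simp

lemma op_bound:
  assumes "T \<in> ops"
  obtains C where "0 < C" "\<And>f. f \<in> V \<Longrightarrow> N (T f) \<le> C * N f"
proof -
  obtain C where C: "\<And>f. f \<in> V \<Longrightarrow> N (T f) \<le> C * N f"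
    using assms unfolding bounded_ops_def bounded_linear_map_def by blast
  have "N (T f) \<le> (\<bar>C\<bar> + 1) * N f" if "f \<in> V" for f
    using C[OF that] mult_right_mono[OF _ norm_nonneg[OF that], of C "\<bar>C\<bar> + 1"] by linarith
  then show thesis using that[of "\<bar>C\<bar> + 1"] by simp
qed

lemma op_sum:
  assumes "T \<in> ops" "finite F" "\<And>k. k \<in> F \<Longrightarrow> g k \<in> V"
  shows "T (\<lambda>i. \<Sum>k\<in>F. a k * g k i) = (\<lambda>j. \<Sum>k\<in>F. a k * T (g k) j)"
  using assms(2,3)
proof (induction F)
  case (insert x F)
  then show ?case
    using op_add[OF assms(1) scale_in finite_combination[THEN conjunct1], of "g x" F g "a x" a]
      op_scale[OF assms(1)] by simp
qed (simp add: op_zero[OF assms(1)])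

lemma opI:
  assumes "\<And>f. f \<in> V \<Longrightarrow> T f \<in> V" "\<And>f. f \<in> V \<Longrightarrow> N (T f) \<le> C * N f"
    "\<And>f g. f \<in> V \<Longrightarrow> g \<in> V \<Longrightarrow> T (\<lambda>i. f i + g i) = (\<lambda>j. T f j + T g j)"
    "\<And>a f. f \<in> V \<Longrightarrow> T (\<lambda>i. a * f i) = (\<lambda>j. a * T f j)"
    "\<And>f. f \<notin> V \<Longrightarrow> T f = (\<lambda>j. 0)"
  shows "T \<in> ops"
  unfolding bounded_ops_def bounded_linear_map_def using assms by blast

lemma op_comp:
  assumes S: "S \<in> ops" and T: "T \<in> ops"
  shows "S \<circ> T \<in> ops"
proof -
  obtain C D where C: "0 < C" "\<And>f. f \<in> V \<Longrightarrow> N (S f) \<le> C * N f"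
    and D: "0 < D" "\<And>f. f \<in> V \<Longrightarrow> N (T f) \<le> D * N f"
    using op_bound S T by metis
  have "N (S (T f)) \<le> C * D * N f" if "f \<in> V" for f
    by (rule order_trans[OF C(2)[OF op_in[OF T that]]])
      (use D(2)[OF that] C(1) in \<open>simp add: mult.assoc\<close>)
  then show ?thesis
    by (intro opI[where C = "C * D"])
      (auto simp: op_in[OF S] op_in[OF T] op_add[OF S] op_add[OF T] op_scale[OF S] op_scale[OF T]
        op_outside[OF T] op_zero[OF S])
qed

lemma op_add_op:
  assumes S: "S \<in> ops" and T: "T \<in> ops"
  shows "add_op S T \<in> ops"
proof -
  obtain C D where C: "0 < C" "\<And>f. f \<in> V \<Longrightarrow> N (S f) \<le> C * N f"
    and D: "0 < D" "\<And>f. f \<in> V \<Longrightarrow> N (T f) \<le> D * N f"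
    using op_bound S T by metis
  have "N (add_op S T f) \<le> (C + D) * N f" if "f \<in> V" for f
    using triangle[OF op_in[OF S that] op_in[OF T that]] C(2)[OF that] D(2)[OF that]
    by (simp add: add_op_def algebra_simps)
  then show ?thesis
    by (intro opI[where C = "C + D"])
      (auto simp: add_op_def add_in op_in[OF S] op_in[OF T] op_add[OF S] op_add[OF T] op_scale[OF S]
        op_scale[OF T] op_outside[OF T] op_outside[OF S] algebra_simps)
qed

lemma op_scale_op:
  assumes T: "T \<in> ops"
  shows "scale_op a T \<in> ops"
proof -
  obtain D where D: "0 < D" "\<And>f. f \<in> V \<Longrightarrow> N (T f) \<le> D * N f"
    using op_bound T by metis
  have "N (scale_op a T f) \<le> (norm a * D) * N f" if "f \<in> V" for f
    using norm_scale[OF op_in[OF T that], of a] mult_left_mono[OF D(2)[OF that], of "norm a"]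
    by (simp add: scale_op_def algebra_simps)
  then show ?thesis
    by (intro opI[where C = "norm a * D"])
      (auto simp: scale_op_def scale_in op_in[OF T] op_add[OF T] op_scale[OF T]
        op_outside[OF T] algebra_simps)
qed

text \<open>
  Operators vanish outside the space, so a formula that defines an operator has to be cut off there.
\<close>

definition lin_op :: "(('i \<Rightarrow> 'k) \<Rightarrow> 'i \<Rightarrow> 'k) \<Rightarrow> ('i, 'k) operator" where
  "lin_op \<Phi> = (\<lambda>f. if f \<in> V then \<Phi> f else (\<lambda>j. 0))"

lemma lin_op_in:
  assumes "\<And>f. f \<in> V \<Longrightarrow> \<Phi> f \<in> V \<and> N (\<Phi> f) \<le> C * N f"
    "\<And>f g. f \<in> V \<Longrightarrow> g \<in> V \<Longrightarrow> \<Phi> (\<lambda>i. f i + g i) = (\<lambda>j. \<Phi> f j + \<Phi> g j)"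
    "\<And>a f. f \<in> V \<Longrightarrow> \<Phi> (\<lambda>i. a * f i) = (\<lambda>j. a * \<Phi> f j)"
  shows "lin_op \<Phi> \<in> ops"
proof (rule opI[where C = C])
  fix f g assume "f \<in> V" "g \<in> V"
  then show "lin_op \<Phi> (\<lambda>i. f i + g i) = (\<lambda>j. lin_op \<Phi> f j + lin_op \<Phi> g j)"
    by (simp add: lin_op_def add_in assms(2))
next
  fix a f assume "f \<in> V"
  then show "lin_op \<Phi> (\<lambda>i. a * f i) = (\<lambda>j. a * lin_op \<Phi> f j)"
    by (simp add: lin_op_def scale_in assms(3))
qed (use assms(1) in \<open>auto simp: lin_op_def\<close>)

definition proj :: "'i set \<Rightarrow> ('i, 'k) operator" where
  "proj A = lin_op (restr A)"

lemma proj_in: "proj A \<in> ops"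
  unfolding proj_def by (rule lin_op_in[where C = 1])
    (auto simp: restr_in norm_restr_le, auto simp: restr_def)

lemma proj_apply: "f \<in> V \<Longrightarrow> proj A f = restr A f"
  by (simp add: proj_def lin_op_def)

text \<open>
  Finitely supported vectors are dense by \<open>small_tail\<close>, so a bound for an operator may be checked on
  them.
\<close>

lemma bound_if_finite_support_bound:
  assumes T: "T \<in> ops" and "0 \<le> \<delta>"
    and fin: "\<And>F f. finite F \<Longrightarrow> F \<subseteq> I \<Longrightarrow> f \<in> V \<Longrightarrow> (\<And>i. i \<notin> F \<Longrightarrow> f i = 0) \<Longrightarrow> N (T f) \<le> \<delta> * N f"
    and f: "f \<in> V"
  shows "N (T f) \<le> \<delta> * N f"
proof (rule field_le_epsilon)
  fix e :: real assume "0 < e"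
  obtain C where C: "0 < C" "\<And>f. f \<in> V \<Longrightarrow> N (T f) \<le> C * N f" using op_bound[OF T] by blast
  obtain R where R: "R \<subseteq> I" "finite R" "N (restr (- R) f) < e / C"
    using small_tail[OF f] \<open>0 < e\<close> C(1) by (meson divide_pos_pos)
  have "N (T f) \<le> N (T (restr R f)) + N (T (restr (- R) f))"
    using triangle[OF op_in[OF T restr_in[OF f]] op_in[OF T restr_in[OF f]], of R "- R"]
    by (simp flip: op_add[OF T restr_in[OF f] restr_in[OF f]] add: restr_split)
  moreover have "N (T (restr R f)) \<le> \<delta> * N (restr R f)"
    by (rule fin[OF R(2,1) restr_in[OF f]]) (simp add: restr_def)
  moreover have "\<delta> * N (restr R f) \<le> \<delta> * N f"
    using norm_restr_le[OF f] \<open>0 \<le> \<delta>\<close> by (simp add: mult_left_mono)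
  moreover have "N (T (restr (- R) f)) \<le> C * N (restr (- R) f)" using C(2) restr_in f by blast
  moreover have "C * N (restr (- R) f) \<le> e" using R(3) C(1) by (simp add: field_simps)
  ultimately show "N (T f) \<le> \<delta> * N f + e" by linarith
qed

end

section \<open>Approximate factorization of coordinate projections\<close>

context disjoint_norm
begin

lemma op_finite_support:
  assumes "T \<in> ops" "finite F" "F \<subseteq> I" "\<And>i. i \<notin> F \<Longrightarrow> f i = 0"
  shows "T f = (\<lambda>j. \<Sum>k\<in>F. f k * T (unit_vec k) j)"
proof -
  have "T f = T (\<lambda>i. \<Sum>k\<in>F. f k * unit_vec k i)"
    using finite_support_expand[of F f, OF assms(2,4)] by simp
  also have "\<dots> = (\<lambda>j. \<Sum>k\<in>F. f k * T (unit_vec k) j)"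
    by (rule op_sum) (use assms unit_in in auto)
  finally show ?thesis .
qed

text \<open>
  If \<open>F\<close> is infinite, then the columns \<open>T (unit_vec k)\<close> with \<open>k \<in> F\<close> have countable supports, and the
  union of these supports is a set \<open>A\<close> that works even with bound zero. If \<open>F\<close> is finite, countable
  supports may already be too large, and only finitely many coordinates of each of the finitely many
  columns are kept.
\<close>

lemma small_range_off_small_set:
  assumes T: "T \<in> ops" and K: "infinite K" and F: "F \<subseteq> I" "|F| <o |K|" and "0 < \<eta>"
  shows "\<exists>A\<subseteq>I. |A| <o |K| \<and> (\<forall>f\<in>V. N (restr (- A) (T (restr F f))) \<le> \<eta> * N f)"
proof (cases "finite F")
  case True
  have "\<exists>R\<subseteq>I. finite R \<and> N (restr (- R) (T (unit_vec k))) < \<eta> / (real (card F) + 1)" if "k \<in> F" for k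
    using small_tail[OF op_in[OF T unit_in]] that F(1) \<open>0 < \<eta>\<close> by (metis add_nonneg_pos divide_pos_pos of_nat_0_le_iff subsetD zero_less_one)
  then obtain R where R: "\<And>k. k \<in> F \<Longrightarrow> R k \<subseteq> I \<and> finite (R k) \<and>
      N (restr (- R k) (T (unit_vec k))) < \<eta> / (real (card F) + 1)" by metis
  define A where "A = (\<Union>k\<in>F. R k)"
  have "finite A" "A \<subseteq> I" using R True by (auto simp: A_def)
  have "N (restr (- A) (T (restr F f))) \<le> \<eta> * N f" if f: "f \<in> V" for f
  proof -
    have "T (restr F f) = (\<lambda>j. \<Sum>k\<in>F. restr F f k * T (unit_vec k) j)"
      by (rule op_finite_support[OF T True F(1)]) (simp add: restr_def)
    also have "\<dots> = (\<lambda>j. \<Sum>k\<in>F. f k * T (unit_vec k) j)" by (simp add: restr_def)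
    finally have eq: "restr (- A) (T (restr F f)) = (\<lambda>j. \<Sum>k\<in>F. f k * restr (- A) (T (unit_vec k)) j)"
      by (auto simp: restr_def)
    have "N (restr (- A) (T (restr F f))) \<le> (\<Sum>k\<in>F. norm (f k) * N (restr (- A) (T (unit_vec k))))"
      unfolding eq using finite_combination[OF True, of "\<lambda>k. restr (- A) (T (unit_vec k))" f]
        restr_in op_in[OF T unit_in] F(1) by blast
    also have "\<dots> \<le> (\<Sum>k\<in>F. N f * (\<eta> / (real (card F) + 1)))"
    proof (rule sum_mono, rule mult_mono)
      fix k assume k: "k \<in> F"
      have Tk: "T (unit_vec k) \<in> V" using k F(1) op_in[OF T unit_in] by blast
      have "N (restr (- A) (T (unit_vec k))) \<le> N (restr (- R k) (T (unit_vec k)))"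
        using k by (intro norm_restr_mono[OF Tk]) (auto simp: A_def)
      then show "N (restr (- A) (T (unit_vec k))) \<le> \<eta> / (real (card F) + 1)" using R[OF k] by linarith
      show "0 \<le> N (restr (- A) (T (unit_vec k)))" using norm_nonneg restr_in Tk by blast
    qed (auto simp: coord_le norm_nonneg f)
    also have "\<dots> = (real (card F) / (real (card F) + 1)) * (\<eta> * N f)" by simp
    also have "\<dots> \<le> 1 * (\<eta> * N f)"
      using norm_nonneg[OF f] \<open>0 < \<eta>\<close> by (intro mult_right_mono) auto
    finally show ?thesis by simp
  qed
  then show ?thesis using \<open>A \<subseteq> I\<close> finite_ordLess_infinite_set[OF \<open>finite A\<close> K] by blast
next
  case False
  define A where "A = (\<Union>k\<in>F. {j. T (unit_vec k) j \<noteq> 0})"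
  have TV: "T (unit_vec k) \<in> V" if "k \<in> F" for k using that F(1) op_in[OF T unit_in] by blast
  have AI: "A \<subseteq> I" using zero_outside[OF TV] by (force simp: A_def)
  have "|A| \<le>o |F|" unfolding A_def
    by (rule card_of_UNION_ordLeq_infinite[OF False])
      (simp_all add: card_of_mono1 countable_ordLeq_infinite False countable_support TV)
  then have AK: "|A| <o |K|" using F(2) ordLeq_ordLess_trans by blast
  have *: "N ((proj (- A) \<circ> (T \<circ> proj F)) f) \<le> 0 * N f" if "f \<in> V" for f
  proof (rule bound_if_finite_support_bound[OF _ _ _ that])
    show "proj (- A) \<circ> (T \<circ> proj F) \<in> ops" by (intro op_comp proj_in T)
    fix G f assume G: "finite G" "G \<subseteq> I" "\<And>i. i \<notin> G \<Longrightarrow> f i = 0" and f: "f \<in> V"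
    have "T (restr F f) = (\<lambda>j. \<Sum>k\<in>G. restr F f k * T (unit_vec k) j)"
      by (rule op_finite_support[OF T G(1,2)]) (simp add: restr_def G(3))
    then have "restr (- A) (T (restr F f)) = (\<lambda>j. 0)"
      by (auto simp: restr_def A_def fun_eq_iff intro!: sum.neutral)
    then show "N ((proj (- A) \<circ> (T \<circ> proj F)) f) \<le> 0 * N f"
      by (simp add: proj_apply f restr_in op_in[OF T] nrm_zero)
  qed simp
  have "N (restr (- A) (T (restr F f))) \<le> \<eta> * N f" if "f \<in> V" for f
  proof -
    have "N (restr (- A) (T (restr F f))) \<le> 0"
      using *[OF that] that by (simp add: proj_apply restr_in op_in[OF T])
    then show ?thesis
      using \<open>0 < \<eta>\<close> norm_nonneg[OF that] mult_nonneg_nonneg[of \<eta> "N f"] by linarith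
  qed
  then show ?thesis using AI AK by blast
qed

text \<open>
  The quantitative negation of "\<open>T\<close> is a norm limit of operators whose range is supported by fewer
  than \<open>|K|\<close> coordinates".
\<close>

definition large_range :: "'i set \<Rightarrow> ('i, 'k) operator \<Rightarrow> real \<Rightarrow> bool" where
  "large_range K T \<epsilon> \<longleftrightarrow>
    (\<forall>A\<subseteq>I. |A| <o |K| \<longrightarrow> (\<exists>f\<in>V. N f \<le> 1 \<and> \<epsilon> < N (restr (- A) (T f))))"

text \<open>
  An operator with large range sends \<open>|K|\<close> disjoint finitely supported vectors to vectors with
  substantial pieces on disjoint finite sets. Given fewer than \<open>|K|\<close> such pairs, let \<open>F\<close> and \<open>A0\<close> be
  the coordinates that they occupy. Up to a small error \<open>T\<close> maps the vectors supported in \<open>F\<close> into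
  the vectors supported in a set \<open>A1\<close> of size less than \<open>|K|\<close>. Hence a vector \<open>f\<close> with large image
  off \<open>A0 \<union> A1\<close> can be cut down to the complement of \<open>F\<close> and still has large image there, and one
  more pair is found.
\<close>

lemma disjoint_blocks:
  assumes T: "T \<in> ops" and K: "infinite K" and large: "large_range K T \<epsilon>" and "0 < \<epsilon>"
  obtains x B where "\<And>k. k \<in> K \<Longrightarrow> x k \<in> V \<and> N (x k) \<le> 1 \<and> finite {i. x k i \<noteq> 0}"
    "\<And>k. k \<in> K \<Longrightarrow> finite (B k) \<and> B k \<subseteq> I \<and> \<epsilon> / 2 < N (restr (B k) (T (x k)))"
    "disjoint_family_on (\<lambda>k. {i. x k i \<noteq> 0}) K" "disjoint_family_on B K"
proof -
  define G where "G = {(x, B). x \<in> V \<and> N x \<le> 1 \<and> finite {i. x i \<noteq> 0} \<and>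
    finite B \<and> B \<subseteq> I \<and> \<epsilon> / 2 < N (restr B (T x))}"
  define R :: "(('i \<Rightarrow> 'k) \<times> 'i set) \<Rightarrow> (('i \<Rightarrow> 'k) \<times> 'i set) \<Rightarrow> bool" where
    "R = (\<lambda>(x, B) (y, D). {i. x i \<noteq> 0} \<inter> {i. y i \<noteq> 0} = {} \<and> B \<inter> D = {})"
  have "\<exists>g\<in>G. g \<notin> S \<and> (\<forall>s\<in>S. R s g \<and> R g s)" if S: "S \<subseteq> G" "|S| <o |K|" for S
  proof -
    define F where "F = (\<Union>s\<in>S. {i. fst s i \<noteq> 0})"
    define A0 where "A0 = (\<Union>s\<in>S. snd s)"
    have F: "F \<subseteq> I" "|F| <o |K|"
    proof -
      show "F \<subseteq> I" using S(1) zero_outside by (fastforce simp: F_def G_def)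
      show "|F| <o |K|" unfolding F_def
        by (rule finite_UN_ordLess[OF K S(2)]) (use S(1) in \<open>auto simp: G_def\<close>)
    qed
    have A0: "A0 \<subseteq> I" "|A0| <o |K|"
    proof -
      show "A0 \<subseteq> I" using S(1) by (fastforce simp: A0_def G_def)
      show "|A0| <o |K|" unfolding A0_def
        by (rule finite_UN_ordLess[OF K S(2)]) (use S(1) in \<open>auto simp: G_def\<close>)
    qed
    obtain A1 where A1: "A1 \<subseteq> I" "|A1| <o |K|"
      "\<And>f. f \<in> V \<Longrightarrow> N (restr (- A1) (T (restr F f))) \<le> (\<epsilon> / 8) * N f"
      using small_range_off_small_set[OF T K F, of "\<epsilon> / 8"] \<open>0 < \<epsilon>\<close> by auto
    define A where "A = A0 \<union> A1"
    have "A \<subseteq> I" "|A| <o |K|" using A0 A1 Un_ordLess[OF K] by (auto simp: A_def)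
    then obtain f where f: "f \<in> V" "N f \<le> 1" "\<epsilon> < N (restr (- A) (T f))"
      using large by (auto simp: large_range_def)
    obtain C where C: "0 < C" "\<And>f. f \<in> V \<Longrightarrow> N (T f) \<le> C * N f" using op_bound[OF T] by blast
    obtain Q where Q: "Q \<subseteq> I" "finite Q" "N (restr (- Q) f) < \<epsilon> / (8 * C)"
      using small_tail[OF f(1), of "\<epsilon> / (8 * C)"] C(1) \<open>0 < \<epsilon>\<close> by auto
    define x where "x = restr (Q - F) f"
    have x: "x \<in> V" "N x \<le> 1" "finite {i. x i \<noteq> 0}" "{i. x i \<noteq> 0} \<inter> F = {}"
    proof -
      show "x \<in> V" "N x \<le> 1" using restr_in norm_restr_le f order_trans unfolding x_def by blast+
      show "finite {i. x i \<noteq> 0}" by (rule finite_subset[OF _ Q(2)]) (auto simp: x_def restr_def)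
      show "{i. x i \<noteq> 0} \<inter> F = {}" by (auto simp: x_def restr_def)
    qed
    define r where "r = restr (- Q - F) f"
    have r: "r \<in> V" "N r \<le> \<epsilon> / (8 * C)"
    proof -
      show "r \<in> V" using restr_in f(1) by (simp add: r_def)
      have "N r \<le> N (restr (- Q) f)" unfolding r_def by (rule norm_restr_mono[OF f(1)]) auto
      then show "N r \<le> \<epsilon> / (8 * C)" using Q(3) by simp
    qed
    have Tr: "N (restr (- A) (T r)) \<le> \<epsilon> / 8"
    proof -
      have "N (restr (- A) (T r)) \<le> C * N r"
        using norm_restr_le[OF op_in[OF T r(1)]] C(2)[OF r(1)] order_trans by blast
      also have "\<dots> \<le> C * (\<epsilon> / (8 * C))" using r(2) C(1) by (intro mult_left_mono) auto
      finally show ?thesis using C(1) by simp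
    qed
    have TF: "N (restr (- A) (T (restr F f))) \<le> \<epsilon> / 8"
    proof -
      have "N (restr (- A) (T (restr F f))) \<le> N (restr (- A1) (T (restr F f)))"
        by (rule norm_restr_mono[OF op_in[OF T restr_in[OF f(1)]]]) (auto simp: A_def)
      also have "\<dots> \<le> (\<epsilon> / 8) * N f" by (rule A1(3)[OF f(1)])
      also have "\<dots> \<le> (\<epsilon> / 8) * 1" using f(2) \<open>0 < \<epsilon>\<close> by (intro mult_left_mono) auto
      finally show ?thesis by simp
    qed
    have f_split: "f = (\<lambda>i. restr F f i + (x i + r i))"
      by (auto simp: x_def r_def restr_def)
    have Ff: "restr F f \<in> V" using restr_in f(1) by blast
    have T_split: "restr (- A) (T f) =
        (\<lambda>i. restr (- A) (T (restr F f)) i + (restr (- A) (T x) i + restr (- A) (T r) i))"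
    proof -
      have "T f = (\<lambda>i. T (restr F f) i + (T x i + T r i))"
        using op_add[OF T Ff add_in[OF x(1) r(1)]] op_add[OF T x(1) r(1)] f_split by simp
      then show ?thesis by (simp add: restr_add)
    qed
    have inV: "restr (- A) (T (restr F f)) \<in> V" "restr (- A) (T x) \<in> V" "restr (- A) (T r) \<in> V"
      using restr_in op_in[OF T] Ff x(1) r(1) by blast+
    have "N (restr (- A) (T f)) \<le> \<epsilon> / 8 + (N (restr (- A) (T x)) + \<epsilon> / 8)"
      using triangle[OF inV(1) add_in[OF inV(2,3)]] triangle[OF inV(2,3)] Tr TF T_split by simp
    then have Tx: "3/4 * \<epsilon> < N (restr (- A) (T x))" using f(3) by simp
    obtain P where P: "P \<subseteq> I" "finite P" "N (restr (- P) (restr (- A) (T x))) < \<epsilon> / 8"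
      using small_tail[OF inV(2), of "\<epsilon> / 8"] \<open>0 < \<epsilon>\<close> by auto
    define B where "B = P - A"
    have "restr P (restr (- A) (T x)) = restr B (T x)" by (auto simp: restr_def B_def)
    then have B: "\<epsilon> / 2 < N (restr B (T x))"
      using norm_restr_split[OF inV(2), of P] P(3) Tx \<open>0 < \<epsilon>\<close> by simp
    have "(x, B) \<in> G" using x P B by (auto simp: G_def B_def)
    moreover have "(x, B) \<notin> S"
    proof
      assume "(x, B) \<in> S"
      then have "B \<subseteq> A" by (force simp: A_def A0_def)
      then have "B = {}" by (auto simp: B_def)
      then show False using B \<open>0 < \<epsilon>\<close> by (simp add: restr_def nrm_zero)
    qed
    moreover have "R s (x, B) \<and> R (x, B) s" if "s \<in> S" for s
      using that x(4) by (force simp: R_def B_def A_def A0_def F_def)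
    ultimately show ?thesis by blast
  qed
  then obtain \<phi> where \<phi>: "inj_on \<phi> K" "\<phi> ` K \<subseteq> G" "pairwise R (\<phi> ` K)"
    using pairwise_family[of G R K] by blast
  have GK: "\<phi> k \<in> G" if "k \<in> K" for k using \<phi>(2) that by blast
  have RK: "R (\<phi> k) (\<phi> l)" if "k \<in> K" "l \<in> K" "k \<noteq> l" for k l
    using \<phi>(1,3) that by (metis image_eqI inj_on_eq_iff pairwiseD)
  show thesis
  proof (rule that[of "\<lambda>k. fst (\<phi> k)" "\<lambda>k. snd (\<phi> k)"])
    fix k assume "k \<in> K"
    then show "fst (\<phi> k) \<in> V \<and> N (fst (\<phi> k)) \<le> 1 \<and> finite {i. fst (\<phi> k) i \<noteq> 0}"
      "finite (snd (\<phi> k)) \<and> snd (\<phi> k) \<subseteq> I \<and> \<epsilon> / 2 < N (restr (snd (\<phi> k)) (T (fst (\<phi> k))))"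
      using GK[of k] by (auto simp: G_def split: prod.splits)
  next
    have "{i. fst (\<phi> k) i \<noteq> 0} \<inter> {i. fst (\<phi> l) i \<noteq> 0} = {} \<and> snd (\<phi> k) \<inter> snd (\<phi> l) = {}"
      if "k \<in> K" "l \<in> K" "k \<noteq> l" for k l
      using RK[OF that] by (simp only: R_def case_prod_beta)
    then show "disjoint_family_on (\<lambda>k. {i. fst (\<phi> k) i \<noteq> 0}) K" "disjoint_family_on (\<lambda>k. snd (\<phi> k)) K"
      by (simp_all only: disjoint_family_on_def) blast+
  qed
qed

text \<open>
  The operator maps \<open>a\<close> to \<open>\<Sum>k. a k * x k\<close>. At every coordinate at most one summand is non-zero, so
  that the series is a finite sum over the set \<open>D i\<close> of the relevant indices.
\<close>

lemma block_embedding: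
  assumes K: "K \<subseteq> I" and x: "\<And>k. k \<in> K \<Longrightarrow> x k \<in> V \<and> N (x k) \<le> 1 \<and> finite {i. x k i \<noteq> 0}"
    and disj: "disjoint_family_on (\<lambda>k. {i. x k i \<noteq> 0}) K"
  obtains U where "U \<in> ops" "\<And>k. k \<in> K \<Longrightarrow> U (unit_vec k) = x k"
proof -
  define D where "D i = {k \<in> K. x k i \<noteq> 0}" for i
  define \<Phi> where "\<Phi> a = (\<lambda>i. \<Sum>k\<in>D i. a k * x k i)" for a
  have D: "D i = {k}" if "k \<in> K" "x k i \<noteq> 0" for i k
    using that disj by (auto simp: D_def disjoint_family_on_def)
  have \<Phi>_on: "restr {i. x k i \<noteq> 0} (\<Phi> a) = (\<lambda>i. a k * x k i)" if "k \<in> K" for k a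
    using D[OF that] by (auto simp: restr_def \<Phi>_def)
  have "\<Phi> a \<in> V \<and> N (\<Phi> a) \<le> N a" if a: "a \<in> V" for a
  proof (rule domination[OF a, where B = "\<lambda>k. {k}" and C = "\<lambda>k. {i. x k i \<noteq> 0}" and K = K])
    fix k assume k: "k \<in> K"
    show "finite {i. x k i \<noteq> 0} \<and> {i. x k i \<noteq> 0} \<subseteq> I" using x[OF k] zero_outside by blast
    have "N (\<lambda>i. a k * x k i) \<le> norm (a k) * 1"
      using norm_scale[of "x k" "a k"] x[OF k] by (simp add: mult_left_le)
    then show "N (restr {i. x k i \<noteq> 0} (\<Phi> a)) \<le> N (restr {k} a)"
      using norm_restr_single[of k a] k K \<Phi>_on[OF k] by auto
  next
    fix i assume "i \<notin> (\<Union>k\<in>K. {i. x k i \<noteq> 0})"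
    then have "D i = {}" by (auto simp: D_def)
    then show "\<Phi> a i = 0" by (simp add: \<Phi>_def)
  qed (use K disj in \<open>auto simp: disjoint_family_on_def\<close>)
  then have "lin_op \<Phi> \<in> ops"
    by (intro lin_op_in[where C = 1])
      (auto simp: \<Phi>_def distrib_right sum.distrib sum_distrib_left mult.assoc)
  moreover have "lin_op \<Phi> (unit_vec k) = x k" if k: "k \<in> K" for k
  proof -
    have "\<Phi> (unit_vec k) i = x k i" for i
    proof -
      have "\<Phi> (unit_vec k) i = (\<Sum>l\<in>D i. if l = k then x k i else 0)"
        unfolding \<Phi>_def by (rule sum.cong) (auto simp: unit_vec_def)
      also have "\<dots> = x k i"
      proof (cases "x k i = 0")
        case False
        then show ?thesis using D[OF k False] by simp
      qed (simp add: sum.neutral)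
      finally show ?thesis .
    qed
    then show ?thesis using k K unit_in by (auto simp: lin_op_def)
  qed
  ultimately show thesis using that by blast
qed

text \<open>
  The functionals norm the blocks of the \<open>y k\<close> and are rescaled to take the value one there; the
  lower bound \<open>\<epsilon>\<close> keeps the rescaled functionals uniformly bounded.
\<close>

lemma block_functionals:
  assumes K: "K \<subseteq> I" and B: "\<And>k. k \<in> K \<Longrightarrow> finite (B k) \<and> B k \<subseteq> I"
    and disj: "disjoint_family_on B K" and "0 < \<epsilon>"
    and y: "\<And>k. k \<in> K \<Longrightarrow> \<epsilon> < N (restr (B k) (y k))"
  obtains W where "W \<in> ops" "\<And>k. k \<in> K \<Longrightarrow> y k \<in> V \<Longrightarrow> W (y k) k = 1"
proof -
  have "\<forall>k\<in>K. \<exists>c. (\<Sum>j\<in>B k. c j * y k j) = of_real (N (restr (B k) (y k))) \<and>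
      (\<forall>z\<in>V. norm (\<Sum>j\<in>B k. c j * z j) \<le> N (restr (B k) z))"
    using norming B by blast
  then obtain c where c: "\<And>k. k \<in> K \<Longrightarrow> (\<Sum>j\<in>B k. c k j * y k j) = of_real (N (restr (B k) (y k)))"
      "\<And>k z. k \<in> K \<Longrightarrow> z \<in> V \<Longrightarrow> norm (\<Sum>j\<in>B k. c k j * z j) \<le> N (restr (B k) z)"
    by metis
  define m where "m k = N (restr (B k) (y k))" for k
  define \<Phi> :: "('i \<Rightarrow> 'k) \<Rightarrow> 'i \<Rightarrow> 'k" where
    "\<Phi> z = (\<lambda>k. if k \<in> K then of_real (1 / m k) * (\<Sum>j\<in>B k. c k j * z j) else 0)" for z
  have m: "\<epsilon> < m k" if "k \<in> K" for k using y[OF that] by (simp add: m_def)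
  have "\<Phi> z \<in> V \<and> N (\<Phi> z) \<le> (1 / \<epsilon>) * N z" if z: "z \<in> V" for z
  proof -
    define z' where "z' = (\<lambda>i. of_real (1 / \<epsilon>) * z i)"
    have z': "z' \<in> V" "N z' = (1 / \<epsilon>) * N z"
      unfolding z'_def using scale_in[OF z] norm_scale[OF z, of "of_real (1 / \<epsilon>)"] \<open>0 < \<epsilon>\<close>
      by (blast, simp add: norm_divide)
    have "\<Phi> z \<in> V \<and> N (\<Phi> z) \<le> N z'"
    proof (rule domination[OF z'(1), where B = B and C = "\<lambda>k. {k}" and K = K])
      fix k assume k: "k \<in> K"
      have eq: "restr (B k) z' = (\<lambda>i. of_real (1 / \<epsilon>) * restr (B k) z i)"
        by (auto simp: restr_def z'_def)
      have "norm (\<Phi> z k) = (1 / m k) * norm (\<Sum>j\<in>B k. c k j * z j)"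
        using k m[OF k] \<open>0 < \<epsilon>\<close> by (simp add: \<Phi>_def norm_mult norm_divide)
      also have "\<dots> \<le> (1 / \<epsilon>) * N (restr (B k) z)"
        using c(2)[OF k z] m[OF k] \<open>0 < \<epsilon>\<close> by (intro mult_mono) (auto simp: frac_le)
      also have "\<dots> = N (restr (B k) z')"
        unfolding eq using norm_scale[OF restr_in[OF z], of "of_real (1 / \<epsilon>)"] \<open>0 < \<epsilon>\<close>
        by (simp add: norm_divide)
      finally show "N (restr {k} (\<Phi> z)) \<le> N (restr (B k) z')"
        using norm_restr_single k K by auto
    qed (use K B disj in \<open>auto simp: disjoint_family_on_def \<Phi>_def\<close>)
    then show ?thesis using z'(2) by simp
  qed
  note bound = this
  have "lin_op \<Phi> \<in> ops"
  proof (rule lin_op_in[where C = "1 / \<epsilon>", OF bound])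
    show "\<Phi> (\<lambda>i. f i + g i) = (\<lambda>j. \<Phi> f j + \<Phi> g j)" for f g
      by (simp add: \<Phi>_def fun_eq_iff distrib_left sum.distrib add_divide_distrib)
    show "\<Phi> (\<lambda>i. a * f i) = (\<lambda>j. a * \<Phi> f j)" for a f
      by (simp add: \<Phi>_def fun_eq_iff sum_distrib_left mult.left_commute)
  qed
  moreover have "lin_op \<Phi> (y k) k = 1" if k: "k \<in> K" "y k \<in> V" for k
    using k c(1)[OF k(1)] m[OF k(1)] \<open>0 < \<epsilon>\<close> by (simp add: lin_op_def \<Phi>_def m_def)
  ultimately show thesis using that by blast
qed

text \<open>
  Moving coordinates along an injection does not increase the norm, by domination with singleton
  blocks.
\<close>

lemma reindexing:
  assumes A: "A \<subseteq> I" "inj_on \<tau> A" "\<tau> ` A \<subseteq> I"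
  defines "\<Phi> \<equiv> \<lambda>(z :: 'i \<Rightarrow> 'k) i. if i \<in> A then z (\<tau> i) else 0"
  shows "lin_op \<Phi> \<in> ops" "\<And>z. z \<in> V \<Longrightarrow> N (\<Phi> z) \<le> N z" "\<And>z. z \<in> V \<Longrightarrow> \<Phi> z \<in> V"
proof -
  have *: "\<Phi> z \<in> V \<and> N (\<Phi> z) \<le> N z" if z: "z \<in> V" for z
  proof (rule domination[OF z, where B = "\<lambda>k. {\<tau> k}" and C = "\<lambda>k. {k}" and K = A])
    fix k assume k: "k \<in> A"
    then have "N (restr {k} (\<Phi> z)) = norm (z (\<tau> k))" "N (restr {\<tau> k} z) = norm (z (\<tau> k))"
      using A norm_restr_single by (auto simp: \<Phi>_def)
    then show "N (restr {k} (\<Phi> z)) \<le> N (restr {\<tau> k} z)" by simp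
  qed (use A in \<open>auto simp: disjoint_family_on_def \<Phi>_def inj_on_def\<close>)
  then show "\<And>z. z \<in> V \<Longrightarrow> N (\<Phi> z) \<le> N z" "\<And>z. z \<in> V \<Longrightarrow> \<Phi> z \<in> V" by auto
  show "lin_op \<Phi> \<in> ops"
  proof (rule lin_op_in[where C = 1])
    show "\<Phi> f \<in> V \<and> N (\<Phi> f) \<le> 1 * N f" if "f \<in> V" for f using *[OF that] by simp
  qed (auto simp: \<Phi>_def)
qed

text \<open>
  An operator with diagonal entries one on \<open>K\<close> is close to the identity after compression to some
  \<open>K' \<subseteq> K\<close> of the same size. This is isolated as a property of the space because \<open>\<ell>\<^sub>1\<close>
  and the other spaces have it for different reasons.
\<close>

definition diagonalizable :: bool where
  "diagonalizable \<longleftrightarrow> (\<forall>M\<in>ops. \<forall>K\<subseteq>I. \<forall>\<delta>>0. infinite K \<longrightarrow> (\<forall>k\<in>K. M (unit_vec k) k = 1) \<longrightarrow>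
    (\<exists>K'\<subseteq>K. |K'| =o |K| \<and>
      (\<forall>f\<in>V. N (\<lambda>i. restr K' (M (restr K' f)) i - restr K' f i) \<le> \<delta> * N f)))"

text \<open>
  The heart of the proof: up to an arbitrarily small error, the projection onto the coordinates in
  \<open>K\<close> factors through every operator with large range. Between the disjoint vectors and the disjoint
  functionals, \<open>T\<close> becomes an operator with diagonal one, its off-diagonal part is removed by passing
  to a subset of \<open>K\<close> of the same size, and this subset is identified with \<open>K\<close>.
\<close>

lemma approximate_factorization:
  assumes diag: diagonalizable and T: "T \<in> ops" and K: "K \<subseteq> I" "infinite K"
    and large: "large_range K T \<epsilon>" and "0 < \<epsilon>" "0 < \<delta>"
  obtains U W where "U \<in> ops" "W \<in> ops"
    "\<And>f. f \<in> V \<Longrightarrow> N (\<lambda>i. W (T (U f)) i - restr K f i) \<le> \<delta> * N f"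
proof -
  obtain x B where x: "\<And>k. k \<in> K \<Longrightarrow> x k \<in> V \<and> N (x k) \<le> 1 \<and> finite {i. x k i \<noteq> 0}"
    and B: "\<And>k. k \<in> K \<Longrightarrow> finite (B k) \<and> B k \<subseteq> I \<and> \<epsilon> / 2 < N (restr (B k) (T (x k)))"
    and disj: "disjoint_family_on (\<lambda>k. {i. x k i \<noteq> 0}) K" "disjoint_family_on B K"
    using disjoint_blocks[OF T K(2) large \<open>0 < \<epsilon>\<close>] by blast
  obtain U where U: "U \<in> ops" "\<And>k. k \<in> K \<Longrightarrow> U (unit_vec k) = x k"
    using block_embedding[OF K(1) x disj(1)] by blast
  obtain W where W: "W \<in> ops" "\<And>k. k \<in> K \<Longrightarrow> T (x k) \<in> V \<Longrightarrow> W (T (x k)) k = 1"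
    using block_functionals[OF K(1) _ disj(2), of "\<epsilon> / 2" "\<lambda>k. T (x k)"] B \<open>0 < \<epsilon>\<close> by auto
  define M where "M = W \<circ> (T \<circ> U)"
  have M: "M \<in> ops" unfolding M_def by (intro op_comp U W T)
  have "M (unit_vec k) k = 1" if "k \<in> K" for k
    using W(2)[OF that] U(2)[OF that] op_in[OF T] x[OF that] by (simp add: M_def)
  then obtain K' where K': "K' \<subseteq> K" "|K'| =o |K|"
    "\<And>f. f \<in> V \<Longrightarrow> N (\<lambda>i. restr K' (M (restr K' f)) i - restr K' f i) \<le> \<delta> * N f"
    using diag[unfolded diagonalizable_def, rule_format, OF M K(1) \<open>0 < \<delta>\<close> K(2)] by auto
  obtain \<sigma> where \<sigma>: "bij_betw \<sigma> K K'"
    using card_of_ordIso[of K K'] ordIso_symmetric[OF K'(2)] by auto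
  define \<tau> where "\<tau> = inv_into K \<sigma>"
  have \<tau>: "bij_betw \<tau> K' K" unfolding \<tau>_def by (rule bij_betw_inv_into[OF \<sigma>])
  have \<sigma>\<tau>: "\<tau> (\<sigma> k) = k" "\<sigma> k \<in> K'" if "k \<in> K" for k
    using \<sigma> that by (auto simp: \<tau>_def bij_betw_inv_into_left bij_betwE)
  define spread :: "('i \<Rightarrow> 'k) \<Rightarrow> 'i \<Rightarrow> 'k" where "spread z = (\<lambda>i. if i \<in> K' then z (\<tau> i) else 0)" for z
  define gather :: "('i \<Rightarrow> 'k) \<Rightarrow> 'i \<Rightarrow> 'k" where "gather z = (\<lambda>i. if i \<in> K then z (\<sigma> i) else 0)" for z
  have spread: "lin_op spread \<in> ops" "\<And>z. z \<in> V \<Longrightarrow> N (spread z) \<le> N z" "\<And>z. z \<in> V \<Longrightarrow> spread z \<in> V"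
    using reindexing[of K' \<tau>] K K' \<tau> unfolding spread_def bij_betw_def by (auto simp: spread_def[abs_def])
  have gather: "lin_op gather \<in> ops" "\<And>z. z \<in> V \<Longrightarrow> N (gather z) \<le> N z" "\<And>z. z \<in> V \<Longrightarrow> gather z \<in> V"
    using reindexing[of K \<sigma>] K K' \<sigma> unfolding gather_def bij_betw_def by (auto simp: gather_def[abs_def])
  show thesis
  proof (rule that[of "U \<circ> (proj K' \<circ> lin_op spread)" "lin_op gather \<circ> (proj K' \<circ> W)"])
    fix f assume f: "f \<in> V"
    have sf: "spread f \<in> V" by (rule spread(3)[OF f])
    have Mf: "M (restr K' (spread f)) \<in> V" using op_in[OF M restr_in[OF sf]] .
    have "(lin_op gather \<circ> (proj K' \<circ> W)) (T ((U \<circ> (proj K' \<circ> lin_op spread)) f)) =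
        gather (restr K' (M (restr K' (spread f))))"
      using Mf f sf restr_in op_in U(1) T W(1) by (simp add: M_def lin_op_def proj_apply)
    moreover have "restr K f = gather (restr K' (spread f))"
      using \<sigma>\<tau> by (auto simp: restr_def gather_def spread_def)
    ultimately have "(\<lambda>i. (lin_op gather \<circ> (proj K' \<circ> W)) (T ((U \<circ> (proj K' \<circ> lin_op spread)) f)) i
        - restr K f i) = gather (\<lambda>i. restr K' (M (restr K' (spread f))) i - restr K' (spread f) i)"
      by (auto simp: gather_def)
    moreover have "N (gather (\<lambda>i. restr K' (M (restr K' (spread f))) i - restr K' (spread f) i)) \<le> \<delta> * N f"
    proof -
      have "N (gather (\<lambda>i. restr K' (M (restr K' (spread f))) i - restr K' (spread f) i)) \<le> \<delta> * N (spread f)"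
        by (rule order_trans[OF gather(2) K'(3)[OF sf]]) (intro sub_in restr_in Mf sf)
      also have "\<dots> \<le> \<delta> * N f" using spread(2)[OF f] \<open>0 < \<delta>\<close> by simp
      finally show ?thesis .
    qed
    ultimately show "N (\<lambda>i. (lin_op gather \<circ> (proj K' \<circ> W)) (T ((U \<circ> (proj K' \<circ> lin_op spread)) f)) i
        - restr K f i) \<le> \<delta> * N f" by simp
  qed (intro op_comp proj_in U W spread gather)+
qed

end

section \<open>Removing the off-diagonal part of a matrix\<close>

lemma geometric_sum_inj_le_2:
  assumes "finite A" "inj_on r A"
  shows "(\<Sum>j\<in>A. (1/2::real) ^ (r j :: nat)) \<le> 2"
proof -
  have "(\<Sum>j\<in>A. (1/2::real) ^ r j) = (\<Sum>n\<in>r ` A. (1/2) ^ n)"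
    using assms(2) by (simp add: sum.reindex)
  also have "\<dots> \<le> (\<Sum>n. (1/2) ^ n)"
    using assms(1) by (intro sum_le_suminf) (auto simp: summable_geometric)
  also have "\<dots> = 2" by (simp add: suminf_geometric)
  finally show ?thesis .
qed

context disjoint_norm
begin

text \<open>
  The columns of the off-diagonal part of the compression of \<open>M\<close> to \<open>K\<close> are the vectors
  \<open>restr (K - {k}) (M (unit_vec k))\<close>; expanding a finitely supported vector in the basis bounds the
  operator by its columns.
\<close>

lemma off_diagonal_bound:
  assumes M: "M \<in> ops" and K: "K \<subseteq> I" "\<And>k. k \<in> K \<Longrightarrow> M (unit_vec k) k = 1" and "0 \<le> \<delta>"
    and cols: "\<And>F f. finite F \<Longrightarrow> F \<subseteq> K \<Longrightarrow> f \<in> V \<Longrightarrow>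
      (\<Sum>k\<in>F. norm (f k) * N (restr (K - {k}) (M (unit_vec k)))) \<le> \<delta> * N f"
    and f: "f \<in> V"
  shows "N (\<lambda>i. restr K (M (restr K f)) i - restr K f i) \<le> \<delta> * N f"
proof -
  define D where "D = add_op (proj K \<circ> (M \<circ> proj K)) (scale_op (-1) (proj K))"
  have D: "D \<in> ops" unfolding D_def by (intro op_add_op op_comp op_scale_op proj_in M)
  have D_apply: "D f = (\<lambda>i. restr K (M (restr K f)) i - restr K f i)" if "f \<in> V" for f
    using that op_in[OF M] restr_in by (simp add: D_def add_op_def scale_op_def proj_apply)
  have D_unit: "D (unit_vec k) = (if k \<in> K then restr (K - {k}) (M (unit_vec k)) else (\<lambda>i. 0))"
    if "k \<in> I" for k
  proof (cases "k \<in> K")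
    case True
    then have "restr K (unit_vec k) = (unit_vec k :: 'i \<Rightarrow> 'k)"
      by (auto simp: restr_def unit_vec_def)
    then show ?thesis using True K(2)[OF True] D_apply[OF unit_in[OF that]]
      by (auto simp: restr_def unit_vec_def)
  next
    case False
    then have "restr K (unit_vec k) = ((\<lambda>i. 0) :: 'i \<Rightarrow> 'k)"
      by (auto simp: restr_def unit_vec_def)
    then show ?thesis using False D_apply[OF unit_in[OF that]] by (simp add: op_zero[OF M] restr_def)
  qed
  have "N (D f) \<le> \<delta> * N f"
  proof (rule bound_if_finite_support_bound[OF D \<open>0 \<le> \<delta>\<close> _ f])
    fix F f assume F: "finite F" "F \<subseteq> I" "\<And>i. i \<notin> F \<Longrightarrow> f i = 0" and f: "f \<in> V"
    have "D f = (\<lambda>j. \<Sum>k\<in>F. f k * D (unit_vec k) j)" by (rule op_finite_support[OF D F])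
    then have "N (D f) \<le> (\<Sum>k\<in>F. norm (f k) * N (D (unit_vec k)))"
      using finite_combination[OF F(1), of "\<lambda>k. D (unit_vec k)" f] op_value_in[OF D] by simp
    also have "\<dots> = (\<Sum>k\<in>F \<inter> K. norm (f k) * N (restr (K - {k}) (M (unit_vec k))))"
    proof (rule sum.mono_neutral_cong_right[OF F(1)])
      show "\<forall>k\<in>F - F \<inter> K. norm (f k) * N (D (unit_vec k)) = 0"
      proof
        fix k assume k: "k \<in> F - F \<inter> K"
        then have "D (unit_vec k) = (\<lambda>i. 0)" using D_unit[of k] F(2) by auto
        then show "norm (f k) * N (D (unit_vec k)) = 0" by (simp add: nrm_zero)
      qed
    qed (use D_unit F(2) in auto)
    also have "\<dots> \<le> \<delta> * N f" by (rule cols) (use F f in auto)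
    finally show "N (D f) \<le> \<delta> * N f" .
  qed
  then show ?thesis using D_apply[OF f] by simp
qed

text \<open>
  The case of \<open>\<ell>\<^sub>1\<close>. There the norm of an operator is the supremum of the norms of its columns, and
  the columns of \<open>M\<close> are uniformly bounded vectors whose norms behave like measures, so that
  Rosenthal's argument applies.
\<close>

lemma diagonalizable_if_superadditive:
  assumes super: "\<And>f A B. f \<in> V \<Longrightarrow> A \<inter> B = {} \<Longrightarrow>
    N (restr A f) + N (restr B f) \<le> N (restr (A \<union> B) f)"
  shows diagonalizable
  unfolding diagonalizable_def
proof (intro ballI allI impI)
  fix M :: "('i, 'k) operator" and K \<delta>
  assume M: "M \<in> ops" and K: "K \<subseteq> I" "infinite K" and diag: "\<forall>k\<in>K. M (unit_vec k) k = 1"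
    and \<delta>: "(0::real) < \<delta>"
  obtain C where C: "0 < C" "\<And>f. f \<in> V \<Longrightarrow> N (M f) \<le> C * N f" using op_bound[OF M] by blast
  obtain n where n: "C \<le> real n * \<delta>"
    using reals_Archimedean3[OF \<delta>] less_imp_le by blast
  have "\<exists>K'\<subseteq>K. |K'| =o |K| \<and> (\<forall>k\<in>K'. N (restr (K' - {k}) (M (unit_vec k))) \<le> \<delta>)"
  proof (rule rosenthal_disjointification[where \<mu> = "\<lambda>k A. N (restr A (M (unit_vec k)))"])
    show "N (restr (K - {k}) (M (unit_vec k))) \<le> real n * \<delta>" if "k \<in> K" for k
    proof -
      have "unit_vec k \<in> V" "N (unit_vec k) = 1" using that K(1) unit_in norm_unit by auto
      then show ?thesis using norm_restr_le[OF op_value_in[OF M], of "K - {k}" "unit_vec k"]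
          C(2)[of "unit_vec k"] n by simp
    qed
  qed (use K \<delta> in \<open>auto intro!: norm_nonneg restr_in op_value_in[OF M] norm_restr_mono super\<close>)
  then obtain K' where K': "K' \<subseteq> K" "|K'| =o |K|"
    "\<And>k. k \<in> K' \<Longrightarrow> N (restr (K' - {k}) (M (unit_vec k))) \<le> \<delta>" by blast
  have sum_le: "(\<Sum>k\<in>F. norm (f k)) \<le> N (restr F f)" if "finite F" "F \<subseteq> I" "f \<in> V" for F f
    using that(1,2)
  proof (induction F)
    case empty
    then show ?case using that(3) norm_nonneg restr_in by auto
  next
    case (insert k F)
    then show ?case using super[OF that(3), of "{k}" F] norm_restr_single[of k f] by auto
  qed
  have "N (\<lambda>i. restr K' (M (restr K' f)) i - restr K' f i) \<le> \<delta> * N f" if f: "f \<in> V" for f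
  proof (rule off_diagonal_bound[OF M _ _ _ _ f])
    fix F f assume F: "finite F" "F \<subseteq> K'" and f: "f \<in> V"
    have "(\<Sum>k\<in>F. norm (f k) * N (restr (K' - {k}) (M (unit_vec k)))) \<le> (\<Sum>k\<in>F. norm (f k) * \<delta>)"
      by (intro sum_mono mult_left_mono K'(3)) (use F in auto)
    also have "\<dots> = \<delta> * (\<Sum>k\<in>F. norm (f k))" by (simp add: sum_distrib_left mult.commute)
    also have "\<dots> \<le> \<delta> * N f"
      using order_trans[OF sum_le[of F f] norm_restr_le[OF f]] F f K'(1) K(1) \<delta>
      by (intro mult_left_mono) auto
    finally show "(\<Sum>k\<in>F. norm (f k) * N (restr (K' - {k}) (M (unit_vec k)))) \<le> \<delta> * N f" .
  qed (use K K' diag \<delta> in auto)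
  then show "\<exists>K'\<subseteq>K. |K'| =o |K| \<and>
      (\<forall>f\<in>V. N (\<lambda>i. restr K' (M (restr K' f)) i - restr K' f i) \<le> \<delta> * N f)"
    using K' by blast
qed

text \<open>
  This holds in \<open>c\<^sub>0\<close> and in \<open>\<ell>\<^sub>p\<close> for \<open>p > 1\<close> and fails in \<open>\<ell>\<^sub>1\<close>. It stands for the fact that the
  unit vectors are weakly null.
\<close>

definition sublinear_indicators :: bool where
  "sublinear_indicators \<longleftrightarrow> (\<forall>\<eta>>0. \<exists>n>0. \<forall>F\<subseteq>I. finite F \<longrightarrow> card F = n \<longrightarrow>
    N (\<lambda>i. if i \<in> F then 1 else 0) \<le> \<eta> * real n)"

text \<open>
  If \<open>n\<close> entries of the row have modulus at least \<open>\<eta>\<close>, then a sum of \<open>n\<close> unit vectors with suitable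
  unimodular coefficients has an image of norm at least \<open>n \<eta>\<close>, whereas its own norm is \<open>o(n)\<close>.
\<close>

lemma finitely_many_large_in_row:
  assumes flat: sublinear_indicators and M: "M \<in> ops" and "0 < \<eta>"
  shows "finite {k \<in> I. \<eta> \<le> norm (M (unit_vec k) j)}" (is "finite ?L")
proof (rule ccontr)
  assume inf: "infinite ?L"
  obtain C where C: "0 < C" "\<And>f. f \<in> V \<Longrightarrow> N (M f) \<le> C * N f" using op_bound[OF M] by blast
  obtain n where n: "n > 0" "\<And>F. F \<subseteq> I \<Longrightarrow> finite F \<Longrightarrow> card F = n \<Longrightarrow>
      N (\<lambda>i. if i \<in> F then 1 else 0) \<le> \<eta> / (2 * C) * real n"
    using flat C(1) \<open>0 < \<eta>\<close> unfolding sublinear_indicators_def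
    by (metis divide_pos_pos mult_pos_pos zero_less_numeral)
  obtain F where F: "F \<subseteq> ?L" "finite F" "card F = n"
    using infinite_arbitrarily_large[OF inf] by blast
  define m where "m k = M (unit_vec k) j" for k
  \<comment> \<open>The coefficients turn the entries of row \<open>j\<close> into their moduli.\<close>
  define f :: "'i \<Rightarrow> 'k" where "f = (\<lambda>k. if k \<in> F then of_real (norm (m k)) / m k else 0)"
  have FI: "F \<subseteq> I" using F by blast
  have f: "f \<in> V" by (rule finite_support(1)[OF F(2) FI]) (simp add: f_def)
  have one: "(\<lambda>i. if i \<in> F then 1 else 0) \<in> V"
    by (rule finite_support(1)[OF F(2) FI]) simp
  have "N f \<le> N (\<lambda>i. if i \<in> F then 1 else 0)"
    by (rule solid(2)[OF one]) (simp add: f_def norm_divide)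
  then have Nf: "N f \<le> \<eta> / (2 * C) * real n" using n(2)[OF FI F(2,3)] by linarith
  have "M f j = (\<Sum>k\<in>F. f k * m k)"
    using op_finite_support[OF M F(2) FI, of f] by (simp add: f_def m_def)
  also have "\<dots> = (\<Sum>k\<in>F. of_real (norm (m k)))"
    by (rule sum.cong) (auto simp: f_def)
  also have "\<dots> = of_real (\<Sum>k\<in>F. norm (m k))" by simp
  finally have "norm (M f j) = \<bar>\<Sum>k\<in>F. norm (m k)\<bar>" by (simp only: norm_of_real)
  then have "norm (M f j) = (\<Sum>k\<in>F. norm (m k))" by (simp add: sum_nonneg)
  also have "\<dots> \<ge> (\<Sum>k\<in>F. \<eta>)" by (rule sum_mono) (use F in \<open>auto simp: m_def\<close>)
  finally have "real n * \<eta> \<le> norm (M f j)" using F(3) by simp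
  also have "\<dots> \<le> N (M f)" by (rule coord_le[OF op_in[OF M f]])
  also have "\<dots> \<le> C * N f" by (rule C(2)[OF f])
  also have "\<dots> \<le> C * (\<eta> / (2 * C) * real n)" using Nf C(1) by (intro mult_left_mono) auto
  also have "\<dots> = real n * \<eta> / 2" using C(1) by simp
  finally show False using n(1) \<open>0 < \<eta>\<close> by simp
qed

lemma countable_row:
  assumes flat: sublinear_indicators and M: "M \<in> ops"
  shows "countable {k \<in> I. M (unit_vec k) j \<noteq> 0}"
proof -
  have "{k \<in> I. M (unit_vec k) j \<noteq> 0} \<subseteq> (\<Union>n. {k \<in> I. inverse (real (Suc n)) \<le> norm (M (unit_vec k) j)})"
  proof
    fix k assume k: "k \<in> {k \<in> I. M (unit_vec k) j \<noteq> 0}"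
    then obtain n where "inverse (real (Suc n)) < norm (M (unit_vec k) j)"
      using reals_Archimedean[of "norm (M (unit_vec k) j)"] by auto
    then show "k \<in> (\<Union>n. {k \<in> I. inverse (real (Suc n)) \<le> norm (M (unit_vec k) j)})"
      using k less_imp_le by blast
  qed
  moreover have "countable (\<Union>n. {k \<in> I. inverse (real (Suc n)) \<le> norm (M (unit_vec k) j)})"
    by (rule countable_UN[OF countableI_type], rule countable_finite,
        rule finitely_many_large_in_row[OF flat M]) simp
  ultimately show ?thesis using countable_subset by blast
qed

text \<open>
  Now the rows as well as the columns of \<open>M\<close> tend to zero. If \<open>K\<close> is uncountable, every index is
  therefore linked to only countably many others by non-zero entries of \<open>M\<close>, and \<open>|K|\<close> mutually
  unlinked indices can be selected; the off-diagonal part disappears. If \<open>K\<close> is countable, a gliding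
  hump argument selects infinitely many indices with absolutely summable off-diagonal part. In the
  latter case each selected index \<open>k\<close> carries a label \<open>r\<close>, different for different indices, and
  the entry at a pair of indices with labels \<open>r\<close>, \<open>s\<close> has to be at most a multiple of
  \<open>(1/2) ^ (r + s)\<close>. The labels make this a condition on pairs, so that both cases use the same
  selection principle.
\<close>

lemma diagonalizable_if_sublinear_indicators:
  assumes flat: sublinear_indicators
  shows diagonalizable
  unfolding diagonalizable_def
proof (intro ballI allI impI)
  fix M :: "('i, 'k) operator" and K \<delta>
  assume M: "M \<in> ops" and K: "K \<subseteq> I" "infinite K" and diag: "\<forall>k\<in>K. M (unit_vec k) k = 1"
    and \<delta>: "(0::real) < \<delta>"
  have "\<exists>K'\<subseteq>K. |K'| =o |K| \<and> (\<forall>F f. finite F \<longrightarrow> F \<subseteq> K' \<longrightarrow> f \<in> V \<longrightarrow>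
      (\<Sum>k\<in>F. norm (f k) * N (restr (K' - {k}) (M (unit_vec k)))) \<le> \<delta> * N f)"
  proof (cases "countable K")
    case False
    define R where "R j k \<longleftrightarrow> M (unit_vec k) j = 0 \<and> M (unit_vec j) k = 0" for j k
    have "\<exists>g\<in>K. g \<notin> S \<and> (\<forall>s\<in>S. R s g \<and> R g s)" if S: "S \<subseteq> K" "|S| <o |K|" for S
    proof -
      define bad where "bad = (\<Union>s\<in>S. {k \<in> I. M (unit_vec k) s \<noteq> 0} \<union> {k. M (unit_vec s) k \<noteq> 0})"
      have "|bad| <o |K|" unfolding bad_def
        by (rule countable_UN_ordLess[OF False S(2)])
          (simp add: countable_row[OF flat M] countable_support op_value_in[OF M])
      then have "|bad \<union> S| <o |K|" using Un_ordLess[OF K(2)] S(2) by blast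
      then obtain k where "k \<in> K" "k \<notin> bad \<union> S" using ordLess_Diff_nonempty by metis
      moreover have "R s k \<and> R k s" if "s \<in> S" for s
        using that \<open>k \<in> K\<close> \<open>k \<notin> bad \<union> S\<close> K(1) unfolding R_def bad_def by blast
      ultimately show ?thesis by blast
    qed
    note extend = this
    obtain \<phi> where \<phi>: "inj_on \<phi> K" "\<phi> ` K \<subseteq> K" "pairwise R (\<phi> ` K)"
      by (rule pairwise_family[of K R K]) (use extend in auto)
    have card: "|\<phi> ` K| =o |K|"
      using card_of_ordIso[of K "\<phi> ` K"] inj_on_imp_bij_betw[OF \<phi>(1)] ordIso_symmetric by blast
    have off_zero: "restr (\<phi> ` K - {k}) (M (unit_vec k)) = (\<lambda>i. 0)" if "k \<in> \<phi> ` K" for k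
    proof
      fix i show "restr (\<phi> ` K - {k}) (M (unit_vec k)) i = 0"
        using \<phi>(3) that unfolding pairwise_def R_def restr_def by auto
    qed
    have "(\<Sum>k\<in>F. norm (f k) * N (restr (\<phi> ` K - {k}) (M (unit_vec k)))) \<le> \<delta> * N f"
      if "F \<subseteq> \<phi> ` K" "f \<in> V" for F f
    proof -
      have "(\<Sum>k\<in>F. norm (f k) * N (restr (\<phi> ` K - {k}) (M (unit_vec k)))) = 0"
        using that(1) off_zero by (intro sum.neutral) (auto simp: nrm_zero subset_iff)
      then show ?thesis using norm_nonneg[OF that(2)] \<delta> by simp
    qed
    then show ?thesis using \<phi>(2) card by blast
  next
    case True
    define b where "b r s = \<delta> / 4 * (1/2) ^ r * (1/2) ^ s" for r s :: nat
    have b: "0 < b r s" "b r s = b s r" for r s using \<delta> by (auto simp: b_def)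
    define R where "R = (\<lambda>(j, r) (k, s). j \<noteq> k \<and> r \<noteq> s \<and>
      norm (M (unit_vec k) j) \<le> b r s \<and> norm (M (unit_vec j) k) \<le> b r s)"
    have "\<exists>g\<in>K \<times> UNIV. g \<notin> S \<and> (\<forall>s\<in>S. R s g \<and> R g s)"
      if S: "S \<subseteq> K \<times> UNIV" "|S| <o |K|" for S :: "('i \<times> nat) set"
    proof -
      have "finite S"
        using countable_ordLeq_infinite[OF _ True, of S] S(2) not_ordLess_ordLeq by blast
      \<comment> \<open>The label is fixed first; then almost all indices satisfy the finitely many bounds.\<close>
      then obtain r where r: "r \<notin> snd ` S" using ex_new_if_finite[of "snd ` S"] by auto
      define bad where "bad = (\<Union>(j, s)\<in>S. {k \<in> I. b r s \<le> norm (M (unit_vec k) j)} \<union>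
        {k. b r s \<le> norm (M (unit_vec j) k)}) \<union> fst ` S"
      have "finite bad" unfolding bad_def using \<open>finite S\<close> b(1)
        by (auto intro: finitely_many_large_in_row[OF flat M] finitely_many_large op_value_in[OF M])
      then obtain k where k: "k \<in> K" "k \<notin> bad" using K(2) by (meson finite_subset subsetI)
      have "R s (k, r) \<and> R (k, r) s" if "s \<in> S" for s
      proof -
        obtain j t where s: "s = (j, t)" by fastforce
        have "j \<noteq> k" "t \<noteq> r" using that r k(2) unfolding s bad_def by force+
        moreover have "norm (M (unit_vec k) j) < b r t" "norm (M (unit_vec j) k) < b r t"
          using that k K(1) unfolding s bad_def by force+
        ultimately show ?thesis by (auto simp: R_def s b(2)[of t r])
      qed
      moreover have "(k, r) \<notin> S" using r by force
      ultimately show ?thesis using k(1) by blast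
    qed
    note extend = this
    obtain \<phi> where \<phi>: "inj_on \<phi> K" "\<phi> ` K \<subseteq> K \<times> UNIV" "pairwise R (\<phi> ` K)"
      by (rule pairwise_family[of "K \<times> UNIV" R K]) (use extend in auto)
    define K' where "K' = (\<lambda>k. fst (\<phi> k)) ` K"
    \<comment> \<open>Distinct selected pairs have distinct first components, so the label of an index is unique.\<close>
    define r where "r k = (SOME s. (k, s) \<in> \<phi> ` K)" for k
    have pr: "(k, r k) \<in> \<phi> ` K" if k: "k \<in> K'" for k
    proof -
      obtain l where "l \<in> K" "k = fst (\<phi> l)" using k by (auto simp: K'_def)
      then have "(k, snd (\<phi> l)) \<in> \<phi> ` K" by simp
      then have "\<exists>s. (k, s) \<in> \<phi> ` K" by blast
      then show ?thesis unfolding r_def by (rule someI_ex)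
    qed
    have RK: "R (j, r j) (k, r k)" if "j \<in> K'" "k \<in> K'" "j \<noteq> k" for j k
      by (rule pairwiseD[OF \<phi>(3) pr[OF that(1)] pr[OF that(2)]]) (simp add: that(3))
    have "inj_on (\<lambda>k. fst (\<phi> k)) K"
    proof (rule inj_onI, rule ccontr)
      fix j k assume jk: "j \<in> K" "k \<in> K" "fst (\<phi> j) = fst (\<phi> k)" "j \<noteq> k"
      then have "\<phi> j \<noteq> \<phi> k" using \<phi>(1) by (auto dest: inj_onD)
      then have "R (\<phi> j) (\<phi> k)" using \<phi>(3) jk by (auto simp: pairwise_def)
      then show False using jk(3) by (auto simp: R_def split: prod.splits)
    qed
    then have card: "|K'| =o |K|" unfolding K'_def
      using card_of_ordIso[of K "(\<lambda>k. fst (\<phi> k)) ` K"] inj_on_imp_bij_betw ordIso_symmetric by blast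
    have sub: "K' \<subseteq> K" using \<phi>(2) by (force simp: K'_def)
    have inj_r: "inj_on r K'" using RK by (force simp: inj_on_def R_def)
    have col: "N (restr (K' - {k}) (M (unit_vec k))) \<le> \<delta> / 2 * (1/2) ^ r k" if k: "k \<in> K'" for k
    proof (rule norm_le_if_finite_restr_le)
      fix Q assume Q: "finite Q" "Q \<subseteq> I"
      have "N (restr Q (restr (K' - {k}) (M (unit_vec k)))) \<le>
          (\<Sum>j\<in>Q. norm (restr Q (restr (K' - {k}) (M (unit_vec k))) j))"
        by (rule finite_support(2)[OF Q]) (simp add: restr_def)
      also have "\<dots> = (\<Sum>j\<in>Q \<inter> (K' - {k}). norm (M (unit_vec k) j))"
        using Q(1) by (intro sum.mono_neutral_cong_right) (auto simp: restr_def)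
      also have "\<dots> \<le> (\<Sum>j\<in>Q \<inter> (K' - {k}). \<delta> / 4 * (1/2) ^ r k * (1/2) ^ r j)"
      proof (rule sum_mono)
        fix j assume "j \<in> Q \<inter> (K' - {k})"
        then have "R (j, r j) (k, r k)" using RK k by blast
        then show "norm (M (unit_vec k) j) \<le> \<delta> / 4 * (1/2) ^ r k * (1/2) ^ r j"
          by (simp add: R_def b_def mult_ac)
      qed
      also have "\<dots> = \<delta> / 4 * (1/2) ^ r k * (\<Sum>j\<in>Q \<inter> (K' - {k}). (1/2) ^ r j)"
        by (simp add: sum_distrib_left)
      also have "\<dots> \<le> \<delta> / 4 * (1/2) ^ r k * 2"
        using Q(1) \<delta> inj_on_subset[OF inj_r, of "Q \<inter> (K' - {k})"] by (intro mult_left_mono geometric_sum_inj_le_2) auto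
      finally show "N (restr Q (restr (K' - {k}) (M (unit_vec k)))) \<le> \<delta> / 2 * (1/2) ^ r k" by simp
    qed (intro restr_in op_value_in M)
    have "(\<Sum>k\<in>F. norm (f k) * N (restr (K' - {k}) (M (unit_vec k)))) \<le> \<delta> * N f"
      if F: "finite F" "F \<subseteq> K'" and f: "f \<in> V" for F f
    proof -
      have "(\<Sum>k\<in>F. norm (f k) * N (restr (K' - {k}) (M (unit_vec k)))) \<le>
          (\<Sum>k\<in>F. N f * (\<delta> / 2 * (1/2) ^ r k))"
        using F(2) by (intro sum_mono mult_mono coord_le f col norm_nonneg restr_in op_value_in M) auto
      also have "\<dots> = (N f * (\<delta> / 2)) * (\<Sum>k\<in>F. (1/2) ^ r k)" by (simp add: sum_distrib_left mult.assoc)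
      also have "\<dots> \<le> (N f * (\<delta> / 2)) * 2"
        using F \<delta> inj_on_subset[OF inj_r] norm_nonneg[OF f]
        by (intro mult_left_mono geometric_sum_inj_le_2) auto
      finally show ?thesis by (simp add: mult.commute)
    qed
    then show ?thesis using sub card by blast
  qed
  then obtain K' where K': "K' \<subseteq> K" "|K'| =o |K|"
    "\<And>F f. finite F \<Longrightarrow> F \<subseteq> K' \<Longrightarrow> f \<in> V \<Longrightarrow>
      (\<Sum>k\<in>F. norm (f k) * N (restr (K' - {k}) (M (unit_vec k)))) \<le> \<delta> * N f" by blast
  have "N (\<lambda>i. restr K' (M (restr K' f)) i - restr K' f i) \<le> \<delta> * N f" if f: "f \<in> V" for f
    by (rule off_diagonal_bound[OF M _ _ _ K'(3) f]) (use K'(1) K(1) diag \<delta> in auto)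
  then show "\<exists>K'\<subseteq>K. |K'| =o |K| \<and>
      (\<forall>f\<in>V. N (\<lambda>i. restr K' (M (restr K' f)) i - restr K' f i) \<le> \<delta> * N f)"
    using K' by blast
qed

end

section \<open>Closed ideals\<close>

definition closed_pointwise :: "('i \<Rightarrow> 'k::real_normed_field) set \<Rightarrow> bool" where
  "closed_pointwise W \<longleftrightarrow> (\<forall>f\<in>W. \<forall>g\<in>W. (\<lambda>i. f i + g i) \<in> W) \<and> (\<forall>a. \<forall>f\<in>W. (\<lambda>i. a * f i) \<in> W)"

lemma bounded_linear_map_cong:
  assumes "bounded_linear_map X Y T" "\<And>f. f \<in> vecs X \<Longrightarrow> T' f = T f" "closed_pointwise (vecs X)"
  shows "bounded_linear_map X Y T'"
  using assms unfolding bounded_linear_map_def closed_pointwise_def by auto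

text \<open>
  Isomorphism is symmetric. The inverse of the inverse agrees with \<open>U\<close> only on the space, so closure
  under the vector space operations is needed to transfer linearity.
\<close>

lemma isomorphic_spaces_if_inverse:
  assumes bij: "bij_betw U (vecs Y) (vecs X)" and U: "bounded_linear_map Y X U"
    and inv: "bounded_linear_map X Y (inv_into (vecs Y) U)" and closed: "closed_pointwise (vecs Y)"
  shows "isomorphic_spaces X Y"
proof -
  let ?U = "inv_into (vecs Y) U"
  have "bij_betw ?U (vecs X) (vecs Y)" by (rule bij_betw_inv_into[OF bij])
  moreover have "bounded_linear_map Y X (inv_into (vecs X) ?U)"
    by (rule bounded_linear_map_cong[OF U _ closed]) (rule inv_into_inv_into_eq[OF bij])
  ultimately show ?thesis unfolding isomorphic_spaces_def using inv by blast
qed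

context disjoint_norm
begin

text \<open>
  Fewer than \<open>|K|\<close> coordinates cannot keep the images of \<open>|K|\<close> unit vectors apart. Up to a small
  error each \<open>T (unit_vec k)\<close>, restricted to \<open>A\<close>, lives on a finite subset of \<open>A\<close>. There are
  fewer than \<open>|K|\<close> such subsets, so infinitely many indices \<open>k\<close> share one of them, and a bounded
  infinite family in a finite-dimensional space contains two members that are close to each other.
\<close>

lemma close_images:
  assumes T: "T \<in> ops" and K: "K \<subseteq> I" "infinite K" and A: "|A| <o |K|" and "0 < \<delta>"
  obtains k l where "k \<in> K" "l \<in> K" "k \<noteq> l"
    "N (restr A (T (\<lambda>i. unit_vec k i - unit_vec l i))) < \<delta>"
proof -
  have u: "unit_vec k \<in> V" "N (unit_vec k) = 1" if "k \<in> K" for k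
    using that K unit_in norm_unit by auto
  have "\<exists>R\<subseteq>I. finite R \<and> N (restr (- R) (T (unit_vec k))) < \<delta> / 4" for k
    by (rule small_tail[OF op_value_in[OF T]]) (use \<open>0 < \<delta>\<close> in simp)
  then obtain R where R: "\<And>k. R k \<subseteq> I \<and> finite (R k) \<and> N (restr (- R k) (T (unit_vec k))) < \<delta> / 4"
    by metis
  obtain R0 where R0: "infinite {k \<in> K. R k \<inter> A = R0}"
    by (rule pigeonhole_finite_sets[OF K(2) A, of "\<lambda>k. R k \<inter> A"]) (use R in auto)
  define L where "L = {k \<in> K. R k \<inter> A = R0}"
  obtain k0 where k0: "k0 \<in> L" using R0 by (metis L_def ex_in_conv finite.emptyI)
  have fR0: "finite R0" "R0 \<subseteq> I" using k0 R by (auto simp: L_def)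
  obtain C where C: "0 < C" "\<And>f. f \<in> V \<Longrightarrow> N (T f) \<le> C * N f" using op_bound[OF T] by blast
  have bound: "norm (T (unit_vec k) j) \<le> C" if "k \<in> L" for k j
    using coord_le[OF op_value_in[OF T], of "unit_vec k" j] C(2)[of "unit_vec k"] u[of k] that
    by (simp add: L_def)
  define \<eta> where "\<eta> = \<delta> / (4 * (real (card R0) + 1))"
  have "0 < \<eta>" using \<open>0 < \<delta>\<close> by (simp add: \<eta>_def)
  obtain L' where L': "L' \<subseteq> L" "infinite L'"
      "\<forall>j\<in>R0. \<forall>k\<in>L'. \<forall>l\<in>L'. norm (T (unit_vec k) j - T (unit_vec l) j) < \<eta>"
    using bounded_infinite_close_subset[of R0 L \<eta> "\<lambda>k. T (unit_vec k)" C] fR0 R0 \<open>0 < \<eta>\<close> bound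
    unfolding L_def[symmetric] by auto
  obtain k where k: "k \<in> L'" using L'(2) by (metis ex_in_conv finite.emptyI)
  obtain l where l: "l \<in> L'" "l \<noteq> k" using L'(2) by (metis finite.emptyI finite_insert infinite_super insertCI subsetI)
  have kl: "k \<in> K" "l \<in> K" "R k \<inter> A = R0" "R l \<inter> A = R0" using k l L'(1) by (auto simp: L_def)
  define h where "h = T (\<lambda>i. unit_vec k i - unit_vec l i)"
  have h: "h = (\<lambda>j. T (unit_vec k) j - T (unit_vec l) j)"
    unfolding h_def by (rule op_sub[OF T u(1)[OF kl(1)] u(1)[OF kl(2)]])
  have hV: "h \<in> V" unfolding h_def by (rule op_value_in[OF T])
  have 1: "N (restr R0 h) \<le> \<delta> / 4"
  proof -
    have "N (restr R0 h) \<le> (\<Sum>j\<in>R0. norm (restr R0 h j))"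
      by (rule finite_support(2)[OF fR0]) (simp add: restr_def)
    also have "\<dots> \<le> (\<Sum>j\<in>R0. \<eta>)"
      by (rule sum_mono) (use L'(3) k l in \<open>auto simp: restr_def h intro: less_imp_le\<close>)
    also have "\<dots> = (real (card R0) / (real (card R0) + 1)) * (\<delta> / 4)"
      by (simp add: \<eta>_def)
    also have "\<dots> \<le> 1 * (\<delta> / 4)" using \<open>0 < \<delta>\<close> by (intro mult_right_mono) auto
    finally show ?thesis by simp
  qed
  have 2: "N (restr (A - R0) h) \<le> \<delta> / 4 + \<delta> / 4"
  proof -
    have "N (restr (A - R0) h) \<le> N (restr (A - R0) (T (unit_vec k))) + N (restr (A - R0) (T (unit_vec l)))"
      unfolding h restr_sub by (intro triangle_sub restr_in op_value_in T)
    moreover have "N (restr (A - R0) (T (unit_vec k))) \<le> N (restr (- R k) (T (unit_vec k)))"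
      by (rule norm_restr_mono[OF op_value_in[OF T]]) (use kl in auto)
    moreover have "N (restr (A - R0) (T (unit_vec l))) \<le> N (restr (- R l) (T (unit_vec l)))"
      by (rule norm_restr_mono[OF op_value_in[OF T]]) (use kl in auto)
    ultimately show ?thesis using R[of k] R[of l] by linarith
  qed
  have "N (restr A h) \<le> N (restr R0 (restr A h)) + N (restr (- R0) (restr A h))"
    by (rule norm_restr_split[OF restr_in[OF hV]])
  moreover have "restr R0 (restr A h) = restr R0 h" "restr (- R0) (restr A h) = restr (A - R0) h"
    using kl by (auto simp: restr_def)
  ultimately have "N (restr A h) < \<delta>" using 1 2 \<open>0 < \<delta>\<close> by simp
  then show thesis using that[OF kl(1,2)] l(2) by (simp add: h_def)
qed

text \<open>
  For any \<open>A\<close> of size less than \<open>|K|\<close>, some difference \<open>h\<close> of two unit vectors has an image that is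
  small on \<open>A\<close>. As \<open>T\<close> is bounded below at \<open>h\<close>, the image is large off \<open>A\<close>. The norm of \<open>h\<close> may be as
  large as two, so that \<open>h / 2\<close> is the vector in the unit ball.
\<close>

lemma large_range_if_bounded_below:
  assumes T: "T \<in> ops" and K: "K \<subseteq> I" "infinite K" and "0 < c"
    and below: "\<And>f. f \<in> V \<Longrightarrow> (\<And>i. i \<notin> K \<Longrightarrow> f i = 0) \<Longrightarrow> c * N f \<le> N (T f)"
  shows "large_range K T (c / 8)"
  unfolding large_range_def
proof (intro allI impI)
  fix A assume A: "A \<subseteq> I" "|A| <o |K|"
  obtain k l where kl: "k \<in> K" "l \<in> K" "k \<noteq> l"
    "N (restr A (T (\<lambda>i. unit_vec k i - unit_vec l i))) < c / 2"
    using close_images[OF T K A(2), of "c / 2"] \<open>0 < c\<close> by auto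
  define h :: "'i \<Rightarrow> 'k" where "h = (\<lambda>i. unit_vec k i - unit_vec l i)"
  have u: "unit_vec k \<in> V" "N (unit_vec k) = 1" "unit_vec l \<in> V" "N (unit_vec l) = 1"
    using kl K(1) unit_in norm_unit by auto
  have h: "h \<in> V" "N h \<le> 2" "1 \<le> N h"
  proof -
    show "h \<in> V" unfolding h_def by (rule sub_in[OF u(1,3)])
    show "N h \<le> 2" unfolding h_def using triangle_sub[OF u(1,3)] u by simp
    have "norm (h k) = 1" using kl(3) by (simp add: h_def unit_vec_def)
    then show "1 \<le> N h" using coord_le[OF \<open>h \<in> V\<close>, of k] by simp
  qed
  have "c * N h \<le> N (T h)"
    by (rule below[OF h(1)]) (use kl in \<open>auto simp: h_def unit_vec_def\<close>)
  moreover have "c * 1 \<le> c * N h" using h(3) \<open>0 < c\<close> by (intro mult_left_mono) auto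
  moreover have "N (T h) \<le> N (restr A (T h)) + N (restr (- A) (T h))"
    by (rule norm_restr_split[OF op_in[OF T h(1)]])
  ultimately have large: "c / 2 < N (restr (- A) (T h))" using kl(4) unfolding h_def[symmetric] by linarith
  define f where "f = (\<lambda>i. of_real (1/2) * h i)"
  have f: "f \<in> V" "N f \<le> 1"
    unfolding f_def using scale_in[OF h(1)] norm_scale[OF h(1), of "of_real (1/2)"] h(2)
    by (blast, simp add: norm_divide)
  have "restr (- A) (T f) = (\<lambda>i. of_real (1/2) * restr (- A) (T h) i)"
    unfolding f_def op_scale[OF T h(1)] by (auto simp: restr_def)
  then have "N (restr (- A) (T f)) = 1/2 * N (restr (- A) (T h))"
    using norm_scale[OF restr_in[OF op_in[OF T h(1)]], of "of_real (1/2)"] by (simp add: norm_divide)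
  then have "c / 8 < N (restr (- A) (T f))" using large \<open>0 < c\<close> by linarith
  then show "\<exists>f\<in>V. N f \<le> 1 \<and> c / 8 < N (restr (- A) (T f))" using f by blast
qed

text \<open>
  Composing with an isomorphism from \<open>E K\<close> onto the copy replaces the copy by the coordinate
  subspace itself.
\<close>

lemma bounded_below_on_copy:
  assumes T: "T \<in> ops" and K: "K \<subseteq> I" "infinite K" and copy: "T \<notin> S_ops (E K) (E I)"
  obtains U c where "U \<in> ops" "0 < c"
    "\<And>f. f \<in> V \<Longrightarrow> (\<And>i. i \<notin> K \<Longrightarrow> f i = 0) \<Longrightarrow> c * N f \<le> N (T (U f))"
proof -
  obtain E0 c where E0: "lin_subspace (E I) E0" "isomorphic_spaces (subspace_of (E I) E0) (E K)"
    and c: "c > 0" "\<And>f. f \<in> E0 \<Longrightarrow> N (T f) \<ge> c * N f"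
    using copy T unfolding S_ops_def by blast
  obtain \<Psi> where \<Psi>: "bij_betw \<Psi> E0 (vecs (E K))" "bounded_linear_map (subspace_of (E I) E0) (E K) \<Psi>"
    "bounded_linear_map (E K) (subspace_of (E I) E0) (inv_into E0 \<Psi>)"
    using E0(2) unfolding isomorphic_spaces_def by (auto simp: subspace_of_def)
  have "K \<noteq> {}" using K(2) by auto
  note EK = vecs_sub[OF K(1) \<open>K \<noteq> {}\<close>] nrm_sub[OF K(1) \<open>K \<noteq> {}\<close>]
  define Q where "Q = inv_into E0 \<Psi>"
  have E0V: "E0 \<subseteq> V" using E0(1) by (simp add: lin_subspace_def)
  have rK: "restr K f \<in> vecs (E K)" "nrm (E K) (restr K f) \<le> N f" if "f \<in> V" for f
  proof -
    show *: "restr K f \<in> vecs (E K)" using restr_in[OF that] by (simp add: EK(1) restr_def)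
    show "nrm (E K) (restr K f) \<le> N f" using EK(2)[OF *] norm_restr_le[OF that] by simp
  qed
  have Q: "Q f \<in> E0" if "f \<in> vecs (E K)" for f
    using \<Psi>(3) that by (simp add: bounded_linear_map_def Q_def subspace_of_def)
  have Q_add: "Q (\<lambda>i. f i + g i) = (\<lambda>i. Q f i + Q g i)" if "f \<in> vecs (E K)" "g \<in> vecs (E K)" for f g
    using \<Psi>(3) that by (simp add: bounded_linear_map_def Q_def)
  have Q_scale: "Q (\<lambda>i. a * f i) = (\<lambda>i. a * Q f i)" if "f \<in> vecs (E K)" for f a
    using \<Psi>(3) that by (simp add: bounded_linear_map_def Q_def)
  have "\<exists>D. \<forall>f\<in>vecs (E K). N (Q f) \<le> D * nrm (E K) f"
    using \<Psi>(3) by (simp add: bounded_linear_map_def Q_def subspace_of_def)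
  then obtain D where D: "\<And>f. f \<in> vecs (E K) \<Longrightarrow> N (Q f) \<le> D * nrm (E K) f" by blast
  have "\<exists>D'. \<forall>g\<in>E0. nrm (E K) (\<Psi> g) \<le> D' * N g"
    using \<Psi>(2) by (simp add: bounded_linear_map_def subspace_of_def)
  then obtain D' where D': "\<And>g. g \<in> E0 \<Longrightarrow> nrm (E K) (\<Psi> g) \<le> D' * N g" by blast
  define U where "U = lin_op (\<lambda>f. Q (restr K f))"
  have "U \<in> ops" unfolding U_def
  proof (rule lin_op_in[where C = "\<bar>D\<bar>"])
    fix f assume f: "f \<in> V"
    have "N (Q (restr K f)) \<le> D * nrm (E K) (restr K f)" by (rule D[OF rK(1)[OF f]])
    also have "\<dots> \<le> \<bar>D\<bar> * N f"
      using rK[OF f] EK(2)[OF rK(1)[OF f]] norm_nonneg[OF restr_in[OF f]] by (intro mult_mono) auto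
    finally show "Q (restr K f) \<in> V \<and> N (Q (restr K f)) \<le> \<bar>D\<bar> * N f"
      using Q rK(1)[OF f] E0V by auto
    fix a
    have "restr K (\<lambda>i. a * f i) = (\<lambda>i. a * restr K f i)" by (auto simp: restr_def)
    then show "Q (restr K (\<lambda>i. a * f i)) = (\<lambda>j. a * Q (restr K f) j)"
      using Q_scale[OF rK(1)[OF f]] by simp
  qed (simp add: restr_add Q_add rK)
  moreover have "c / (\<bar>D'\<bar> + 1) * N f \<le> N (T (U f))" if f: "f \<in> V" "\<And>i. i \<notin> K \<Longrightarrow> f i = 0" for f
  proof -
    have fK: "f \<in> vecs (E K)" using f by (simp add: EK(1))
    have "restr K f = f" using f(2) by (auto simp: restr_def)
    then have Uf: "U f = Q f" using f(1) by (simp add: U_def lin_op_def)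
    have "\<Psi> (Q f) = f" unfolding Q_def using \<Psi>(1) fK by (simp add: bij_betw_inv_into_right)
    then have "N f \<le> D' * N (Q f)" using D'[OF Q[OF fK]] EK(2)[OF fK] by simp
    also have "\<dots> \<le> (\<bar>D'\<bar> + 1) * N (Q f)"
      using norm_nonneg Q[OF fK] E0V by (intro mult_right_mono) auto
    finally have "N f / (\<bar>D'\<bar> + 1) \<le> N (Q f)" by (simp add: field_simps)
    then have "c * (N f / (\<bar>D'\<bar> + 1)) \<le> c * N (Q f)" using c(1) by (intro mult_left_mono) auto
    also have "\<dots> \<le> N (T (U f))" using c(2)[OF Q[OF fK]] Uf by simp
    finally show ?thesis by simp
  qed
  moreover have "0 < c / (\<bar>D'\<bar> + 1)" using c(1) by simp
  ultimately show thesis using that by blast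
qed

text \<open>
  If \<open>W T U\<close> is within \<open>1/2\<close> of the identity on \<open>E K\<close>, then \<open>T U\<close> is bounded below there. Hence
  \<open>U\<close> is an isomorphism of \<open>E K\<close> onto its range, and \<open>T\<close> is bounded below on this range.
\<close>

lemma large_range_imp_not_S_ops:
  assumes diag: diagonalizable and T: "T \<in> ops" and K: "K \<subseteq> I" "infinite K"
    and large: "large_range K T \<epsilon>" and "0 < \<epsilon>"
  shows "T \<notin> S_ops (E K) (E I)"
proof -
  obtain U W where U: "U \<in> ops" and W: "W \<in> ops"
    and near: "\<And>f. f \<in> V \<Longrightarrow> N (\<lambda>i. W (T (U f)) i - restr K f i) \<le> 1/2 * N f"
    using approximate_factorization[OF diag T K large \<open>0 < \<epsilon>\<close>, of "1/2"] by auto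
  obtain CW where CW: "0 < CW" "\<And>f. f \<in> V \<Longrightarrow> N (W f) \<le> CW * N f" using op_bound[OF W] by blast
  obtain CT where CT: "0 < CT" "\<And>f. f \<in> V \<Longrightarrow> N (T f) \<le> CT * N f" using op_bound[OF T] by blast
  obtain CU where CU: "0 < CU" "\<And>f. f \<in> V \<Longrightarrow> N (U f) \<le> CU * N f" using op_bound[OF U] by blast
  have "K \<noteq> {}" using K(2) by auto
  note EK = vecs_sub[OF K(1) \<open>K \<noteq> {}\<close>] nrm_sub[OF K(1) \<open>K \<noteq> {}\<close>]
  have closedK: "closed_pointwise (vecs (E K))"
    by (auto simp: closed_pointwise_def EK(1) add_in scale_in)
  define c0 where "c0 = 1 / (2 * CW)"
  have "0 < c0" using CW(1) by (simp add: c0_def)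
  have below: "c0 * N f \<le> N (T (U f))" if f: "f \<in> vecs (E K)" for f
  proof -
    have fV: "f \<in> V" and "restr K f = f" using f by (auto simp: EK(1) restr_def)
    have WV: "W (T (U f)) \<in> V" by (rule op_value_in[OF W])
    have "N f \<le> N (W (T (U f))) + N (\<lambda>i. f i - W (T (U f)) i)" by (rule triangle_le[OF fV WV])
    also have "N (\<lambda>i. f i - W (T (U f)) i) = N (\<lambda>i. W (T (U f)) i - f i)"
      using norm_neg[OF sub_in[OF WV fV]] by simp
    also have "\<dots> \<le> 1/2 * N f" using near[OF fV] \<open>restr K f = f\<close> by simp
    finally have "1/2 * N f \<le> N (W (T (U f)))" by simp
    also have "\<dots> \<le> CW * N (T (U f))" by (rule CW(2)[OF op_value_in[OF T]])
    finally show ?thesis using CW(1) by (simp add: c0_def field_simps)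
  qed
  have UV: "U f \<in> V" for f by (rule op_value_in[OF U])
  have inverse_bound: "N f \<le> CT / c0 * N (U f)" if "f \<in> vecs (E K)" for f
  proof -
    have "c0 * N f \<le> CT * N (U f)" using below[OF that] CT(2)[OF UV] by (rule order_trans)
    then show ?thesis using \<open>0 < c0\<close> by (simp add: field_simps)
  qed
  define E0 where "E0 = U ` vecs (E K)"
  have U_lin: "U (\<lambda>i. f i + g i) = (\<lambda>i. U f i + U g i)" "U (\<lambda>i. a * f i) = (\<lambda>i. a * U f i)"
    if "f \<in> vecs (E K)" "g \<in> vecs (E K)" for f g a
    using that op_add[OF U] op_scale[OF U] by (simp_all add: EK(1))
  have K_closed: "(\<lambda>i. f i + g i) \<in> vecs (E K)" "(\<lambda>i. a * f i) \<in> vecs (E K)"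
    if "f \<in> vecs (E K)" "g \<in> vecs (E K)" for f g a
    using closedK that by (auto simp: closed_pointwise_def)
  have zeroK: "(\<lambda>i. 0) \<in> vecs (E K)" by (simp add: EK(1) zero_in)
  have lin: "lin_subspace (E I) E0" unfolding lin_subspace_def
  proof (intro conjI ballI allI)
    show "E0 \<subseteq> V" using UV by (auto simp: E0_def)
    show "(\<lambda>i. 0) \<in> E0" using op_zero[OF U] zeroK unfolding E0_def by (metis image_eqI)
  next
    fix f g assume "f \<in> E0" "g \<in> E0"
    then show "(\<lambda>i. f i + g i) \<in> E0" unfolding E0_def
      using U_lin(1) K_closed(1) by (auto simp flip: U_lin(1))
  next
    fix a f assume "f \<in> E0"
    then show "(\<lambda>i. a * f i) \<in> E0" unfolding E0_def
      using K_closed(2) by (auto simp flip: U_lin(2))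
  qed
  have inj: "inj_on U (vecs (E K))"
  proof (rule inj_onI)
    fix f g assume fg: "f \<in> vecs (E K)" "g \<in> vecs (E K)" "U f = U g"
    have fgV: "f \<in> V" "g \<in> V" using fg by (auto simp: EK(1))
    have d: "(\<lambda>i. f i - g i) \<in> vecs (E K)" using fg(1,2) sub_in by (simp add: EK(1))
    have "U (\<lambda>i. f i - g i) = (\<lambda>i. 0)" using op_sub[OF U fgV] fg(3) by simp
    then have "N (\<lambda>i. f i - g i) \<le> 0" using inverse_bound[OF d] by (simp add: nrm_zero)
    then have "(\<lambda>i. f i - g i) = (\<lambda>i. 0)"
      using norm_eq_0[OF sub_in[OF fgV]] norm_nonneg[OF sub_in[OF fgV]] by simp
    then show "f = g" by (auto simp: fun_eq_iff)
  qed
  have iso: "isomorphic_spaces (subspace_of (E I) E0) (E K)"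
  proof (rule isomorphic_spaces_if_inverse[where U = U, OF _ _ _ closedK])
    show "bij_betw U (vecs (E K)) (vecs (subspace_of (E I) E0))"
      using inj by (simp add: bij_betw_def subspace_of_def E0_def)
    have "N (U f) \<le> CU * nrm (E K) f" if "f \<in> vecs (E K)" for f
      using CU(2) EK that by simp
    then show "bounded_linear_map (E K) (subspace_of (E I) E0) U"
      unfolding bounded_linear_map_def by (auto simp: subspace_of_def E0_def U_lin)
    have inv: "inv_into (vecs (E K)) U (U f) = f" if "f \<in> vecs (E K)" for f
      using inj that by simp
    have "\<exists>C. \<forall>f\<in>vecs (E K). nrm (E K) f \<le> C * N (U f)"
      using inverse_bound EK(2) by (intro exI[of _ "CT / c0"]) auto
    then show "bounded_linear_map (subspace_of (E I) E0) (E K) (inv_into (vecs (E K)) U)"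
      unfolding bounded_linear_map_def
      by (auto simp: subspace_of_def E0_def inv K_closed simp flip: U_lin)
  qed
  have "c0 / CU * N g \<le> N (T g)" if g: "g \<in> E0" for g
  proof -
    obtain f where f: "f \<in> vecs (E K)" "g = U f" using g by (auto simp: E0_def)
    have "c0 / CU * N g \<le> c0 / CU * (CU * N f)"
      using CU f \<open>0 < c0\<close> by (intro mult_left_mono) (auto simp: EK(1))
    also have "\<dots> = c0 * N f" using CU(1) by simp
    also have "\<dots> \<le> N (T g)" using below[OF f(1)] f(2) by simp
    finally show ?thesis .
  qed
  moreover have "0 < c0 / CU" using \<open>0 < c0\<close> CU(1) by simp
  ultimately show ?thesis using lin iso unfolding S_ops_def by blast
qed

lemma in_closed_ideal_if_approximable:
  assumes closed: "norm_closed (E I) J" and J: "J \<subseteq> ops" and T: "T \<in> ops"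
    and approx: "\<And>\<delta>. 0 < \<delta> \<Longrightarrow> \<exists>S\<in>J. \<forall>f\<in>V. N (\<lambda>i. S f i - T f i) \<le> \<delta> * N f"
  shows "T \<in> J"
proof -
  have "\<forall>n. \<exists>S. S \<in> J \<and> (\<forall>f\<in>V. N (\<lambda>i. S f i - T f i) \<le> inverse (real (Suc n)) * N f)"
    using approx by (metis inverse_positive_iff_positive of_nat_0_less_iff zero_less_Suc)
  then obtain S where S: "\<And>n. S n \<in> J"
    "\<And>n f. f \<in> V \<Longrightarrow> N (\<lambda>i. S n f i - T f i) \<le> inverse (real (Suc n)) * N f" by metis
  have bounds: "0 \<le> op_norm (E I) (add_op (S n) (scale_op (-1) T)) \<and>
      op_norm (E I) (add_op (S n) (scale_op (-1) T)) \<le> inverse (real (Suc n))" for n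
  proof -
    let ?D = "\<lambda>f. N (add_op (S n) (scale_op (-1) T) f)" and ?B = "{f \<in> V. N f \<le> 1}"
    have le: "?D f \<le> inverse (real (Suc n))" if "f \<in> ?B" for f
    proof -
      have "?D f \<le> inverse (real (Suc n)) * N f"
        using S(2)[of f n] that by (simp add: add_op_def scale_op_def)
      also have "\<dots> \<le> inverse (real (Suc n)) * 1" using that by (intro mult_left_mono) auto
      finally show ?thesis by simp
    qed
    have zero: "(\<lambda>i. 0) \<in> ?B" by (simp add: zero_in nrm_zero)
    have "?D (\<lambda>i. 0) = 0"
      using op_zero[OF T] op_zero[of "S n"] S(1)[of n] J by (simp add: add_op_def scale_op_def nrm_zero subset_iff)
    moreover have "?D (\<lambda>i. 0) \<le> (SUP f\<in>?B. ?D f)"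
      by (rule cSUP_upper[OF zero]) (use le in \<open>auto intro!: bdd_aboveI2\<close>)
    moreover have "(SUP f\<in>?B. ?D f) \<le> inverse (real (Suc n))"
      by (rule cSUP_least) (use zero le in auto)
    ultimately show ?thesis unfolding op_norm_def by simp
  qed
  have "(\<lambda>n. op_norm (E I) (add_op (S n) (scale_op (-1) T))) \<longlonglongrightarrow> 0"
    by (rule tendsto_sandwich[OF _ _ tendsto_const LIMSEQ_inverse_real_of_nat]) (use bounds in auto)
  then show ?thesis using closed S(1) T unfolding norm_closed_def by blast
qed

text \<open>
  A non-zero ideal contains an operator \<open>T\<close> with a non-zero value \<open>T f j\<close>, and \<open>T\<close> composed with
  operators of rank one gives all one-dimensional coordinate projections.
\<close>

lemma proj_finite_in_ideal:
  assumes J: "op_ideal (E I) J" and "J \<noteq> {zero_op}" and A: "finite A" "A \<subseteq> I"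
  shows "proj A \<in> J"
proof -
  have JO: "J \<subseteq> ops" and zero: "zero_op \<in> J" and add: "\<And>S T. S \<in> J \<Longrightarrow> T \<in> J \<Longrightarrow> add_op S T \<in> J"
    and comp: "\<And>S T. T \<in> J \<Longrightarrow> S \<in> ops \<Longrightarrow> S \<circ> T \<in> J" "\<And>S T. T \<in> J \<Longrightarrow> S \<in> ops \<Longrightarrow> T \<circ> S \<in> J"
    using J by (auto simp: op_ideal_def)
  obtain T where T: "T \<in> J" "T \<noteq> zero_op" using zero assms(2) by blast
  then obtain f j where f: "T f j \<noteq> 0" unfolding zero_op_def by (metis ext)
  have TO: "T \<in> ops" using T JO by blast
  have fV: "f \<in> V" using f op_outside[OF TO] by metis
  have jI: "j \<in> I" using f zero_outside[OF op_value_in[OF TO]] by blast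
  have single: "proj {a} \<in> J" if a: "a \<in> I" for a
  proof -
    define U where "U = lin_op (\<lambda>z i. z a * f i)"
    define W where "W = lin_op (\<lambda>z i. z j * (unit_vec a i / T f j))"
    have rank_one: "lin_op (\<lambda>z i. z b * g i) \<in> ops" if g: "g \<in> V" for b g
    proof (rule lin_op_in[where C = "N g"])
      fix z assume z: "z \<in> V"
      have "norm (z b) * N g \<le> N g * N z"
        using mult_right_mono[OF coord_le[OF z] norm_nonneg[OF g]] by (simp add: mult.commute)
      then show "(\<lambda>i. z b * g i) \<in> V \<and> N (\<lambda>i. z b * g i) \<le> N g * N z"
        using scale_in[OF g] norm_scale[OF g] by simp
    qed (auto simp: algebra_simps)
    have ga: "(\<lambda>i. unit_vec a i / T f j) \<in> V"
      using scale_in[OF unit_in[OF a], of "1 / T f j"] by simp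
    have "U \<in> ops" "W \<in> ops" unfolding U_def W_def using rank_one[OF fV] rank_one[OF ga] by auto
    then have "W \<circ> (T \<circ> U) \<in> J" using comp T(1) by blast
    moreover have "W \<circ> (T \<circ> U) = proj {a}"
    proof
      fix z show "(W \<circ> (T \<circ> U)) z = proj {a} z"
      proof (cases "z \<in> V")
        case True
        have "T (U z) = (\<lambda>i. z a * T f i)"
          using op_scale[OF TO fV, of "z a"] True by (simp add: U_def lin_op_def)
        moreover have "T (U z) \<in> V" by (rule op_value_in[OF TO])
        ultimately have "W (T (U z)) = (\<lambda>i. z a * T f j * (unit_vec a i / T f j))"
          by (simp add: W_def lin_op_def)
        then show ?thesis using True f
          by (auto simp: proj_apply restr_def unit_vec_def)
      next
        case False
        then show ?thesis
          using op_zero[OF TO] op_zero[OF \<open>W \<in> ops\<close>] by (simp add: U_def proj_def lin_op_def)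
      qed
    qed
    ultimately show ?thesis by simp
  qed
  show ?thesis using A
  proof (induction A)
    case empty
    have "proj {} = zero_op" by (auto simp: proj_def lin_op_def zero_op_def restr_def)
    then show ?case using zero by simp
  next
    case (insert a A)
    have "proj (insert a A) = add_op (proj {a}) (proj A)"
      using insert.hyps by (auto simp: proj_def lin_op_def add_op_def restr_def fun_eq_iff)
    then show ?case using add single insert by auto
  qed
qed

text \<open>
  Let \<open>K\<close> be of least cardinality among the infinite sets whose coordinate projection is not in \<open>J\<close>.
  An operator in \<open>J\<close> that is bounded below on a copy of \<open>E K\<close> would put this projection into the
  closed ideal \<open>J\<close>, so that \<open>J \<subseteq> S_ops (E K) (E I)\<close>. Conversely, an operator \<open>T\<close> in
  \<open>S_ops (E K) (E I)\<close> does not have large range, hence is a limit of operators \<open>proj A \<circ> T\<close> with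
  \<open>|A| <o |K|\<close>, and these belong to \<open>J\<close> by the choice of \<open>K\<close>.
\<close>

theorem closed_ideals_are_S_ops:
  assumes diag: diagonalizable and J: "nonzero_proper_closed_ideal (E I) J"
  obtains K where "K \<subseteq> I" "infinite K" "J = S_ops (E K) (E I)"
proof -
  have ideal: "op_ideal (E I) J" and closed: "norm_closed (E I) J" and "J \<noteq> {zero_op}" and "J \<noteq> ops"
    using J by (auto simp: nonzero_proper_closed_ideal_def)
  have JO: "J \<subseteq> ops"
    and comp: "\<And>S T. T \<in> J \<Longrightarrow> S \<in> ops \<Longrightarrow> S \<circ> T \<in> J" "\<And>S T. T \<in> J \<Longrightarrow> S \<in> ops \<Longrightarrow> T \<circ> S \<in> J"
    using ideal by (auto simp: op_ideal_def)
  define \<K> where "\<K> = {K. K \<subseteq> I \<and> infinite K \<and> proj K \<notin> J}"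
  have "proj I \<notin> J"
  proof
    assume "proj I \<in> J"
    have "T \<in> J" if T: "T \<in> ops" for T
    proof -
      have "T \<circ> proj I = T"
      proof
        fix f show "(T \<circ> proj I) f = T f"
        proof (cases "f \<in> V")
          case True
          have "restr I f = f" using zero_outside[OF True] by (auto simp: restr_def)
          then show ?thesis using True by (simp add: proj_apply)
        qed (simp add: proj_def lin_op_def op_zero[OF T] op_outside[OF T])
      qed
      then show ?thesis using comp(1)[OF \<open>proj I \<in> J\<close> T] by simp
    qed
    then show False using JO \<open>J \<noteq> ops\<close> by blast
  qed
  then have "I \<in> \<K>" using infinite_I by (simp add: \<K>_def)
  moreover have "wf (inv_image (ordLess :: ('i rel \<times> 'i rel) set) card_of)"
    by (rule wf_inv_image[OF wf_ordLess])
  ultimately obtain K where K: "K \<in> \<K>" "\<And>A. |A| <o |K| \<Longrightarrow> A \<notin> \<K>"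
    using wfE_min[of "inv_image ordLess card_of" I \<K>] by (auto simp: in_inv_image)
  then have KI: "K \<subseteq> I" "infinite K" "proj K \<notin> J" by (auto simp: \<K>_def)
  have small: "proj A \<in> J" if "A \<subseteq> I" "|A| <o |K|" for A
    using K(2)[OF that(2)] that(1) proj_finite_in_ideal[OF ideal \<open>J \<noteq> {zero_op}\<close>]
    by (cases "finite A") (auto simp: \<K>_def)
  have not_large: "\<not> large_range K T \<epsilon>" if T: "T \<in> J" and "0 < \<epsilon>" for T \<epsilon>
  proof
    assume large: "large_range K T \<epsilon>"
    have "proj K \<in> J"
    proof (rule in_closed_ideal_if_approximable[OF closed JO proj_in])
      fix \<delta> :: real assume "0 < \<delta>"
      then obtain U W where U: "U \<in> ops" and W: "W \<in> ops"
        and near: "\<And>f. f \<in> V \<Longrightarrow> N (\<lambda>i. W (T (U f)) i - restr K f i) \<le> \<delta> * N f"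
        using approximate_factorization[OF diag _ KI(1,2) large \<open>0 < \<epsilon>\<close>] T JO by blast
      have "W \<circ> (T \<circ> U) \<in> J" using comp T U W by blast
      then show "\<exists>S\<in>J. \<forall>f\<in>V. N (\<lambda>i. S f i - proj K f i) \<le> \<delta> * N f"
        using near by (intro bexI[of _ "W \<circ> (T \<circ> U)"]) (auto simp: proj_apply)
    qed
    then show False using KI(3) by blast
  qed
  have "J = S_ops (E K) (E I)"
  proof
    show "J \<subseteq> S_ops (E K) (E I)"
    proof (rule subsetI, rule ccontr)
      fix T assume T: "T \<in> J" "T \<notin> S_ops (E K) (E I)"
      have TO: "T \<in> ops" using T JO by blast
      obtain U c where U: "U \<in> ops" and c: "0 < c"
        "\<And>f. f \<in> V \<Longrightarrow> (\<And>i. i \<notin> K \<Longrightarrow> f i = 0) \<Longrightarrow> c * N f \<le> N (T (U f))"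
        using bounded_below_on_copy[OF TO KI(1,2) T(2)] by blast
      have "large_range K (T \<circ> U) (c / 8)"
        by (rule large_range_if_bounded_below[OF op_comp[OF TO U] KI(1,2) c(1)]) (simp add: c(2))
      then show False using not_large comp(2)[OF T(1) U] c(1) by simp
    qed
    show "S_ops (E K) (E I) \<subseteq> J"
    proof
      fix T assume TS: "T \<in> S_ops (E K) (E I)"
      then have T: "T \<in> ops" by (simp add: S_ops_def)
      show "T \<in> J"
      proof (rule in_closed_ideal_if_approximable[OF closed JO T])
        fix \<delta> :: real assume "0 < \<delta>"
        then have "\<not> large_range K T \<delta>"
          using large_range_imp_not_S_ops[OF diag T KI(1,2)] TS by blast
        then obtain A where A: "A \<subseteq> I" "|A| <o |K|"
          "\<And>f. f \<in> V \<Longrightarrow> N f \<le> 1 \<Longrightarrow> N (restr (- A) (T f)) \<le> \<delta>"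
          unfolding large_range_def by (meson not_less)
        have "N (\<lambda>i. (proj A \<circ> T) f i - T f i) \<le> \<delta> * N f" if f: "f \<in> V" for f
        proof (cases "N f = 0")
          case True
          then have "f = (\<lambda>i. 0)" using norm_eq_0[OF f] by blast
          then show ?thesis using True op_zero[OF T] by (simp add: proj_apply zero_in restr_def nrm_zero)
        next
          case False
          then have pos: "0 < N f" using norm_nonneg[OF f] by simp
          define g where "g = (\<lambda>i. of_real (1 / N f) * f i)"
          have g: "g \<in> V" "N g \<le> 1"
            unfolding g_def using scale_in[OF f] norm_scale[OF f, of "of_real (1 / N f)"] pos
            by (blast, simp add: norm_divide)
          have Tf: "T f \<in> V" by (rule op_value_in[OF T])
          have "(\<lambda>i. (proj A \<circ> T) f i - T f i) = (\<lambda>i. - restr (- A) (T f) i)"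
            using Tf by (auto simp: proj_apply restr_def)
          then have "N (\<lambda>i. (proj A \<circ> T) f i - T f i) = N (restr (- A) (T f))"
            using norm_neg[OF restr_in[OF Tf]] by simp
          moreover have "restr (- A) (T g) = (\<lambda>i. of_real (1 / N f) * restr (- A) (T f) i)"
            unfolding g_def op_scale[OF T f] by (auto simp: restr_def)
          then have "N (restr (- A) (T g)) = N (restr (- A) (T f)) / N f"
            using norm_scale[OF restr_in[OF Tf], of "of_real (1 / N f)"] pos by (simp add: norm_divide)
          ultimately show ?thesis using A(3)[OF g] pos by (simp add: pos_divide_le_eq)
        qed
        moreover have "proj A \<circ> T \<in> J" using comp(2)[OF small[OF A(1,2)] T] .
        ultimately show "\<exists>S\<in>J. \<forall>f\<in>V. N (\<lambda>i. S f i - T f i) \<le> \<delta> * N f" by blast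
      qed
    qed
  qed
  then show thesis using that KI by blast
qed

end

section \<open>The spaces \<open>c\<^sub>0(I)\<close>\<close>

lemma c0_vecs: "f \<in> vecs (c0_space I) \<longleftrightarrow>
    (\<forall>i. i \<notin> I \<longrightarrow> f i = 0) \<and> (\<forall>\<epsilon>>0. finite {i\<in>I. \<epsilon> \<le> norm (f i)})"
  by (simp add: c0_space_def)

lemma c0_nrm: "nrm (c0_space I) f = (SUP i\<in>I. norm (f i))"
  by (simp add: c0_space_def)

lemma c0_coord:
  assumes "finite {i\<in>I. 1 \<le> norm (f i)}" "i \<in> I"
  shows "norm (f i) \<le> nrm (c0_space I) f"
  unfolding c0_nrm
proof (rule cSUP_upper[OF assms(2)], rule bdd_aboveI2)
  fix j assume "j \<in> I"
  then show "norm (f j) \<le> 1 + (\<Sum>i\<in>{i\<in>I. 1 \<le> norm (f i)}. norm (f i))"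
    using member_le_sum[of j "{i\<in>I. 1 \<le> norm (f i)}" "\<lambda>i. norm (f i)"] assms(1)
      sum_nonneg[of "{i\<in>I. 1 \<le> norm (f i)}" "\<lambda>i. norm (f i)"]
    by (cases "1 \<le> norm (f j)") auto
qed

lemma c0_nrm_le: "I \<noteq> {} \<Longrightarrow> (\<And>i. i \<in> I \<Longrightarrow> norm (f i) \<le> b) \<Longrightarrow> nrm (c0_space I) f \<le> b"
  unfolding c0_nrm by (rule cSUP_least)

lemma c0_coord_le: "f \<in> vecs (c0_space I) \<Longrightarrow> i \<in> I \<Longrightarrow> norm (f i) \<le> nrm (c0_space I) f"
  by (rule c0_coord) (auto simp: c0_vecs)

lemma c0_finite_support:
  assumes "finite D" "D \<subseteq> I" "\<And>i. i \<notin> D \<Longrightarrow> f i = 0"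
  shows "f \<in> vecs (c0_space I)"
  unfolding c0_vecs
proof (intro conjI allI impI)
  fix \<epsilon> :: real assume "\<epsilon> > 0"
  have "{i \<in> I. \<epsilon> \<le> norm (f i)} \<subseteq> D"
  proof
    fix i assume "i \<in> {i \<in> I. \<epsilon> \<le> norm (f i)}"
    then have "f i \<noteq> 0" using \<open>\<epsilon> > 0\<close> by auto
    then show "i \<in> D" using assms(3) by blast
  qed
  then show "finite {i \<in> I. \<epsilon> \<le> norm (f i)}" using assms(1) finite_subset by blast
qed (use assms in auto)

lemma c0_restr_finite:
  assumes "finite D" "D \<subseteq> I"
  shows "restr D f \<in> vecs (c0_space I)"
  by (rule c0_finite_support[OF assms]) (simp add: restr_def)

lemma c0_finite_restr_attained:
  assumes "finite D" "D \<subseteq> I" "D \<noteq> {}"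
  obtains j where "j \<in> D" "nrm (c0_space I) (restr D y) = norm (y j)"
proof -
  obtain j where j: "j \<in> D" "\<And>i. i \<in> D \<Longrightarrow> norm (y i) \<le> norm (y j)"
  proof -
    have "Max ((\<lambda>i. norm (y i)) ` D) \<in> (\<lambda>i. norm (y i)) ` D" using assms by (intro Max_in) auto
    then obtain j where "j \<in> D" "norm (y j) = Max ((\<lambda>i. norm (y i)) ` D)" by force
    then show thesis using that[of j] assms by simp
  qed
  have "nrm (c0_space I) (restr D y) \<le> norm (y j)"
    by (rule c0_nrm_le) (use assms j in \<open>auto simp: restr_def\<close>)
  moreover have "norm (y j) \<le> nrm (c0_space I) (restr D y)"
    using c0_coord_le[OF c0_restr_finite[OF assms(1,2)], of j y] j(1) assms(2) by (auto simp: restr_def)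
  ultimately show thesis using that[OF j(1)] by simp
qed

lemma c0_scale_in: "f \<in> vecs (c0_space I) \<Longrightarrow> (\<lambda>i. a * f i) \<in> vecs (c0_space I)"
proof -
  assume f: "f \<in> vecs (c0_space I)"
  have "finite {i\<in>I. \<epsilon> \<le> norm (a * f i)}" if "\<epsilon> > 0" for \<epsilon>
  proof (cases "a = 0")
    case False
    then have "{i\<in>I. \<epsilon> \<le> norm (a * f i)} = {i\<in>I. \<epsilon> / norm a \<le> norm (f i)}"
      by (auto simp: norm_mult field_simps)
    then show ?thesis using f that False by (simp add: c0_vecs)
  qed (use that in simp)
  then show ?thesis using f by (simp add: c0_vecs)
qed

lemma c0_norm_scale:
  assumes "I \<noteq> {}" "f \<in> vecs (c0_space I)"
  shows "nrm (c0_space I) (\<lambda>i. a * f i) = norm a * nrm (c0_space I) f"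
proof -
  have le: "nrm (c0_space I) (\<lambda>i. b * g i) \<le> norm b * nrm (c0_space I) g"
    if "g \<in> vecs (c0_space I)" for b and g :: "'a \<Rightarrow> 'b"
    by (rule c0_nrm_le[OF assms(1)]) (simp add: norm_mult mult_left_mono c0_coord_le[OF that])
  show ?thesis
  proof (cases "a = 0")
    case True
    then show ?thesis using assms(1) by (simp add: c0_nrm)
  next
    case False
    have "nrm (c0_space I) f \<le> norm (1 / a) * nrm (c0_space I) (\<lambda>i. a * f i)"
      using le[OF c0_scale_in[OF assms(2), of a], of "1 / a"] False by simp
    then show ?thesis using le[OF assms(2), of a] False by (simp add: norm_divide field_simps)
  qed
qed

text \<open>
  Domination holds because each coordinate of \<open>w\<close> is at most the largest entry of \<open>z\<close> on the
  corresponding block; as the blocks of \<open>z\<close> are disjoint and those of \<open>w\<close> are finite, \<open>w\<close> has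
  only finitely many large coordinates.
\<close>

lemma disjoint_norm_c0:
  assumes I: "infinite I"
  shows "disjoint_norm (c0_space :: 'i set \<Rightarrow> ('i, 'k::{real_normed_field, heine_borel}) nspace) I"
proof
  let ?E = "c0_space :: 'i set \<Rightarrow> ('i, 'k) nspace"
  have ne: "I \<noteq> {}" using I by auto
  show "infinite I" by fact
  show "f i = 0" if "f \<in> vecs (?E I)" "i \<notin> I" for f i using that by (simp add: c0_vecs)
  show "(\<lambda>i. 0) \<in> vecs (?E I)" by (rule c0_finite_support[of "{}"]) auto
  show "(\<lambda>i. f i + g i) \<in> vecs (?E I)" if fg: "f \<in> vecs (?E I)" "g \<in> vecs (?E I)" for f g
    unfolding c0_vecs
  proof (intro conjI allI impI)
    fix \<epsilon> :: real assume "\<epsilon> > 0"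
    have "{i\<in>I. \<epsilon> \<le> norm (f i + g i)} \<subseteq> {i\<in>I. \<epsilon>/2 \<le> norm (f i)} \<union> {i\<in>I. \<epsilon>/2 \<le> norm (g i)}"
    proof
      fix i assume i: "i \<in> {i\<in>I. \<epsilon> \<le> norm (f i + g i)}"
      then have "\<epsilon> \<le> norm (f i) + norm (g i)" using norm_triangle_ineq[of "f i" "g i"] by auto
      then show "i \<in> {i\<in>I. \<epsilon>/2 \<le> norm (f i)} \<union> {i\<in>I. \<epsilon>/2 \<le> norm (g i)}" using i by auto
    qed
    moreover have "finite ({i\<in>I. \<epsilon>/2 \<le> norm (f i)} \<union> {i\<in>I. \<epsilon>/2 \<le> norm (g i)})"
      using fg half_gt_zero[OF \<open>\<epsilon> > 0\<close>] unfolding c0_vecs by blast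
    ultimately show "finite {i\<in>I. \<epsilon> \<le> norm (f i + g i)}" using finite_subset by blast
  qed (use fg in \<open>simp add: c0_vecs\<close>)
  show "nrm (?E I) (\<lambda>i. f i + g i) \<le> nrm (?E I) f + nrm (?E I) g"
    if fg: "f \<in> vecs (?E I)" "g \<in> vecs (?E I)" for f g
  proof (rule c0_nrm_le[OF ne])
    fix i assume "i \<in> I"
    then show "norm (f i + g i) \<le> nrm (?E I) f + nrm (?E I) g"
      using norm_triangle_ineq[of "f i" "g i"] c0_coord_le[OF fg(1), of i] c0_coord_le[OF fg(2), of i]
      by linarith
  qed
  show "(\<lambda>i. a * f i) \<in> vecs (?E I)" if "f \<in> vecs (?E I)" for a f by (rule c0_scale_in[OF that])
  show "nrm (?E I) (\<lambda>i. a * f i) = norm a * nrm (?E I) f" if "f \<in> vecs (?E I)" for a f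
    by (rule c0_norm_scale[OF ne that])
  show unit: "unit_vec k \<in> vecs (?E I)" if "k \<in> I" for k
    by (rule c0_finite_support[of "{k}"]) (use that in \<open>auto simp: unit_vec_def\<close>)
  show "nrm (?E I) (unit_vec k) = 1" if "k \<in> I" for k
  proof (rule antisym)
    show "nrm (?E I) (unit_vec k) \<le> 1" by (rule c0_nrm_le[OF ne]) (simp add: unit_vec_def)
    show "1 \<le> nrm (?E I) (unit_vec k)"
      using c0_coord_le[OF unit[OF that] that] by (simp add: unit_vec_def)
  qed
  show "\<exists>R\<subseteq>I. finite R \<and> nrm (?E I) (restr (- R) f) < \<epsilon>" if f: "f \<in> vecs (?E I)" and "0 < \<epsilon>" for f \<epsilon>
  proof (intro exI conjI)
    let ?R = "{i\<in>I. \<epsilon>/2 \<le> norm (f i)}"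
    show "finite ?R" using f half_gt_zero[OF \<open>0 < \<epsilon>\<close>] unfolding c0_vecs by blast
    have "nrm (?E I) (restr (- ?R) f) \<le> \<epsilon>/2"
      by (rule c0_nrm_le[OF ne]) (use \<open>0 < \<epsilon>\<close> in \<open>auto simp: restr_def\<close>)
    then show "nrm (?E I) (restr (- ?R) f) < \<epsilon>" using \<open>0 < \<epsilon>\<close> by simp
  qed auto
  show "w \<in> vecs (?E I) \<and> nrm (?E I) w \<le> nrm (?E I) z"
    if z: "z \<in> vecs (?E I)" and disj: "disjoint_family_on B K" "disjoint_family_on C K"
      and B: "\<And>k. k \<in> K \<Longrightarrow> finite (B k) \<and> B k \<subseteq> I" and C: "\<And>k. k \<in> K \<Longrightarrow> finite (C k) \<and> C k \<subseteq> I"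
      and w: "\<And>i. i \<notin> (\<Union>k\<in>K. C k) \<Longrightarrow> w i = 0"
      and le: "\<And>k. k \<in> K \<Longrightarrow> nrm (?E I) (restr (C k) w) \<le> nrm (?E I) (restr (B k) z)"
    for z w :: "'i \<Rightarrow> 'k" and B C :: "'a \<Rightarrow> 'i set" and K
  proof -
    have dominated: "\<exists>j\<in>B k. norm (w i) \<le> norm (z j)" if k: "k \<in> K" "i \<in> C k" "w i \<noteq> 0" for k i
    proof -
      have "norm (w i) \<le> nrm (?E I) (restr (C k) w)"
        using c0_coord_le[OF c0_restr_finite[of "C k" I w], of i] C[OF k(1)] k(2) by (auto simp: restr_def)
      also have "\<dots> \<le> nrm (?E I) (restr (B k) z)" by (rule le[OF k(1)])
      finally have *: "norm (w i) \<le> nrm (?E I) (restr (B k) z)" .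
      have "B k \<noteq> {}"
      proof
        assume "B k = {}"
        then have "nrm (?E I) (restr (B k) z) = 0" using ne by (simp add: restr_def c0_nrm)
        then show False using * k(3) by simp
      qed
      then obtain j where "j \<in> B k" "nrm (?E I) (restr (B k) z) = norm (z j)"
        using c0_finite_restr_attained[of "B k" I z] B[OF k(1)] by blast
      then show ?thesis using * by auto
    qed
    have "finite {i\<in>I. \<epsilon> \<le> norm (w i)}" if "\<epsilon> > 0" for \<epsilon>
    proof -
      define Z where "Z = {j\<in>I. \<epsilon> \<le> norm (z j)}"
      have "finite Z" using z \<open>\<epsilon> > 0\<close> by (simp add: Z_def c0_vecs)
      have one: "finite {k\<in>K. j \<in> B k}" for j
      proof (cases "\<exists>k\<in>K. j \<in> B k")
        case True
        then obtain k where "k \<in> K" "j \<in> B k" by blast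
        then have "{k\<in>K. j \<in> B k} \<subseteq> {k}" using disj(1) by (auto simp: disjoint_family_on_def)
        then show ?thesis using finite_subset by blast
      next
        case False
        then have "{k\<in>K. j \<in> B k} = {}" by blast
        then show ?thesis by (metis finite.emptyI)
      qed
      have "{i\<in>I. \<epsilon> \<le> norm (w i)} \<subseteq> (\<Union>j\<in>Z. \<Union>k\<in>{k\<in>K. j \<in> B k}. C k)"
      proof
        fix i assume i: "i \<in> {i\<in>I. \<epsilon> \<le> norm (w i)}"
        then have "w i \<noteq> 0" using \<open>\<epsilon> > 0\<close> by auto
        then obtain k where k: "k \<in> K" "i \<in> C k" using w by blast
        then obtain j where "j \<in> B k" "norm (w i) \<le> norm (z j)" using dominated \<open>w i \<noteq> 0\<close> by blast
        moreover from this have "j \<in> Z" using i B[OF k(1)] by (auto simp: Z_def)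
        ultimately show "i \<in> (\<Union>j\<in>Z. \<Union>k\<in>{k\<in>K. j \<in> B k}. C k)" using k by blast
      qed
      moreover have "finite (\<Union>j\<in>Z. \<Union>k\<in>{k\<in>K. j \<in> B k}. C k)"
        using \<open>finite Z\<close> one C by blast
      ultimately show ?thesis using finite_subset by blast
    qed
    moreover have "w i = 0" if "i \<notin> I" for i using w C that by blast
    ultimately have "w \<in> vecs (?E I)" by (simp add: c0_vecs)
    moreover have "nrm (?E I) w \<le> nrm (?E I) z"
    proof (rule c0_nrm_le[OF ne])
      fix i assume "i \<in> I"
      have "0 \<le> nrm (?E I) z" using c0_coord_le[OF z \<open>i \<in> I\<close>] norm_ge_zero order_trans by blast
      show "norm (w i) \<le> nrm (?E I) z"
      proof (cases "w i = 0")
        case False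
        then obtain k where k: "k \<in> K" "i \<in> C k" using w by blast
        then obtain j where "j \<in> B k" "norm (w i) \<le> norm (z j)" using dominated False by blast
        then show ?thesis using c0_coord_le[OF z, of j] B[OF k(1)] by fastforce
      qed (use \<open>0 \<le> nrm (?E I) z\<close> in simp)
    qed
    ultimately show ?thesis by blast
  qed
  show "\<exists>c. (\<Sum>j\<in>D. c j * y j) = of_real (nrm (?E I) (restr D y)) \<and>
      (\<forall>z\<in>vecs (?E I). norm (\<Sum>j\<in>D. c j * z j) \<le> nrm (?E I) (restr D z))"
    if D: "finite D" "D \<subseteq> I" for D y
  proof (cases "D = {}")
    case True
    then show ?thesis using ne by (simp add: restr_def c0_nrm)
  next
    case False
    then obtain m where m: "m \<in> D" "nrm (?E I) (restr D y) = norm (y m)"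
      using c0_finite_restr_attained[OF D] by blast
    define c where "c j = (if j = m then of_real (norm (y m)) / y m else 0)" for j
    have sum: "(\<Sum>j\<in>D. c j * z j) = of_real (norm (y m)) / y m * z m" for z
    proof -
      have "(\<Sum>j\<in>D. c j * z j) = (\<Sum>j\<in>D. if j = m then of_real (norm (y m)) / y m * z m else 0)"
        by (rule sum.cong) (auto simp: c_def)
      then show ?thesis using D m by simp
    qed
    have "norm (\<Sum>j\<in>D. c j * z j) \<le> nrm (?E I) (restr D z)" for z
    proof -
      have "norm (\<Sum>j\<in>D. c j * z j) \<le> norm (z m)" by (simp add: sum norm_mult norm_divide)
      also have "\<dots> \<le> nrm (?E I) (restr D z)"
        using c0_coord_le[OF c0_restr_finite[OF D], of m z] m(1) D(2) by (auto simp: restr_def)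
      finally show ?thesis .
    qed
    moreover have "(\<Sum>j\<in>D. c j * y j) = of_real (nrm (?E I) (restr D y))" using m(2) by (simp add: sum)
    ultimately show ?thesis by blast
  qed
  show vecs_K: "vecs (?E K) = {f \<in> vecs (?E I). \<forall>i. i \<notin> K \<longrightarrow> f i = 0}" if K: "K \<subseteq> I" "K \<noteq> {}" for K
  proof -
    have "{i\<in>I. \<epsilon> \<le> norm (f i)} = {i\<in>K. \<epsilon> \<le> norm (f i)}"
      if "\<forall>i. i \<notin> K \<longrightarrow> f i = 0" "\<epsilon> > 0" for f :: "'i \<Rightarrow> 'k" and \<epsilon>
      using that K(1) by force
    then show ?thesis using K(1) unfolding c0_vecs set_eq_iff by auto
  qed
  show "nrm (?E K) f = nrm (?E I) f" if K: "K \<subseteq> I" "K \<noteq> {}" "f \<in> vecs (?E K)" for K f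
  proof (rule antisym)
    have f: "f \<in> vecs (?E I)" "\<And>i. i \<notin> K \<Longrightarrow> f i = 0" using vecs_K[OF K(1,2)] K(3) by auto
    show "nrm (?E K) f \<le> nrm (?E I) f"
      by (rule c0_nrm_le[OF K(2)]) (use c0_coord_le[OF f(1)] K(1) in auto)
    obtain k where "k \<in> K" using K(2) by blast
    then have "0 \<le> nrm (?E K) f" using c0_coord_le[OF K(3)] norm_ge_zero order_trans by blast
    then show "nrm (?E I) f \<le> nrm (?E K) f"
      by (intro c0_nrm_le[OF ne]) (metis c0_coord_le[OF K(3)] f(2) norm_zero)
  qed
qed

lemma c0_diagonalizable:
  assumes I: "infinite I"
  shows "disjoint_norm.diagonalizable (c0_space :: 'i set \<Rightarrow> ('i, 'k::{real_normed_field, heine_borel}) nspace) I"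
proof -
  interpret disjoint_norm "c0_space :: 'i set \<Rightarrow> ('i, 'k) nspace" I by (rule disjoint_norm_c0[OF I])
  have ne: "I \<noteq> {}" using I by auto
  have sublinear_indicators unfolding sublinear_indicators_def
  proof (intro allI impI)
    fix \<eta> :: real assume "\<eta> > 0"
    then obtain n where n: "0 < n" "inverse (real n) < \<eta>" using ex_inverse_of_nat_less by blast
    have "N (\<lambda>i. if i \<in> F then 1 else 0) \<le> \<eta> * real n" for F
    proof -
      have "N (\<lambda>i. if i \<in> F then 1 else 0) \<le> 1" by (rule c0_nrm_le[OF ne]) auto
      also have "1 \<le> \<eta> * real n" using n by (simp add: field_simps)
      finally show ?thesis .
    qed
    then show "\<exists>n>0. \<forall>F\<subseteq>I. finite F \<longrightarrow> card F = n \<longrightarrow> N (\<lambda>i. if i \<in> F then 1 else 0) \<le> \<eta> * real n"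
      using n(1) by blast
  qed
  then show ?thesis by (rule diagonalizable_if_sublinear_indicators)
qed

section \<open>The spaces \<open>\<ell>\<^sub>p(I)\<close>\<close>

lemma powr_convex_nonneg:
  fixes x y t p :: real
  assumes "1 \<le> p" "0 \<le> x" "0 \<le> y" "0 \<le> t" "t \<le> 1"
  shows "(t * x + (1 - t) * y) powr p \<le> t * x powr p + (1 - t) * y powr p"
proof -
  have small: "(s * u) powr p \<le> s * u powr p" if "0 \<le> s" "s \<le> 1" "0 \<le> u" for s u :: real
  proof -
    have "s powr p \<le> s"
      using that assms(1) powr_mono'[of 1 p s] by (cases "s = 0") auto
    then show ?thesis using that by (simp add: powr_mult mult_right_mono)
  qed
  consider "x = 0" | "y = 0" | "0 < x" "0 < y" using assms by linarith
  then show ?thesis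
  proof cases
    case 1
    then show ?thesis using small[of "1 - t" y] assms by simp
  next
    case 2
    then show ?thesis using small[of t x] assms by simp
  next
    case 3
    then show ?thesis
      using convex_onD[OF powr_convex[OF assms(1)], of t y x] assms by (simp add: algebra_simps)
  qed
qed

lemma lp_vecs: "f \<in> vecs (lp_space p I) \<longleftrightarrow>
    (\<forall>i. i \<notin> I \<longrightarrow> f i = 0) \<and> (\<lambda>i. norm (f i) powr p) summable_on I"
  by (simp add: lp_space_def)

lemma lp_nrm: "nrm (lp_space p I) f = (\<Sum>\<^sub>\<infinity>i\<in>I. norm (f i) powr p) powr (1 / p)"
  by (simp add: lp_space_def)

lemma lp_nrm_nonneg: "0 \<le> nrm (lp_space p I) f"
  by (simp add: lp_nrm)

lemma lp_nrm_powr: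
  assumes "1 \<le> p"
  shows "nrm (lp_space p I) f powr p = (\<Sum>\<^sub>\<infinity>i\<in>I. norm (f i) powr p)"
  using assms by (simp add: lp_nrm powr_powr infsum_nonneg)

lemma lp_sum_le:
  assumes "1 \<le> p" "f \<in> vecs (lp_space p I)" "finite F" "F \<subseteq> I"
  shows "(\<Sum>i\<in>F. norm (f i) powr p) \<le> nrm (lp_space p I) f powr p"
  unfolding lp_nrm_powr[OF assms(1)]
  using assms finite_sum_le_infsum[of "\<lambda>i. norm (f i) powr p" I F] by (simp add: lp_vecs)

text \<open>
  Together with \<open>lp_sum_le\<close> this reduces statements about the norm to inequalities for finite sums.
\<close>

lemma lp_if_sums_le:
  assumes "1 \<le> p" "\<And>i. i \<notin> I \<Longrightarrow> f i = 0" "0 \<le> b"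
    "\<And>F. finite F \<Longrightarrow> F \<subseteq> I \<Longrightarrow> (\<Sum>i\<in>F. norm (f i) powr p) \<le> b powr p"
  shows "f \<in> vecs (lp_space p I)" "nrm (lp_space p I) f \<le> b"
proof -
  have summable: "(\<lambda>i. norm (f i) powr p) summable_on I"
    by (rule nonneg_bdd_above_summable_on) (auto intro!: bdd_aboveI2 assms(4))
  then show "f \<in> vecs (lp_space p I)" using assms(2) by (simp add: lp_vecs)
  have "(\<Sum>\<^sub>\<infinity>i\<in>I. norm (f i) powr p) \<le> b powr p"
    by (rule infsum_le_finite_sums[OF summable assms(4)])
  then have "(\<Sum>\<^sub>\<infinity>i\<in>I. norm (f i) powr p) powr (1 / p) \<le> (b powr p) powr (1 / p)"
    using assms(1) by (intro powr_mono2) (auto simp: infsum_nonneg)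
  also have "\<dots> = b" using assms(1,3) by (simp add: powr_powr)
  finally show "nrm (lp_space p I) f \<le> b" by (simp add: lp_nrm)
qed

lemma lp_coord_le:
  assumes "1 \<le> p" "f \<in> vecs (lp_space p I)" "i \<in> I"
  shows "norm (f i) \<le> nrm (lp_space p I) f"
proof -
  have "norm (f i) powr p \<le> nrm (lp_space p I) f powr p"
    using lp_sum_le[OF assms(1,2), of "{i}"] assms(3) by simp
  then show ?thesis
    using powr_less_mono2[OF _ lp_nrm_nonneg, of p p I f "norm (f i)"] assms(1) by force
qed

lemma lp_finite_support:
  assumes "1 \<le> p" "finite D" "D \<subseteq> I" "\<And>i. i \<notin> D \<Longrightarrow> f i = 0"
  shows "f \<in> vecs (lp_space p I)" "nrm (lp_space p I) f powr p = (\<Sum>i\<in>D. norm (f i) powr p)"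
proof -
  have "(\<lambda>i. norm (f i) powr p) summable_on I \<longleftrightarrow> (\<lambda>i. norm (f i) powr p) summable_on D"
    by (rule summable_on_cong_neutral) (use assms in auto)
  then show "f \<in> vecs (lp_space p I)" using assms by (auto simp: lp_vecs)
  have "(\<Sum>\<^sub>\<infinity>i\<in>I. norm (f i) powr p) = (\<Sum>\<^sub>\<infinity>i\<in>D. norm (f i) powr p)"
    by (rule infsum_cong_neutral) (use assms in auto)
  then show "nrm (lp_space p I) f powr p = (\<Sum>i\<in>D. norm (f i) powr p)"
    using assms(1,2) by (simp add: lp_nrm_powr)
qed

lemma lp_restr_finite:
  assumes "1 \<le> p" "finite D" "D \<subseteq> I"
  shows "restr D f \<in> vecs (lp_space p I)"
    "nrm (lp_space p I) (restr D f) powr p = (\<Sum>i\<in>D. norm (f i) powr p)"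
  using lp_finite_support[OF assms, of "restr D f"] by (auto simp: restr_def)

text \<open>
  Minkowski's inequality, from the convexity of \<open>x powr p\<close> applied to \<open>norm (f i) / a\<close> and
  \<open>norm (g i) / b\<close>, where \<open>a\<close> and \<open>b\<close> are the norms of the two vectors.
\<close>

lemma lp_add:
  assumes p: "1 \<le> p" and f: "f \<in> vecs (lp_space p I)" and g: "g \<in> vecs (lp_space p I)"
  shows "(\<lambda>i. f i + g i) \<in> vecs (lp_space p I)"
    "nrm (lp_space p I) (\<lambda>i. f i + g i) \<le> nrm (lp_space p I) f + nrm (lp_space p I) g"
proof -
  let ?N = "nrm (lp_space p I)"
  define a where "a = ?N f"
  define b where "b = ?N g"
  have ab: "0 \<le> a" "0 \<le> b" by (simp_all add: a_def b_def lp_nrm_nonneg)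
  have out: "f i = 0" "g i = 0" if "i \<notin> I" for i using f g that by (auto simp: lp_vecs)
  have sums: "(\<Sum>i\<in>F. norm (f i + g i) powr p) \<le> (a + b) powr p" if F: "finite F" "F \<subseteq> I" for F
  proof -
    consider "a = 0" | "b = 0" | "0 < a" "0 < b" using ab by linarith
    then show ?thesis
    proof cases
      case 1
      then have "f i = 0" for i using lp_coord_le[OF p f, of i] out[of i] by (cases "i \<in> I") (auto simp: a_def)
      then show ?thesis using 1 lp_sum_le[OF p g F] by (simp add: b_def)
    next
      case 2
      then have "g i = 0" for i using lp_coord_le[OF p g, of i] out[of i] by (cases "i \<in> I") (auto simp: b_def)
      then show ?thesis using 2 lp_sum_le[OF p f F] by (simp add: a_def)
    next
      case 3
      define t where "t = a / (a + b)"
      have t: "0 \<le> t" "t \<le> 1" "1 - t = b / (a + b)" using 3 by (auto simp: t_def field_simps)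
      have "norm (f i + g i) powr p \<le>
          (a + b) powr p * (t * (norm (f i) powr p / a powr p) + (1 - t) * (norm (g i) powr p / b powr p))" for i
      proof -
        have "norm (f i + g i) powr p \<le> (norm (f i) + norm (g i)) powr p"
          using p by (intro powr_mono2) (auto simp: norm_triangle_ineq)
        also have "norm (f i) + norm (g i) = (a + b) * (t * (norm (f i) / a) + (1 - t) * (norm (g i) / b))"
        proof -
          have "(a + b) * t = a" "(a + b) * (1 - t) = b" using 3 unfolding t(3) by (simp_all add: t_def)
          moreover have "(a + b) * (t * (norm (f i) / a) + (1 - t) * (norm (g i) / b)) =
              ((a + b) * t) * (norm (f i) / a) + ((a + b) * (1 - t)) * (norm (g i) / b)"
            by (simp only: distrib_left mult.assoc)
          ultimately show ?thesis using 3 by simp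
        qed
        also have "\<dots> powr p = (a + b) powr p * (t * (norm (f i) / a) + (1 - t) * (norm (g i) / b)) powr p"
          by (rule powr_mult)
        also have "\<dots> \<le> (a + b) powr p * (t * (norm (f i) / a) powr p + (1 - t) * (norm (g i) / b) powr p)"
          using 3 t by (intro mult_left_mono powr_convex_nonneg p) auto
        finally show ?thesis using 3 by (simp add: powr_divide)
      qed
      then have "(\<Sum>i\<in>F. norm (f i + g i) powr p) \<le> (\<Sum>i\<in>F. (a + b) powr p *
          (t * (norm (f i) powr p / a powr p) + (1 - t) * (norm (g i) powr p / b powr p)))"
        by (rule sum_mono)
      also have "\<dots> = (a + b) powr p * (t * ((\<Sum>i\<in>F. norm (f i) powr p) / a powr p) +
          (1 - t) * ((\<Sum>i\<in>F. norm (g i) powr p) / b powr p))"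
        by (simp only: sum_distrib_left[symmetric] sum.distrib sum_divide_distrib[symmetric])
      also have "\<dots> \<le> (a + b) powr p * (t * 1 + (1 - t) * 1)"
        using lp_sum_le[OF p f F] lp_sum_le[OF p g F] 3 t(1,2)
        by (intro mult_left_mono add_mono) (auto simp: a_def b_def)
      finally show ?thesis by simp
    qed
  qed
  show "(\<lambda>i. f i + g i) \<in> vecs (lp_space p I)"
    by (rule lp_if_sums_le(1)[OF p _ _ sums]) (use out ab in auto)
  show "?N (\<lambda>i. f i + g i) \<le> ?N f + ?N g"
    unfolding a_def[symmetric] b_def[symmetric]
    by (rule lp_if_sums_le(2)[OF p _ _ sums]) (use out ab in auto)
qed

lemma lp_scale:
  assumes p: "1 \<le> p" and f: "f \<in> vecs (lp_space p I)"
  shows "(\<lambda>i. a * f i) \<in> vecs (lp_space p I)"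
    "nrm (lp_space p I) (\<lambda>i. a * f i) = norm a * nrm (lp_space p I) f"
proof -
  have eq: "norm (a * f i) powr p = norm a powr p * norm (f i) powr p" for i
    by (simp add: norm_mult powr_mult)
  show "(\<lambda>i. a * f i) \<in> vecs (lp_space p I)"
    using f unfolding lp_vecs eq by (auto intro: summable_on_cmult_right)
  have "nrm (lp_space p I) (\<lambda>i. a * f i) = (norm a powr p * (\<Sum>\<^sub>\<infinity>i\<in>I. norm (f i) powr p)) powr (1 / p)"
    unfolding lp_nrm eq by (simp only: infsum_cmult_right')
  also have "\<dots> = (norm a powr p) powr (1 / p) * nrm (lp_space p I) f"
    by (simp add: powr_mult lp_nrm infsum_nonneg)
  also have "(norm a powr p) powr (1 / p) = norm a" using p by (simp add: powr_powr)
  finally show "nrm (lp_space p I) (\<lambda>i. a * f i) = norm a * nrm (lp_space p I) f" .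
qed

lemma young_powr:
  fixes a b p :: real
  assumes "1 \<le> p" "0 \<le> a" "0 \<le> b"
  shows "a powr (p - 1) * b \<le> (1 - 1 / p) * a powr p + 1 / p * b powr p"
proof (cases "a = 0 \<or> b = 0")
  case True
  then have "a powr (p - 1) * b = 0" by auto
  moreover have "0 \<le> (1 - 1 / p) * a powr p" "0 \<le> 1 / p * b powr p" using assms by auto
  ultimately show ?thesis by linarith
next
  case False
  then have "(a powr p) powr (1 - 1 / p) * (b powr p) powr (1 / p) \<le> (1 - 1 / p) * a powr p + 1 / p * b powr p"
    using assms by (intro Youngs_inequality_0) (auto simp: field_simps)
  moreover have "p * (1 - 1 / p) = p - 1" using assms by (simp add: field_simps)
  ultimately show ?thesis using assms by (simp add: powr_powr)
qed

text \<open>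
  The equality case of Hoelder's inequality: the functional with coefficients
  \<open>norm (y j) powr p / y j\<close>, suitably rescaled.
\<close>

lemma lp_norming:
  fixes y :: "'i \<Rightarrow> 'k::real_normed_field"
  assumes p: "1 \<le> p" and D: "finite D" "D \<subseteq> I"
  shows "\<exists>c. (\<Sum>j\<in>D. c j * y j) = of_real (nrm (lp_space p I) (restr D y)) \<and>
    (\<forall>z. norm (\<Sum>j\<in>D. c j * z j) \<le> nrm (lp_space p I) (restr D z))"
proof -
  let ?N = "nrm (lp_space p I)"
  define A where "A = ?N (restr D y)"
  have Ap: "A powr p = (\<Sum>j\<in>D. norm (y j) powr p)" unfolding A_def by (rule lp_restr_finite(2)[OF p D])
  have A0: "0 \<le> A" by (simp add: A_def lp_nrm_nonneg)
  define c :: "'i \<Rightarrow> 'k" where "c j = of_real (norm (y j) powr p / A powr (p - 1)) / y j" for j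
  have "c j * y j = of_real (norm (y j) powr p / A powr (p - 1))" for j
    by (cases "y j = 0") (auto simp: c_def)
  then have "(\<Sum>j\<in>D. c j * y j) = of_real (\<Sum>j\<in>D. norm (y j) powr p / A powr (p - 1))" by simp
  also have "(\<Sum>j\<in>D. norm (y j) powr p / A powr (p - 1)) = A powr p / A powr (p - 1)"
    by (simp add: Ap sum_divide_distrib)
  also have "\<dots> = A" using A0 by (cases "A = 0") (auto simp flip: powr_diff)
  finally have norming_eq: "(\<Sum>j\<in>D. c j * y j) = of_real A" .
  have nc: "norm (c j) = (norm (y j) / A) powr (p - 1)" for j
  proof (cases "y j = 0")
    case False
    then have "norm (c j) = norm (y j) powr p / A powr (p - 1) / norm (y j)"
      by (simp add: c_def norm_divide norm_mult)
    also have "\<dots> = norm (y j) powr (p - 1) / A powr (p - 1)"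
      using False by (simp add: powr_diff)
    finally show ?thesis using A0 by (simp add: powr_divide)
  qed (simp add: c_def)
  have "norm (\<Sum>j\<in>D. c j * z j) \<le> ?N (restr D z)" for z
  proof -
    define Z where "Z = ?N (restr D z)"
    have Zp: "Z powr p = (\<Sum>j\<in>D. norm (z j) powr p)" unfolding Z_def by (rule lp_restr_finite(2)[OF p D])
    have Z0: "0 \<le> Z" by (simp add: Z_def lp_nrm_nonneg)
    have le: "norm (z j) \<le> Z" if "j \<in> D" for j
      using lp_coord_le[OF p lp_restr_finite(1)[OF p D, of z], of j] that D(2) by (auto simp: restr_def Z_def)
    show ?thesis
    proof (cases "A = 0 \<or> Z = 0")
      case True
      have "c j * z j = 0" if "j \<in> D" for j
        using True le[OF that] by (auto simp: c_def)
      then have "(\<Sum>j\<in>D. c j * z j) = 0" by (intro sum.neutral) blast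
      then show ?thesis using Z0 by (simp add: Z_def)
    next
      case False
      then have pos: "0 < A" "0 < Z" using A0 Z0 by auto
      have "norm (\<Sum>j\<in>D. c j * z j) \<le> (\<Sum>j\<in>D. norm (c j) * norm (z j))"
        by (rule order_trans[OF norm_sum]) (simp add: norm_mult)
      also have "\<dots> = Z * (\<Sum>j\<in>D. (norm (y j) / A) powr (p - 1) * (norm (z j) / Z))"
        unfolding sum_distrib_left using pos by (intro sum.cong) (auto simp: nc)
      also have "\<dots> \<le> Z * (\<Sum>j\<in>D. (1 - 1 / p) * (norm (y j) / A) powr p + 1 / p * (norm (z j) / Z) powr p)"
        using pos p by (intro mult_left_mono sum_mono young_powr) auto
      also have "(\<Sum>j\<in>D. (1 - 1 / p) * (norm (y j) / A) powr p + 1 / p * (norm (z j) / Z) powr p) =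
          (1 - 1 / p) * ((\<Sum>j\<in>D. norm (y j) powr p) / A powr p) + 1 / p * ((\<Sum>j\<in>D. norm (z j) powr p) / Z powr p)"
        using pos by (simp add: sum.distrib sum_distrib_left sum_divide_distrib powr_divide)
      also have "\<dots> = 1" using pos by (simp flip: Ap Zp)
      finally show ?thesis by (simp add: Z_def)
    qed
  qed
  then show ?thesis using norming_eq unfolding A_def by blast
qed

text \<open>
  Domination holds because the \<open>p\<close>-th power of the norm is additive over disjoint blocks.
\<close>

lemma disjoint_norm_lp:
  assumes I: "infinite I" and p: "1 \<le> p"
  shows "disjoint_norm (lp_space p :: 'i set \<Rightarrow> ('i, 'k::{real_normed_field, heine_borel}) nspace) I"
proof
  let ?E = "lp_space p :: 'i set \<Rightarrow> ('i, 'k) nspace"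
  show "infinite I" by fact
  show "f i = 0" if "f \<in> vecs (?E I)" "i \<notin> I" for f i using that by (simp add: lp_vecs)
  show "(\<lambda>i. 0) \<in> vecs (?E I)" by (simp add: lp_vecs)
  show "(\<lambda>i. f i + g i) \<in> vecs (?E I)" "nrm (?E I) (\<lambda>i. f i + g i) \<le> nrm (?E I) f + nrm (?E I) g"
    if "f \<in> vecs (?E I)" "g \<in> vecs (?E I)" for f g by (rule lp_add[OF p that])+
  show "(\<lambda>i. a * f i) \<in> vecs (?E I)" "nrm (?E I) (\<lambda>i. a * f i) = norm a * nrm (?E I) f"
    if "f \<in> vecs (?E I)" for a f by (rule lp_scale[OF p that])+
  show "unit_vec k \<in> vecs (?E I)" "nrm (?E I) (unit_vec k) = 1" if "k \<in> I" for k
  proof -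
    note fin = lp_finite_support[OF p, of "{k}" I "unit_vec k :: 'i \<Rightarrow> 'k"]
    show "unit_vec k \<in> vecs (?E I)" using fin(1) that by (simp add: unit_vec_def)
    have "nrm (?E I) (unit_vec k) powr p = 1" using fin(2) that by (simp add: unit_vec_def)
    then have "(nrm (?E I) (unit_vec k) powr p) powr (1 / p) = 1" by simp
    then show "nrm (?E I) (unit_vec k) = 1" using p lp_nrm_nonneg[of p I "unit_vec k :: 'i \<Rightarrow> 'k"] by (simp add: powr_powr)
  qed
  show "\<exists>R\<subseteq>I. finite R \<and> nrm (?E I) (restr (- R) f) < \<epsilon>" if f: "f \<in> vecs (?E I)" and "0 < \<epsilon>" for f \<epsilon>
  proof -
    let ?s = "\<lambda>i. norm (f i) powr p"
    have summable: "?s summable_on I" using f by (simp add: lp_vecs)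
    have "0 < (\<epsilon> / 2) powr p" using \<open>0 < \<epsilon>\<close> by simp
    then obtain R where R: "finite R" "R \<subseteq> I" "dist (sum ?s R) (infsum ?s I) \<le> (\<epsilon> / 2) powr p"
      using infsum_finite_approximation[OF summable] by blast
    have "nrm (?E I) (restr (- R) f) \<le> \<epsilon> / 2"
    proof (rule lp_if_sums_le(2)[OF p])
      fix F assume F: "finite F" "F \<subseteq> I"
      have "(\<Sum>i\<in>F. norm (restr (- R) f i) powr p) = (\<Sum>i\<in>F - R. ?s i)"
        using F(1) p by (intro sum.mono_neutral_cong_right) (auto simp: restr_def)
      also have "\<dots> = sum ?s (R \<union> F) - sum ?s R"
        using F(1) R(1) sum.union_disjoint[of R "F - R" ?s] by simp
      also have "\<dots> \<le> infsum ?s I - sum ?s R"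
        using finite_sum_le_infsum[OF summable, of "R \<union> F"] F R by simp
      also have "\<dots> \<le> (\<epsilon> / 2) powr p" using R(3) by (simp add: dist_real_def)
      finally show "(\<Sum>i\<in>F. norm (restr (- R) f i) powr p) \<le> (\<epsilon> / 2) powr p" .
    qed (use f \<open>0 < \<epsilon>\<close> in \<open>auto simp: lp_vecs restr_def\<close>)
    then show ?thesis using R \<open>0 < \<epsilon>\<close> by (intro exI[of _ R]) auto
  qed
  show "w \<in> vecs (?E I) \<and> nrm (?E I) w \<le> nrm (?E I) z"
    if z: "z \<in> vecs (?E I)" and disj: "disjoint_family_on B K" "disjoint_family_on C K"
      and B: "\<And>k. k \<in> K \<Longrightarrow> finite (B k) \<and> B k \<subseteq> I" and C: "\<And>k. k \<in> K \<Longrightarrow> finite (C k) \<and> C k \<subseteq> I"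
      and w: "\<And>i. i \<notin> (\<Union>k\<in>K. C k) \<Longrightarrow> w i = 0"
      and le: "\<And>k. k \<in> K \<Longrightarrow> nrm (?E I) (restr (C k) w) \<le> nrm (?E I) (restr (B k) z)"
    for z w :: "'i \<Rightarrow> 'k" and B C :: "'a \<Rightarrow> 'i set" and K
  proof -
    have block: "(\<Sum>i\<in>C k. norm (w i) powr p) \<le> (\<Sum>i\<in>B k. norm (z i) powr p)" if k: "k \<in> K" for k
    proof -
      have "nrm (?E I) (restr (C k) w) powr p \<le> nrm (?E I) (restr (B k) z) powr p"
        using le[OF k] p lp_nrm_nonneg by (intro powr_mono2) auto
      then show ?thesis using lp_restr_finite(2)[OF p] B[OF k] C[OF k] by metis
    qed
    have sums: "(\<Sum>i\<in>F. norm (w i) powr p) \<le> nrm (?E I) z powr p" if F: "finite F" "F \<subseteq> I" for F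
    proof -
      define k where "k i = (SOME k. k \<in> K \<and> i \<in> C k)" for i
      have k: "k i \<in> K" "i \<in> C (k i)" if "w i \<noteq> 0" for i
        using someI_ex[of "\<lambda>k. k \<in> K \<and> i \<in> C k"] w[of i] that unfolding k_def by blast+
      define K' where "K' = k ` {i\<in>F. w i \<noteq> 0}"
      have K': "finite K'" "K' \<subseteq> K" using F(1) k by (auto simp: K'_def)
      have disjK': "disjoint_family_on B K'" "disjoint_family_on C K'"
        using disj K'(2) disjoint_family_on_mono by blast+
      have "(\<Sum>i\<in>F. norm (w i) powr p) = (\<Sum>i\<in>{i\<in>F. w i \<noteq> 0}. norm (w i) powr p)"
        using F(1) by (intro sum.mono_neutral_right) auto
      also have "\<dots> \<le> (\<Sum>i\<in>(\<Union>l\<in>K'. C l). norm (w i) powr p)"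
      proof (rule sum_mono2)
        show "finite (\<Union>l\<in>K'. C l)" using K' C by blast
        show "{i\<in>F. w i \<noteq> 0} \<subseteq> (\<Union>l\<in>K'. C l)" using k by (auto simp: K'_def)
      qed simp
      also have "\<dots> = (\<Sum>l\<in>K'. \<Sum>i\<in>C l. norm (w i) powr p)"
        using K' C disjK'(2) by (intro sum.UNION_disjoint_family) auto
      also have "\<dots> \<le> (\<Sum>l\<in>K'. \<Sum>i\<in>B l. norm (z i) powr p)"
        using block K'(2) by (intro sum_mono) auto
      also have "\<dots> = (\<Sum>i\<in>(\<Union>l\<in>K'. B l). norm (z i) powr p)"
        using K' B disjK'(1) by (intro sum.UNION_disjoint_family[symmetric]) auto
      also have "\<dots> \<le> nrm (?E I) z powr p"
        by (rule lp_sum_le[OF p z]) (use K' B in auto)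
      finally show ?thesis .
    qed
    have "w i = 0" if "i \<notin> I" for i using w C that by blast
    then show ?thesis using lp_if_sums_le[OF p _ lp_nrm_nonneg sums] by blast
  qed
  show "\<exists>c. (\<Sum>j\<in>D. c j * y j) = of_real (nrm (?E I) (restr D y)) \<and>
      (\<forall>z\<in>vecs (?E I). norm (\<Sum>j\<in>D. c j * z j) \<le> nrm (?E I) (restr D z))"
    if D: "finite D" "D \<subseteq> I" for D y
    using lp_norming[OF p D] by blast
  show vecs_K: "vecs (?E K) = {f \<in> vecs (?E I). \<forall>i. i \<notin> K \<longrightarrow> f i = 0}" if K: "K \<subseteq> I" "K \<noteq> {}" for K
  proof -
    have "(\<lambda>i. norm (f i) powr p) summable_on I \<longleftrightarrow> (\<lambda>i. norm (f i) powr p) summable_on K"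
      if "\<forall>i. i \<notin> K \<longrightarrow> f i = 0" for f :: "'i \<Rightarrow> 'k"
      by (rule summable_on_cong_neutral) (use that K in auto)
    then show ?thesis unfolding lp_vecs set_eq_iff mem_Collect_eq using K(1) by blast
  qed
  show "nrm (?E K) f = nrm (?E I) f" if K: "K \<subseteq> I" "K \<noteq> {}" "f \<in> vecs (?E K)" for K f
  proof -
    have "infsum (\<lambda>i. norm (f i) powr p) K = infsum (\<lambda>i. norm (f i) powr p) I"
      by (rule infsum_cong_neutral) (use K in \<open>auto simp: lp_vecs\<close>)
    then show ?thesis by (simp add: lp_nrm)
  qed
qed

lemma lp_diagonalizable:
  assumes I: "infinite I" and p: "1 \<le> p"
  shows "disjoint_norm.diagonalizable (lp_space p :: 'i set \<Rightarrow> ('i, 'k::{real_normed_field, heine_borel}) nspace) I"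
proof -
  interpret disjoint_norm "lp_space p :: 'i set \<Rightarrow> ('i, 'k) nspace" I by (rule disjoint_norm_lp[OF I p])
  show ?thesis
  proof (cases "p = 1")
    case True
    show ?thesis
    proof (rule diagonalizable_if_superadditive)
      fix f :: "'i \<Rightarrow> 'k" and A B :: "'i set" assume f: "f \<in> V" and AB: "A \<inter> B = {}"
      have N: "N g = (\<Sum>\<^sub>\<infinity>i\<in>I. norm (g i))" for g
        using True by (simp add: lp_nrm infsum_nonneg)
      have summable: "(\<lambda>i. norm (restr Q f i)) summable_on I" for Q
        using restr_in[OF f, of Q] True by (simp add: lp_vecs)
      have "norm (restr (A \<union> B) f i) = norm (restr A f i) + norm (restr B f i)" for i
        using AB by (auto simp: restr_def)
      then have "N (restr (A \<union> B) f) = N (restr A f) + N (restr B f)"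
        using infsum_add[OF summable[of A] summable[of B]] by (simp add: N)
      then show "N (restr A f) + N (restr B f) \<le> N (restr (A \<union> B) f)" by simp
    qed
  next
    case False
    then have "1 < p" using p by simp
    have sublinear_indicators unfolding sublinear_indicators_def
    proof (intro allI impI)
      fix \<eta> :: real assume "\<eta> > 0"
      have "(\<lambda>n. real n powr (1 - p)) \<longlonglongrightarrow> 0"
        by (rule tendsto_neg_powr) (use \<open>1 < p\<close> in \<open>auto simp: filterlim_real_sequentially\<close>)
      then have "\<forall>\<^sub>F n in sequentially. real n powr (1 - p) < \<eta> powr p"
        by (rule order_tendstoD(2)) (use \<open>\<eta> > 0\<close> in simp)
      then have "\<forall>\<^sub>F n in sequentially. real n powr (1 - p) < \<eta> powr p \<and> 0 < n"
        using eventually_gt_at_top[of 0] by eventually_elim simp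
      then obtain n where n: "real n powr (1 - p) < \<eta> powr p" "0 < n"
        unfolding eventually_sequentially by blast
      have "real n = real n powr (1 - p) * real n powr p" using n(2) by (simp flip: powr_add)
      also have "\<dots> \<le> \<eta> powr p * real n powr p" using n(1) by (intro mult_right_mono) auto
      also have "\<dots> = (\<eta> * real n) powr p" using \<open>\<eta> > 0\<close> by (simp add: powr_mult)
      finally have np: "real n \<le> (\<eta> * real n) powr p" .
      have "N (\<lambda>i. if i \<in> F then 1 else 0) \<le> \<eta> * real n" if F: "F \<subseteq> I" "finite F" "card F = n" for F
      proof (rule lp_if_sums_le(2)[OF p])
        fix G assume "finite G" "G \<subseteq> I"
        have "(\<Sum>i\<in>G. norm (if i \<in> F then 1 else 0 :: 'k) powr p) = (\<Sum>i\<in>G \<inter> F. 1)"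
          using \<open>finite G\<close> by (intro sum.mono_neutral_cong_right) auto
        also have "\<dots> \<le> real n" using F card_mono[of F "G \<inter> F"] by simp
        finally show "(\<Sum>i\<in>G. norm (if i \<in> F then 1 else 0 :: 'k) powr p) \<le> (\<eta> * real n) powr p"
          using np by linarith
      qed (use F \<open>\<eta> > 0\<close> in auto)
      then show "\<exists>n>0. \<forall>F\<subseteq>I. finite F \<longrightarrow> card F = n \<longrightarrow> N (\<lambda>i. if i \<in> F then 1 else 0) \<le> \<eta> * real n"
        using n(2) by blast
    qed
    then show ?thesis by (rule diagonalizable_if_sublinear_indicators)
  qed
qed

section \<open>Classification of the closed ideals\<close>

text \<open>
  The cardinal \<open>\<kappa>\<close> is represented by the cardinal order \<open>|K|\<close>, whose field is \<open>K\<close>.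
\<close>

lemma cardinal_of_closed_ideal:
  fixes E :: "'i set \<Rightarrow> ('i, 'k::{real_normed_field, heine_borel}) nspace" and \<Lambda> :: "'i rel"
  assumes \<Lambda>: "Cinfinite \<Lambda>" and E: "disjoint_norm E (Field \<Lambda>)"
    and diag: "disjoint_norm.diagonalizable E (Field \<Lambda>)"
    and J: "nonzero_proper_closed_ideal (E (Field \<Lambda>)) J"
  shows "\<exists>\<kappa> :: 'i rel. Cinfinite \<kappa> \<and> \<kappa> \<le>o \<Lambda> \<and> J = S_ops (E (Field \<kappa>)) (E (Field \<Lambda>))"
proof -
  obtain K where K: "K \<subseteq> Field \<Lambda>" "infinite K" "J = S_ops (E K) (E (Field \<Lambda>))"
    by (rule disjoint_norm.closed_ideals_are_S_ops[OF E diag J])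
  have field: "|Field \<Lambda>| =o \<Lambda>" using \<Lambda> by (simp add: card_of_Field_ordIso)
  have "|K| \<le>o \<Lambda>" by (rule ordLeq_ordIso_trans[OF card_of_mono1[OF K(1)] field])
  moreover have "Cinfinite |K|" using K(2) by (simp add: cinfinite_def Field_card_of card_of_card_order_on)
  ultimately show ?thesis using K(3) by (intro exI[of _ "|K|"]) (simp add: Field_card_of)
qed

theorem theorem1p5:
  fixes \<Lambda> :: "'i rel" and p :: real
  assumes "Cinfinite \<Lambda>" and "1 \<le> p"
  shows
    "(\<forall>J :: ('i, real) operator set.
        nonzero_proper_closed_ideal (c0_space (Field \<Lambda>)) J \<longrightarrow>
        (\<exists>\<kappa> :: 'i rel. Cinfinite \<kappa> \<and> \<kappa> \<le>o \<Lambda> \<and>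
           J = S_ops (c0_space (Field \<kappa>)) (c0_space (Field \<Lambda>)))) \<and>
     (\<forall>J :: ('i, real) operator set.
        nonzero_proper_closed_ideal (lp_space p (Field \<Lambda>)) J \<longrightarrow>
        (\<exists>\<kappa> :: 'i rel. Cinfinite \<kappa> \<and> \<kappa> \<le>o \<Lambda> \<and>
           J = S_ops (lp_space p (Field \<kappa>)) (lp_space p (Field \<Lambda>)))) \<and>
     (\<forall>J :: ('i, complex) operator set.
        nonzero_proper_closed_ideal (c0_space (Field \<Lambda>)) J \<longrightarrow>
        (\<exists>\<kappa> :: 'i rel. Cinfinite \<kappa> \<and> \<kappa> \<le>o \<Lambda> \<and>
           J = S_ops (c0_space (Field \<kappa>)) (c0_space (Field \<Lambda>)))) \<and>
     (\<forall>J :: ('i, complex) operator set.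
        nonzero_proper_closed_ideal (lp_space p (Field \<Lambda>)) J \<longrightarrow>
        (\<exists>\<kappa> :: 'i rel. Cinfinite \<kappa> \<and> \<kappa> \<le>o \<Lambda> \<and>
           J = S_ops (lp_space p (Field \<kappa>)) (lp_space p (Field \<Lambda>))))"
proof -
  have inf: "infinite (Field \<Lambda>)" using assms(1) by (simp add: cinfinite_def)
  note c0 = cardinal_of_closed_ideal[OF assms(1) disjoint_norm_c0[OF inf] c0_diagonalizable[OF inf]]
  note lp = cardinal_of_closed_ideal[OF assms(1) disjoint_norm_lp[OF inf assms(2)]
      lp_diagonalizable[OF inf assms(2)]]
  show ?thesis by (intro conjI allI impI c0 lp)
qed

end
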